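(* Let $P(\lambda)=\sum_{j=0}^m A_j\lambda^j$ be an $n\times n$ matrix polynomial with $A_j\in\mathbb{C}^{n\times n}$ and $A_m$ nonsingular, let $w=\{w_0,w_1,\dots,w_m\}$ be nonnegative weights with $w_0>0$, and let $\Sigma=\{\mu_1,\mu_2,\dots,\mu_k\}$ be a given set of $k\le n$ distinct complex numbers. Then, with the notation of the context: (a) For any $\gamma>0$, $D_w(P,\Sigma)\ge\beta_{low}(P,\Sigma,\gamma)$. (b) If the quantities $\beta_1,\beta_2,\dots,\beta_k$ are nonzero, then for any $\gamma>0$ such that $\operatorname{rank}(V(\gamma))=k$, $D_w(P,\Sigma)\le\beta_{up}(P,\Sigma,\gamma)$ and the matrix polynomial $Q_\gamma(\lambda)=P(\lambda)+\Delta_\gamma(\lambda)$ lies on the boundary of $\mathcal{B}(P,\beta_{up}(P,\Sigma,\gamma),w)$.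
   Context: The spectrum $\sigma(Q)$ of a matrix polynomial $Q(\lambda)$ is the set of $\mu\in\mathbb{C}$ for which $Q(\mu)v=0$ for some nonzero $v\in\mathbb{C}^n$. $\|\cdot\|_2$ is the spectral norm; singular values $s_1\ge s_2\ge\cdots$ are in nonincreasing order. Put $w(\lambda)=\sum_{j=0}^m w_j\lambda^j$ and $\rho=nk-k+1$. Class of perturbations: $\mathcal{B}(P,\varepsilon,w)=\{Q(\lambda)=\sum_{j=0}^m(A_j+\Delta_j)\lambda^j:\ \Delta_j\in\mathbb{C}^{n\times n},\ \|\Delta_j\|_2\le\varepsilon w_j,\ j=0,\dots,m\}$, regarded as a subset of the space of $n\times n$ matrix polynomials of degree at most $m$. Distance: $D_w(P,\Sigma)=\min\{\varepsilon\ge0:\ \exists\,Q(\lambda)\in\mathcal{B}(P,\varepsilon,w)\text{ such that }\Sigma\subseteq\sigma(Q)\}$. Divided differences: $P[\mu_i]=P(\mu_i)$ and $P[\mu_i,\dots,\mu_{i+t}]=\dfrac{P[\mu_i,\dots,\mu_{i+t-1}]-P[\mu_{i+1},\dots,\mu_{i+t}]}{\mu_i-\mu_{i+t}}$ for $t\ge1$. $F_\gamma[P,\Sigma]$ is the $nk\times nk$ block lower triangular matrix whose $(i,j)$th $n\times n$ block is $\gamma^{i-j}P[\mu_j,\mu_{j+1},\dots,\mu_i]$ for $i\ge j$ (so $P(\mu_i)$ on the diagonal) and $0$ for $i<j$. Lower bound. Define nonnegative quantities $\varpi[\mu_i]=w(|\mu_i|)$ for $i=1,\dots,k$; $\varpi[\mu_i,\mu_{i+1}]=\sum_{j=0}^m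 w_j\dfrac{|\mu_i^j-\mu_{i+1}^j|}{|\mu_i-\mu_{i+1}|}$ for $i=1,\dots,k-1$; and recursively, for $i=1,\dots,k-2$ and $t=2,\dots,k-i$, $\varpi[\mu_i,\dots,\mu_{i+t}]=\dfrac{\varpi[\mu_i,\dots,\mu_{i+t-1}]+\varpi[\mu_{i+1},\dots,\mu_{i+t}]}{|\mu_i-\mu_{i+t}|}$. Let $F_\gamma[\varpi,\Sigma]$ be the $k\times k$ lower triangular matrix with $(i,j)$ entry $\gamma^{i-j}\varpi[\mu_j,\dots,\mu_i]$ for $i\ge j$ and $0$ for $i<j$. Then $$\beta_{low}(P,\Sigma,\gamma)=\frac{s_\rho(F_\gamma[P,\Sigma])}{\|F_\gamma[\varpi,\Sigma]\|_2}.$$ Upper bound. Let $u(\gamma),v(\gamma)\in\mathbb{C}^{nk}$ be a pair of left and right singular vectors of $F_\gamma[P,\Sigma]$ for the singular value $s_\rho(F_\gamma[P,\Sigma])$ (i.e. unit vectors with $F_\gamma[P,\Sigma]v=s_\rho u$ and $F_\gamma[P,\Sigma]^*u=s_\rho v$), partitioned into blocks $u_j(\gamma),v_j(\gamma)\in\mathbb{C}^n$, $j=1,\dots,k$. Let $V(\gamma)=[\,v_1(\gamma)\;\cdots\;v_k(\gamma)\,]\in\mathbb{C}^{n\times k}$. For $i\neq j$ let $\theta_{i,j}=\gamma/(\mu_i-\mu_j)$. Set $\hat v_1(\gamma)=v_1(\gamma)$, $\hat u_1(\gamma)=u_1(\gamma)$, and for $p=2,\dots,k$, $$\hat v_p(\gamma)=v_p(\gamma)+\sum_{i=1}^{p-1}(-1)^i\Big(\prod_{j=p-i}^{p-1}\theta_{j,p}\Big)v_{p-i}(\gamma),\qquad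 \hat u_p(\gamma)=u_p(\gamma)+\sum_{i=1}^{p-1}(-1)^i\Big(\prod_{j=p-i}^{p-1}\theta_{j,p}\Big)u_{p-i}(\gamma).$$ Let $\hat U(\gamma)=[\,\hat u_1(\gamma)\;\cdots\;\hat u_k(\gamma)\,]$ and $\hat V(\gamma)=[\,\hat v_1(\gamma)\;\cdots\;\hat v_k(\gamma)\,]$. For $i,s=1,\dots,k$ let $$\alpha_{i,s}=\frac{1}{w(|\mu_i|)}\sum_{j=0}^m\Big(\frac{\bar\mu_i}{|\mu_i|}\Big)^j\mu_s^j w_j,\qquad \beta_s=\frac1k\sum_{i=1}^k\alpha_{i,s}.$$ Convention: if $\mu_i=0$, then $(\bar\mu_i/|\mu_i|)^j$ is read as $1$ for $j=0$ and $0$ for $j\ge1$ (so that $\alpha_{i,s}=1$). When all $\beta_s\ne0$, define the $n\times n$ matrix $$\Delta_\gamma=-s_\rho(F_\gamma[P,\Sigma])\,\hat U(\gamma)\,\mathrm{diag}\Big\{\frac1{\beta_1},\dots,\frac1{\beta_k}\Big\}\hat V(\gamma)^\dagger,$$ where $\dagger$ denotes the Moore–Penrose pseudoinverse, and $$\Delta_\gamma(\lambda)=\sum_{j=0}^m\Delta_{\gamma,j}\lambda^j,\quad \Delta_{\gamma,j}=\frac1k\sum_{i=1}^k\Big(\frac{1}{w(|\mu_i|)}\Big(\frac{\bar\mu_i}{|\mu_i|}\Big)^j w_j\Big)\Delta_\gamma,\qquad \beta_{up}(P,\Sigma,\gamma)=\frac1k\sum_{i=1}^k\frac{1}{w(|\mu_i|)}\,\|\Delta_\gamma\|_2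 .$$ *)

theory Defs
  imports
    "HOL-Analysis.Abstract_Metric_Spaces"
    "HOL-Analysis.L2_Norm"
    "Jordan_Normal_Form.Schur_Decomposition"
    "Jordan_Normal_Form.DL_Rank"
begin

section \<open>Norms, singular values, pseudoinverse\<close>

definition vec_norm2 :: "complex vec \<Rightarrow> real" where
  "vec_norm2 x = L2_set (\<lambda>i. cmod (x $ i)) {..<dim_vec x}"

definition spectral_norm :: "complex mat \<Rightarrow> real" where
  "spectral_norm A = Sup {vec_norm2 (A *\<^sub>v x) | x. x \<in> carrier_vec (dim_col A) \<and> vec_norm2 x \<le> 1}"

lemma vec_norm2_mult_le:
  assumes "x \<in> carrier_vec (dim_col A)" "vec_norm2 x \<le> 1"
  shows "vec_norm2 (A *\<^sub>v x) \<le> (\<Sum>r<dim_row A. \<Sum>c<dim_col A. cmod (A $$ (r, c)))"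
proof -
  have x1: "cmod (x $ c) \<le> 1" if "c < dim_col A" for c
  proof -
    have "cmod (x $ c) \<le> vec_norm2 x"
      unfolding vec_norm2_def using that assms(1)
      by (intro member_le_L2_set) auto
    with assms(2) show ?thesis by simp
  qed
  have "vec_norm2 (A *\<^sub>v x) \<le> (\<Sum>r<dim_row A. cmod ((A *\<^sub>v x) $ r))"
    unfolding vec_norm2_def by (rule order_trans[OF L2_set_le_sum]) auto
  also have "\<dots> \<le> (\<Sum>r<dim_row A. \<Sum>c<dim_col A. cmod (A $$ (r, c)))"
  proof (rule sum_mono)
    fix r assume r: "r \<in> {..<dim_row A}"
    have "(A *\<^sub>v x) $ r = (\<Sum>c<dim_col A. A $$ (r, c) * x $ c)"
      using r assms(1) by (auto simp: scalar_prod_def atLeast0LessThan intro!: sum.cong)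
    also have "cmod \<dots> \<le> (\<Sum>c<dim_col A. cmod (A $$ (r, c) * x $ c))"
      by (rule norm_sum)
    also have "\<dots> \<le> (\<Sum>c<dim_col A. cmod (A $$ (r, c)))"
      by (rule sum_mono) (auto simp: norm_mult intro!: mult_left_le x1)
    finally show "cmod ((A *\<^sub>v x) $ r) \<le> (\<Sum>c<dim_col A. cmod (A $$ (r, c)))" .
  qed
  finally show ?thesis .
qed

lemma spectral_norm_upper:
  assumes "x \<in> carrier_vec (dim_col A)" "vec_norm2 x \<le> 1"
  shows "vec_norm2 (A *\<^sub>v x) \<le> spectral_norm A"
  unfolding spectral_norm_def
  using assms
  by (intro cSup_upper bdd_aboveI[where M = "\<Sum>r<dim_row A. \<Sum>c<dim_col A. cmod (A $$ (r, c))"])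
    (auto simp: vec_norm2_mult_le)

lemma spectral_norm_least:
  assumes "\<And>x. x \<in> carrier_vec (dim_col A) \<Longrightarrow> vec_norm2 x \<le> 1 \<Longrightarrow> vec_norm2 (A *\<^sub>v x) \<le> b"
  shows "spectral_norm A \<le> b"
  unfolding spectral_norm_def
proof (rule cSup_least)
  have "0\<^sub>v (dim_col A) \<in> carrier_vec (dim_col A) \<and> vec_norm2 (0\<^sub>v (dim_col A)) \<le> 1"
    by (auto simp: vec_norm2_def L2_set_def)
  then show "{vec_norm2 (A *\<^sub>v x) | x. x \<in> carrier_vec (dim_col A) \<and> vec_norm2 x \<le> 1} \<noteq> {}"
    by blast
qed (use assms in auto)

lemma spectral_norm_nonneg: "0 \<le> spectral_norm A"
proof -
  have "0 \<le> vec_norm2 (A *\<^sub>v 0\<^sub>v (dim_col A))"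
    by (simp add: vec_norm2_def L2_set_nonneg)
  also have "\<dots> \<le> spectral_norm A"
    by (rule spectral_norm_upper) (auto simp: vec_norm2_def L2_set_def)
  finally show ?thesis .
qed

lemma spectral_norm_triangle:
  assumes "A \<in> carrier_mat nr nc" "B \<in> carrier_mat nr nc"
  shows "spectral_norm (A + B) \<le> spectral_norm A + spectral_norm B"
proof (rule spectral_norm_least)
  fix x assume x: "x \<in> carrier_vec (dim_col (A + B))" "vec_norm2 x \<le> 1"
  have "vec_norm2 ((A + B) *\<^sub>v x) = vec_norm2 (A *\<^sub>v x + B *\<^sub>v x)"
    using assms x by (simp add: add_mult_distrib_mat_vec)
  also have "\<dots> = L2_set (\<lambda>i. cmod ((A *\<^sub>v x) $ i + (B *\<^sub>v x) $ i)) {..<nr}"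
    unfolding vec_norm2_def using assms by (intro L2_set_cong) auto
  also have "\<dots> \<le> L2_set (\<lambda>i. cmod ((A *\<^sub>v x) $ i) + cmod ((B *\<^sub>v x) $ i)) {..<nr}"
    by (intro L2_set_mono norm_triangle_ineq) auto
  also have "\<dots> \<le> L2_set (\<lambda>i. cmod ((A *\<^sub>v x) $ i)) {..<nr} + L2_set (\<lambda>i. cmod ((B *\<^sub>v x) $ i)) {..<nr}"
    by (rule L2_set_triangle_ineq)
  also have "\<dots> = vec_norm2 (A *\<^sub>v x) + vec_norm2 (B *\<^sub>v x)"
    unfolding vec_norm2_def using assms by simp
  also have "\<dots> \<le> spectral_norm A + spectral_norm B"
    using assms x by (intro add_mono spectral_norm_upper) auto
  finally show "vec_norm2 ((A + B) *\<^sub>v x) \<le> spectral_norm A + spectral_norm B" .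
qed

lemma spectral_norm_uminus: "spectral_norm (- A) = spectral_norm A"
proof -
  have "vec_norm2 (- A *\<^sub>v x) = vec_norm2 (A *\<^sub>v x)" if "x \<in> carrier_vec (dim_col A)" for x
    unfolding vec_norm2_def using that by (intro L2_set_cong) auto
  then show ?thesis
    unfolding spectral_norm_def by (metis (mono_tags, lifting) index_uminus_mat(3))
qed

lemma spectral_norm_zero: "spectral_norm (0\<^sub>m nr nc) = 0"
proof (rule antisym)
  show "spectral_norm (0\<^sub>m nr nc) \<le> 0"
    by (rule spectral_norm_least) (auto simp: vec_norm2_def L2_set_def)
qed (rule spectral_norm_nonneg)

lemma spectral_norm_eq_0D:
  assumes "A \<in> carrier_mat nr nc" "spectral_norm A = 0"
  shows "A = 0\<^sub>m nr nc"
proof (rule eq_matI)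
  fix r c assume "r < dim_row (0\<^sub>m nr nc :: complex mat)" "c < dim_col (0\<^sub>m nr nc :: complex mat)"
  then have rc: "r < nr" "c < nc" by auto
  have u: "vec_norm2 (unit_vec nc c) \<le> 1"
  proof -
    have "vec_norm2 (unit_vec nc c) = sqrt (\<Sum>i<nc. if i = c then 1 else 0)"
      unfolding vec_norm2_def L2_set_def using rc
      by (intro arg_cong[where f = sqrt] sum.cong) auto
    then show ?thesis using rc by simp
  qed
  have "cmod ((A *\<^sub>v unit_vec nc c) $ r) \<le> vec_norm2 (A *\<^sub>v unit_vec nc c)"
    unfolding vec_norm2_def using rc assms(1) by (intro member_le_L2_set) auto
  also have "\<dots> \<le> spectral_norm A"
    using u assms(1) by (intro spectral_norm_upper) auto
  finally have "(A *\<^sub>v unit_vec nc c) $ r = 0" using assms(2) by simp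
  then show "A $$ (r, c) = 0\<^sub>m nr nc $$ (r, c)" using rc assms(1) by simp
qed (use assms in auto)

text \<open>
  Square roots of the eigenvalues of the Gram matrix, repeated according to algebraic multiplicity,
  in nonincreasing order. The eigenvalues are real, so taking the real part is harmless.
\<close>

definition singular_values :: "complex mat \<Rightarrow> real list" where
  "singular_values A = rev (sorted_list_of_multiset
     (image_mset (\<lambda>e. sqrt (Re e)) (proots (char_poly (mat_adjoint A * A)))))"

text \<open>Numbering starts at 1.\<close>

definition singular_value :: "complex mat \<Rightarrow> nat \<Rightarrow> real" where
  "singular_value A i = singular_values A ! (i - 1)"

definition singular_pair :: "complex mat \<Rightarrow> real \<Rightarrow> complex vec \<Rightarrow> complex vec \<Rightarrow> bool" where
  "singular_pair A s u v \<longleftrightarrow>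
     u \<in> carrier_vec (dim_row A) \<and> v \<in> carrier_vec (dim_col A) \<and>
     vec_norm2 u = 1 \<and> vec_norm2 v = 1 \<and>
     A *\<^sub>v v = complex_of_real s \<cdot>\<^sub>v u \<and> mat_adjoint A *\<^sub>v u = complex_of_real s \<cdot>\<^sub>v v"

definition is_pinv :: "complex mat \<Rightarrow> complex mat \<Rightarrow> bool" where
  "is_pinv A X \<longleftrightarrow> X \<in> carrier_mat (dim_col A) (dim_row A) \<and>
     A * X * A = A \<and> X * A * X = X \<and>
     mat_adjoint (A * X) = A * X \<and> mat_adjoint (X * A) = X * A"

definition pinv :: "complex mat \<Rightarrow> complex mat" where
  "pinv A = (THE X. is_pinv A X)"

section \<open>Matrix polynomials\<close>

text \<open>
  An \<open>n \<times> n\<close> matrix polynomial of degree at most \<open>m\<close> is its coefficient sequence,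
  extended by zero matrices beyond \<open>m\<close>.
\<close>

type_synonym matpoly = "nat \<Rightarrow> complex mat"

definition matpolys :: "nat \<Rightarrow> nat \<Rightarrow> matpoly set" where
  "matpolys n m = {Q. (\<forall>j. Q j \<in> carrier_mat n n) \<and> (\<forall>j>m. Q j = 0\<^sub>m n n)}"

definition eval_matpoly :: "nat \<Rightarrow> nat \<Rightarrow> matpoly \<Rightarrow> complex \<Rightarrow> complex mat" where
  "eval_matpoly n m Q x = mat n n (\<lambda>(r, c). \<Sum>j\<le>m. Q j $$ (r, c) * x ^ j)"

definition spectrum_matpoly :: "nat \<Rightarrow> nat \<Rightarrow> matpoly \<Rightarrow> complex set" where
  "spectrum_matpoly n m Q =
     {x. \<exists>v \<in> carrier_vec n. v \<noteq> 0\<^sub>v n \<and> eval_matpoly n m Q x *\<^sub>v v = 0\<^sub>v n}"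

text \<open>
  The space of matrix polynomials is finite-dimensional, so every norm induces the same topology;
  we take the sum of the spectral norms of the coefficients. The difference is written entrywise
  because the locale \<open>Metric_space\<close> requires symmetry also outside the carrier, where \<open>-\<close> takes the
  dimensions of its second argument.
\<close>

definition matpoly_dist :: "nat \<Rightarrow> nat \<Rightarrow> matpoly \<Rightarrow> matpoly \<Rightarrow> real" where
  "matpoly_dist n m Q R =
     (\<Sum>j\<le>m. spectral_norm (mat n n (\<lambda>(r, c). Q j $$ (r, c) - R j $$ (r, c))))"

lemma Metric_space_matpolys: "Metric_space (matpolys n m) (matpoly_dist n m)"
proof
  define D where "D Q R j = mat n n (\<lambda>(r, c). Q j $$ (r, c) - R j $$ (r, c))"
    for Q R :: matpoly and j
  have dist: "matpoly_dist n m Q R = (\<Sum>j\<le>m. spectral_norm (D Q R j))" for Q R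
    by (simp add: matpoly_dist_def D_def)
  have [simp]: "D Q R j \<in> carrier_mat n n" for Q R j by (simp add: D_def)
  fix Q R S :: matpoly
  show "0 \<le> matpoly_dist n m Q R"
    by (simp add: dist sum_nonneg spectral_norm_nonneg)
  have "D Q R j = - D R Q j" for j by (rule eq_matI) (auto simp: D_def)
  then show "matpoly_dist n m Q R = matpoly_dist n m R Q"
    by (simp add: dist spectral_norm_uminus)
  have "D Q S j = D Q R j + D R S j" for j by (rule eq_matI) (auto simp: D_def)
  then have "spectral_norm (D Q S j) \<le> spectral_norm (D Q R j) + spectral_norm (D R S j)" for j
    by (simp add: spectral_norm_triangle[where nr = n and nc = n])
  then show "matpoly_dist n m Q S \<le> matpoly_dist n m Q R + matpoly_dist n m R S"
    unfolding dist sum.distrib[symmetric] by (rule sum_mono)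
  assume Q: "Q \<in> matpolys n m" and R: "R \<in> matpolys n m"
  then have QR: "Q j \<in> carrier_mat n n" "R j \<in> carrier_mat n n" for j
    by (auto simp: matpolys_def)
  show "matpoly_dist n m Q R = 0 \<longleftrightarrow> Q = R"
  proof
    assume "matpoly_dist n m Q R = 0"
    then have "D Q R j = 0\<^sub>m n n" if "j \<le> m" for j
      using that by (intro spectral_norm_eq_0D) (auto simp: dist sum_nonneg_eq_0_iff spectral_norm_nonneg)
    then have 0: "D Q R j $$ (r, c) = 0" if "j \<le> m" "r < n" "c < n" for j r c
      using that by simp
    have "Q j = R j" for j
    proof (cases "j \<le> m")
      case True
      show ?thesis
        using 0[OF True] QR[of j] by (intro eq_matI) (auto simp: D_def)
    next
      case False
      then show ?thesis using Q R by (simp add: matpolys_def)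
    qed
    then show "Q = R" by blast
  next
    assume "Q = R"
    then have "D Q R j = 0\<^sub>m n n" for j by (intro eq_matI) (auto simp: D_def)
    then show "matpoly_dist n m Q R = 0" by (simp add: dist spectral_norm_zero)
  qed
qed

abbreviation matpoly_topology :: "nat \<Rightarrow> nat \<Rightarrow> matpoly topology" where
  "matpoly_topology n m \<equiv> Metric_space.mtopology (matpolys n m) (matpoly_dist n m)"

definition perturbations :: "nat \<Rightarrow> nat \<Rightarrow> matpoly \<Rightarrow> real \<Rightarrow> (nat \<Rightarrow> real) \<Rightarrow> matpoly set" where
  "perturbations n m P \<epsilon> w =
     {\<lambda>j. P j + \<Delta> j | \<Delta>. \<Delta> \<in> matpolys n m \<and> (\<forall>j\<le>m. spectral_norm (\<Delta> j) \<le> \<epsilon> * w j)}"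

definition dist_spectrum :: "nat \<Rightarrow> nat \<Rightarrow> matpoly \<Rightarrow> (nat \<Rightarrow> real) \<Rightarrow> complex set \<Rightarrow> real" where
  "dist_spectrum n m P w S =
     (LEAST \<epsilon>. 0 \<le> \<epsilon> \<and> (\<exists>Q \<in> perturbations n m P \<epsilon> w. S \<subseteq> spectrum_matpoly n m Q))"

section \<open>Lower bound\<close>

text \<open>
  The prescribed eigenvalues are \<open>\<mu> 1, \<dots>, \<mu> k\<close>, and
  \<open>divdiff n m P \<mu> i t\<close> is \<open>P[\<mu>\<^sub>i, \<dots>, \<mu>\<^sub>i\<^sub>+\<^sub>t]\<close>; similarly for \<open>varpi\<close>.
\<close>

fun divdiff :: "nat \<Rightarrow> nat \<Rightarrow> matpoly \<Rightarrow> (nat \<Rightarrow> complex) \<Rightarrow> nat \<Rightarrow> nat \<Rightarrow> complex mat" where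
  "divdiff n m P \<mu> i 0 = eval_matpoly n m P (\<mu> i)"
| "divdiff n m P \<mu> i (Suc t) =
     (1 / (\<mu> i - \<mu> (i + Suc t))) \<cdot>\<^sub>m (divdiff n m P \<mu> i t - divdiff n m P \<mu> (Suc i) t)"

text \<open>Rows and columns of the library's matrices are numbered from 0, blocks from 1.\<close>

definition F_mat :: "nat \<Rightarrow> nat \<Rightarrow> nat \<Rightarrow> matpoly \<Rightarrow> (nat \<Rightarrow> complex) \<Rightarrow> real \<Rightarrow> complex mat" where
  "F_mat n m k P \<mu> \<gamma> = mat (n * k) (n * k) (\<lambda>(r, c).
     let i = r div n + 1; j = c div n + 1 in
     if j \<le> i then complex_of_real \<gamma> ^ (i - j) * divdiff n m P \<mu> j (i - j) $$ (r mod n, c mod n)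
     else 0)"

definition s_rho :: "nat \<Rightarrow> nat \<Rightarrow> nat \<Rightarrow> matpoly \<Rightarrow> (nat \<Rightarrow> complex) \<Rightarrow> real \<Rightarrow> real" where
  "s_rho n m k P \<mu> \<gamma> = singular_value (F_mat n m k P \<mu> \<gamma>) (n * k - k + 1)"

definition weight :: "nat \<Rightarrow> (nat \<Rightarrow> real) \<Rightarrow> real \<Rightarrow> real" where
  "weight m w x = (\<Sum>j\<le>m. w j * x ^ j)"

fun varpi :: "nat \<Rightarrow> (nat \<Rightarrow> real) \<Rightarrow> (nat \<Rightarrow> complex) \<Rightarrow> nat \<Rightarrow> nat \<Rightarrow> real" where
  "varpi m w \<mu> i 0 = weight m w (cmod (\<mu> i))"
| "varpi m w \<mu> i (Suc 0) =
     (\<Sum>j\<le>m. w j * (cmod (\<mu> i ^ j - \<mu> (Suc i) ^ j) / cmod (\<mu> i - \<mu> (Suc i))))"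
| "varpi m w \<mu> i (Suc (Suc t)) =
     (varpi m w \<mu> i (Suc t) + varpi m w \<mu> (Suc i) (Suc t)) / cmod (\<mu> i - \<mu> (i + Suc (Suc t)))"

definition F_varpi :: "nat \<Rightarrow> nat \<Rightarrow> (nat \<Rightarrow> real) \<Rightarrow> (nat \<Rightarrow> complex) \<Rightarrow> real \<Rightarrow> complex mat" where
  "F_varpi m k w \<mu> \<gamma> = mat k k (\<lambda>(r, c).
     let i = r + 1; j = c + 1 in
     if j \<le> i then complex_of_real (\<gamma> ^ (i - j) * varpi m w \<mu> j (i - j)) else 0)"

definition beta_low ::
  "nat \<Rightarrow> nat \<Rightarrow> nat \<Rightarrow> matpoly \<Rightarrow> (nat \<Rightarrow> real) \<Rightarrow> (nat \<Rightarrow> complex) \<Rightarrow> real \<Rightarrow> real" where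
  "beta_low n m k P w \<mu> \<gamma> = s_rho n m k P \<mu> \<gamma> / spectral_norm (F_varpi m k w \<mu> \<gamma>)"

section \<open>Upper bound\<close>

definition block :: "nat \<Rightarrow> complex vec \<Rightarrow> nat \<Rightarrow> complex vec" where
  "block n x j = vec n (\<lambda>r. x $ ((j - 1) * n + r))"

definition theta :: "(nat \<Rightarrow> complex) \<Rightarrow> real \<Rightarrow> nat \<Rightarrow> nat \<Rightarrow> complex" where
  "theta \<mu> \<gamma> i j = complex_of_real \<gamma> / (\<mu> i - \<mu> j)"

definition hat_block :: "nat \<Rightarrow> (nat \<Rightarrow> complex) \<Rightarrow> real \<Rightarrow> complex vec \<Rightarrow> nat \<Rightarrow> complex vec" where
  "hat_block n \<mu> \<gamma> x p = vec n (\<lambda>r. block n x p $ r +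
     (\<Sum>i = 1..<p. (-1) ^ i * (\<Prod>j = p - i..p - 1. theta \<mu> \<gamma> j p) * block n x (p - i) $ r))"

definition block_mat :: "nat \<Rightarrow> nat \<Rightarrow> complex vec \<Rightarrow> complex mat" where
  "block_mat n k x = mat_of_cols n (map (block n x) [1..<Suc k])"

definition hat_mat :: "nat \<Rightarrow> nat \<Rightarrow> (nat \<Rightarrow> complex) \<Rightarrow> real \<Rightarrow> complex vec \<Rightarrow> complex mat" where
  "hat_mat n k \<mu> \<gamma> x = mat_of_cols n (map (hat_block n \<mu> \<gamma> x) [1..<Suc k])"

text \<open>
  If \<open>\<mu> i = 0\<close>, then \<open>(cnj (\<mu> i) / \<bar>\<mu> i\<bar>) ^ j\<close> is 1 for \<open>j = 0\<close> and 0 for \<open>j \<ge> 1\<close>,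
  because \<open>0 / 0 = 0\<close> and \<open>0 ^ 0 = 1\<close>. This is the intended convention.
\<close>

definition dir_coeff :: "nat \<Rightarrow> (nat \<Rightarrow> real) \<Rightarrow> (nat \<Rightarrow> complex) \<Rightarrow> nat \<Rightarrow> nat \<Rightarrow> complex" where
  "dir_coeff m w \<mu> i j =
     1 / complex_of_real (weight m w (cmod (\<mu> i))) *
     (cnj (\<mu> i) / complex_of_real (cmod (\<mu> i))) ^ j * complex_of_real (w j)"

definition alpha :: "nat \<Rightarrow> (nat \<Rightarrow> real) \<Rightarrow> (nat \<Rightarrow> complex) \<Rightarrow> nat \<Rightarrow> nat \<Rightarrow> complex" where
  "alpha m w \<mu> i s =
     1 / complex_of_real (weight m w (cmod (\<mu> i))) *
     (\<Sum>j\<le>m. (cnj (\<mu> i) / complex_of_real (cmod (\<mu> i))) ^ j * \<mu> s ^ j * complex_of_real (w j))"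

definition beta :: "nat \<Rightarrow> nat \<Rightarrow> (nat \<Rightarrow> real) \<Rightarrow> (nat \<Rightarrow> complex) \<Rightarrow> nat \<Rightarrow> complex" where
  "beta m k w \<mu> s = 1 / of_nat k * (\<Sum>i = 1..k. alpha m w \<mu> i s)"

definition Delta ::
  "nat \<Rightarrow> nat \<Rightarrow> nat \<Rightarrow> matpoly \<Rightarrow> (nat \<Rightarrow> real) \<Rightarrow> (nat \<Rightarrow> complex) \<Rightarrow> real
     \<Rightarrow> complex vec \<Rightarrow> complex vec \<Rightarrow> complex mat" where
  "Delta n m k P w \<mu> \<gamma> u v =
     (- complex_of_real (s_rho n m k P \<mu> \<gamma>)) \<cdot>\<^sub>m
       (hat_mat n k \<mu> \<gamma> u * mat_diag k (\<lambda>s. 1 / beta m k w \<mu> (s + 1)) * pinv (hat_mat n k \<mu> \<gamma> v))"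

definition Delta_poly ::
  "nat \<Rightarrow> nat \<Rightarrow> nat \<Rightarrow> matpoly \<Rightarrow> (nat \<Rightarrow> real) \<Rightarrow> (nat \<Rightarrow> complex) \<Rightarrow> real
     \<Rightarrow> complex vec \<Rightarrow> complex vec \<Rightarrow> matpoly" where
  "Delta_poly n m k P w \<mu> \<gamma> u v = (\<lambda>j.
     if j \<le> m
     then (1 / of_nat k * (\<Sum>i = 1..k. dir_coeff m w \<mu> i j)) \<cdot>\<^sub>m Delta n m k P w \<mu> \<gamma> u v
     else 0\<^sub>m n n)"

definition Q_poly ::
  "nat \<Rightarrow> nat \<Rightarrow> nat \<Rightarrow> matpoly \<Rightarrow> (nat \<Rightarrow> real) \<Rightarrow> (nat \<Rightarrow> complex) \<Rightarrow> real
     \<Rightarrow> complex vec \<Rightarrow> complex vec \<Rightarrow> matpoly" where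
  "Q_poly n m k P w \<mu> \<gamma> u v = (\<lambda>j. P j + Delta_poly n m k P w \<mu> \<gamma> u v j)"

definition beta_up ::
  "nat \<Rightarrow> nat \<Rightarrow> nat \<Rightarrow> matpoly \<Rightarrow> (nat \<Rightarrow> real) \<Rightarrow> (nat \<Rightarrow> complex) \<Rightarrow> real
     \<Rightarrow> complex vec \<Rightarrow> complex vec \<Rightarrow> real" where
  "beta_up n m k P w \<mu> \<gamma> u v =
     1 / real k * (\<Sum>i = 1..k. 1 / weight m w (cmod (\<mu> i))) * spectral_norm (Delta n m k P w \<mu> \<gamma> u v)"

end

theory Submission
  imports Defs
begin

text \<open>
  The matrix \<open>F\<^sub>\<gamma>[P, \<Sigma>]\<close> is \<open>P\<close> evaluated at the lower bidiagonal matrix with diagonal \<open>\<mu>\<^sub>1, \<dots>, \<mu>\<^sub>k\<close>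
  and subdiagonal \<open>\<gamma>\<close>, whose right and left eigenvectors are explicit products of the \<open>\<theta>\<close>'s.

  The right eigenvectors, tensored with null vectors of \<open>Q(\<mu>\<^sub>s)\<close>, give a \<open>k\<close>-dimensional kernel of
  \<open>F\<^sub>\<gamma>[Q, \<Sigma>]\<close> whenever \<open>\<Sigma> \<subseteq> \<sigma>(Q)\<close>. On it \<open>F\<^sub>\<gamma>[P, \<Sigma>]\<close> agrees with \<open>- F\<^sub>\<gamma>[\<Delta>, \<Sigma>]\<close>, whose norm is at most
  \<open>\<epsilon> \<parallel>F\<^sub>\<gamma>[\<varpi>, \<Sigma>]\<parallel>\<close>; so the \<open>k\<close>th smallest singular value of \<open>F\<^sub>\<gamma>[P, \<Sigma>]\<close> is at most that much, by Courant--Fischer.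

  The left eigenvectors are the coefficients of the hat transformation, so \<open>F\<^sub>\<gamma>[P, \<Sigma>] v = s u\<close> becomes
  \<open>P(\<mu>\<^sub>p) hat v\<^sub>p = s hat u\<^sub>p\<close>, and \<open>\<Delta>\<^sub>\<gamma>(\<mu>\<^sub>p) = \<beta>\<^sub>p \<Delta>\<^sub>\<gamma>\<close> cancels it. The constant coefficient of \<open>\<Delta>\<^sub>\<gamma>\<close> attains
  its norm bound, which puts \<open>Q\<^sub>\<gamma>\<close> on the boundary.
\<close>

text \<open>\<open>dist_spectrum\<close> is a \<open>LEAST\<close> over the reals and says nothing
  until a minimum is known to exist. A feasible radius exists because \<open>0 < w 0\<close> leaves
  the constant coefficient free and \<open>k \<le> n\<close> gives every prescribed eigenvalue a
  column of its own; below that radius the feasible data are compact, once the spectral condition is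
  restated by determinants. Both bounds then speak of a radius that is attained.

  \<open>singular_value\<close> is read off the roots of a characteristic polynomial, so the
  Courant--Fischer bound needs a unitary diagonalization of the Gram matrix to tie those roots to
  norms of vectors.

  The null vectors of \<open>Q(\<mu>\<^sub>s)\<close> for different \<open>s\<close> may coincide;
  the vectors built from them are still independent because the one for \<open>s\<close> is zero
  above block \<open>s\<close>.

  Both eigenvector identities are proved from the recursion of divided differences alone, by
  weighting the same sum in two ways, and are used for each matrix entry separately.

  The rank condition passes from \<open>V\<close> to its hat version because the hat transformation
  is unit triangular; it makes the pseudoinverse a left inverse.\<close>

unbundle no vec_syntax

section \<open>Adjoints and unitary diagonalization\<close>

lemma mat_adjoint_index [simp]:
  assumes "i < dim_col A" "j < dim_row A"
  shows "mat_adjoint A $$ (i, j) = conjugate (A $$ (j, i))"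
  using assms by (simp add: mat_adjoint_def mat_of_rows_index)

lemma dim_mat_adjoint [simp]:
  "dim_row (mat_adjoint A) = dim_col A" "dim_col (mat_adjoint A) = dim_row A"
  by (auto simp: mat_adjoint_def)

lemma mat_adjoint_carrier [simp, intro]:
  "A \<in> carrier_mat nr nc \<Longrightarrow> mat_adjoint A \<in> carrier_mat nc nr"
  by (intro carrier_matI) auto

lemma mat_adjoint_mat_adjoint [simp]: "mat_adjoint (mat_adjoint A) = A"
  by (rule eq_matI) auto

lemma mat_adjoint_mult:
  fixes A B :: "complex mat"
  assumes "A \<in> carrier_mat nr n" "B \<in> carrier_mat n nc"
  shows "mat_adjoint (A * B) = mat_adjoint B * mat_adjoint A"
  using assms by (intro eq_matI) (auto simp: scalar_prod_def sum_conjugate conjugate_dist_mul mult.commute)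

lemma cscalar_prod_mat_adjoint:
  fixes A :: "complex mat"
  assumes "A \<in> carrier_mat nr nc" "x \<in> carrier_vec nc" "y \<in> carrier_vec nr"
  shows "(A *\<^sub>v x) \<bullet>c y = x \<bullet>c (mat_adjoint A *\<^sub>v y)"
proof -
  have "(A *\<^sub>v x) \<bullet>c y = (\<Sum>i<nr. \<Sum>j<nc. A $$ (i, j) * x $ j * cnj (y $ i))"
    using assms by (auto simp: scalar_prod_def atLeast0LessThan sum_distrib_right intro!: sum.cong)
  also have "\<dots> = (\<Sum>j<nc. \<Sum>i<nr. A $$ (i, j) * x $ j * cnj (y $ i))"
    by (rule sum.swap)
  also have "\<dots> = x \<bullet>c (mat_adjoint A *\<^sub>v y)"
    using assms by (auto simp: scalar_prod_def atLeast0LessThan sum_distrib_left intro!: sum.cong)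
  finally show ?thesis .
qed

lemma vec_norm2_sq: "(vec_norm2 x)\<^sup>2 = (\<Sum>i<dim_vec x. (cmod (x $ i))\<^sup>2)"
  by (simp add: vec_norm2_def L2_set_def sum_nonneg)

lemma vec_norm2_nonneg [simp]: "0 \<le> vec_norm2 x"
  by (simp add: vec_norm2_def L2_set_nonneg)

lemma cscalar_prod_self: "x \<bullet>c x = complex_of_real ((vec_norm2 x)\<^sup>2)"
  by (simp add: vec_norm2_sq scalar_prod_def atLeast0LessThan complex_norm_square del: of_real_power)

lemma vec_norm2_eq_0:
  assumes "x \<in> carrier_vec n"
  shows "vec_norm2 x = 0 \<longleftrightarrow> x = 0\<^sub>v n"
  using assms by (auto simp: vec_norm2_def L2_set_eq_0_iff)

lemma vec_norm2_zero [simp]: "vec_norm2 (0\<^sub>v n) = 0"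
  by (simp add: vec_norm2_eq_0[of _ n])

text \<open>Gram--Schmidt on a basis starting with \<open>v\<close> keeps \<open>v\<close> as its
  first vector. It yields orthogonal but not normalized vectors, so each is divided by its norm;
  \<open>c\<close> is the norm of \<open>v\<close>.\<close>

lemma unitary_completion:
  fixes v :: "complex vec"
  assumes v: "v \<in> carrier_vec n" "v \<noteq> 0\<^sub>v n"
  obtains W c where "W \<in> carrier_mat n n" "mat_adjoint W * W = 1\<^sub>m n"
    "v = c \<cdot>\<^sub>v col W 0" "c \<noteq> 0"
proof -
  interpret cof_vec_space n "TYPE(complex)" .
  define b where "b = basis_completion v"
  define ws where "ws = gram_schmidt n b"
  note bc = basis_completion[OF v, folded b_def]
  have n: "n \<noteq> 0" using v by (metis carrier_vecD eq_vecI less_nat_zero_code index_zero_vec(2))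
  then obtain vs where bv: "b = v # vs" using bc(6,7) by (cases b) auto
  from gram_schmidt_result[OF bc(2,4,5) refl, folded ws_def] bc(6)
  have ws: "set ws \<subseteq> carrier_vec n" "corthogonal ws" "length ws = n" by auto
  have hd: "ws ! 0 = v"
  proof -
    have "ws \<noteq> []" using ws(3) n by auto
    then show ?thesis
      using gram_schmidt_hd[OF v(1), of vs, folded bv ws_def] by (metis hd_conv_nth)
  qed
  have wsc: "ws ! i \<in> carrier_vec n" if "i < n" for i using ws that by auto
  define N where "N i = complex_of_real (vec_norm2 (ws ! i))" for i
  have N: "ws ! i \<bullet>c ws ! i = (N i)\<^sup>2" for i by (simp add: N_def cscalar_prod_self)
  have N0: "N i \<noteq> 0" if "i < n" for i
    using corthogonalD[OF ws(2), of i i] that ws(3) N[of i] by auto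
  define W where "W = mat n n (\<lambda>(i, j). ws ! j $ i / N j)"
  have W: "W \<in> carrier_mat n n" by (simp add: W_def)
  have "mat_adjoint W * W = 1\<^sub>m n"
  proof (rule eq_matI)
    fix i j assume "i < dim_row (1\<^sub>m n :: complex mat)" "j < dim_col (1\<^sub>m n :: complex mat)"
    then have ij: "i < n" "j < n" by auto
    have "(mat_adjoint W * W) $$ (i, j) = (ws ! j \<bullet>c ws ! i) / (N i * N j)"
      using ij wsc[of i] W
      by (auto simp: W_def scalar_prod_def sum_divide_distrib N_def intro!: sum.cong)
    then show "(mat_adjoint W * W) $$ (i, j) = 1\<^sub>m n $$ (i, j)"
      using ij corthogonalD[OF ws(2), of j i] ws(3) N[of i] N0[of i]
      by (auto simp: power2_eq_square)
  qed (use W in auto)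
  moreover have "v = N 0 \<cdot>\<^sub>v col W 0"
    using v n hd N0[of 0] by (intro eq_vecI) (auto simp: W_def)
  ultimately show ?thesis using that W N0[of 0] n by blast
qed

lemma mat_adjoint_mult_vec_col:
  fixes W :: "complex mat"
  assumes W: "W \<in> carrier_mat n n" "mat_adjoint W * W = 1\<^sub>m n" and j: "j < n"
  shows "mat_adjoint W *\<^sub>v col W j = unit_vec n j"
proof -
  have "mat_adjoint W *\<^sub>v col W j = col (mat_adjoint W * W) j"
    using W(1) j by (intro eq_vecI) auto
  also have "\<dots> = unit_vec n j" using W(2) j by simp
  finally show ?thesis .
qed

text \<open>Deflation: conjugating by a unitary matrix whose first column is an eigenvector splits
  off a block of size 1, and the remaining block is again Hermitian. The diagonal \<open>d\<close>
  is left complex; later steps compare real parts.\<close>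

theorem hermitian_unitary_diagonalization:
  fixes H :: "complex mat"
  assumes "H \<in> carrier_mat n n" "mat_adjoint H = H"
  shows "\<exists>U d. U \<in> carrier_mat n n \<and> mat_adjoint U * U = 1\<^sub>m n \<and> H = U * mat_diag n d * mat_adjoint U"
  using assms
proof (induction n arbitrary: H)
  case 0
  show ?case
    by (rule exI[of _ "1\<^sub>m 0"], rule exI[of _ "\<lambda>_. 0"]) (use 0 in \<open>auto intro!: eq_matI\<close>)
next
  case (Suc n)
  note H = Suc.prems
  have "degree (char_poly H) \<noteq> 0" using degree_monic_char_poly[OF H(1)] by simp
  then obtain e where "poly (char_poly H) e = 0"
    using fundamental_theorem_of_algebra[of "char_poly H"] constant_degree[of "char_poly H"] by auto
  then obtain v where "eigenvector H v e"
    using eigenvalue_root_char_poly[OF H(1)] by (auto simp: eigenvalue_def)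
  then have v: "v \<in> carrier_vec (Suc n)" "v \<noteq> 0\<^sub>v (Suc n)" "H *\<^sub>v v = e \<cdot>\<^sub>v v"
    using H(1) by (auto simp: eigenvector_def)
  from unitary_completion[OF v(1,2)] obtain W c where W: "W \<in> carrier_mat (Suc n) (Suc n)"
    "mat_adjoint W * W = 1\<^sub>m (Suc n)" and c: "v = c \<cdot>\<^sub>v col W 0" "c \<noteq> 0" .
  have cW: "col W 0 \<in> carrier_vec (Suc n)" using W(1) by (intro carrier_vecI) simp
  note aW = mat_adjoint_carrier[OF W(1)]
  have WW: "W * mat_adjoint W = 1\<^sub>m (Suc n)"
    using mat_mult_left_right_inverse[OF aW W(1) W(2)] .
  have "c \<cdot>\<^sub>v (H *\<^sub>v col W 0) = c \<cdot>\<^sub>v (e \<cdot>\<^sub>v col W 0)"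
    using v(3) c(1) H(1) cW by (simp add: mult_mat_vec[symmetric] smult_smult_assoc mult.commute)
  then have eW: "H *\<^sub>v col W 0 = e \<cdot>\<^sub>v col W 0"
    using c(2) H(1) W(1) by (auto simp: vec_eq_iff)
  define K where "K = mat_adjoint W * H * W"
  have K: "K \<in> carrier_mat (Suc n) (Suc n)" using W aW H(1) by (auto simp: K_def)
  have KH: "mat_adjoint K = K"
    using W aW H by (simp add: K_def mat_adjoint_mult[of _ "Suc n" "Suc n" _ "Suc n"] assoc_mult_mat[of _ "Suc n" "Suc n" _ "Suc n" _ "Suc n"])
  have col0: "col K 0 = e \<cdot>\<^sub>v unit_vec (Suc n) 0"
  proof -
    have "col K 0 = mat_adjoint W * H *\<^sub>v col W 0"
      unfolding K_def using W(1) H(1) aW by (intro eq_vecI) auto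
    also have "\<dots> = mat_adjoint W *\<^sub>v (H *\<^sub>v col W 0)"
      using assoc_mult_mat_vec[OF aW H(1) cW] .
    also have "\<dots> = e \<cdot>\<^sub>v (mat_adjoint W *\<^sub>v col W 0)"
      unfolding eW by (rule mult_mat_vec[OF aW cW])
    finally show ?thesis using mat_adjoint_mult_vec_col[OF W, of 0] by simp
  qed
  have K0: "K $$ (i, 0) = (if i = 0 then e else 0)" if "i < Suc n" for i
    using arg_cong[OF col0, of "\<lambda>x. x $ i"] that K by auto
  \<comment> \<open>Hermitian symmetry turns the zeros of the first column into zeros of the first
    row, so \<open>K\<close> is block diagonal.\<close>
  have K0': "K $$ (0, j) = 0" if "j < Suc n" "j \<noteq> 0" for j
    using K0[of j] that KH K by (metis carrier_matD conjugate_zero mat_adjoint_index zero_less_Suc)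
  define K1 where "K1 = mat n n (\<lambda>(i, j). K $$ (Suc i, Suc j))"
  have K1: "K1 \<in> carrier_mat n n" by (simp add: K1_def)
  have "mat_adjoint K1 = K1"
  proof (rule eq_matI)
    fix i j assume ij: "i < dim_row K1" "j < dim_col K1"
    have "mat_adjoint K $$ (Suc i, Suc j) = K $$ (Suc i, Suc j)" using KH by simp
    then show "mat_adjoint K1 $$ (i, j) = K1 $$ (i, j)"
      using ij K by (simp add: K1_def)
  qed (auto simp: K1_def)
  from Suc.IH[OF K1 this] obtain U d where U: "U \<in> carrier_mat n n"
    "mat_adjoint U * U = 1\<^sub>m n" "K1 = U * mat_diag n d * mat_adjoint U" by blast
  define V where "V = four_block_mat (1\<^sub>m 1) (0\<^sub>m 1 n) (0\<^sub>m n 1) U"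
  define d' where "d' i = (if i = 0 then e else d (i - 1))" for i
  have V: "V \<in> carrier_mat (Suc n) (Suc n)" using U by (auto simp: V_def)
  note aU = mat_adjoint_carrier[OF U(1)]
  have aV: "mat_adjoint V = four_block_mat (1\<^sub>m 1) (0\<^sub>m 1 n) (0\<^sub>m n 1) (mat_adjoint U)"
    unfolding V_def using U by (intro eq_matI) (auto simp: conjugate_complex_def)
  have D: "mat_diag (Suc n) d' = four_block_mat (mat 1 1 (\<lambda>_. e)) (0\<^sub>m 1 n) (0\<^sub>m n 1) (mat_diag n d)"
    by (intro eq_matI) (auto simp: mat_diag_def d'_def)
  have KB: "K = four_block_mat (mat 1 1 (\<lambda>_. e)) (0\<^sub>m 1 n) (0\<^sub>m n 1) K1"
    using K K0 K0' by (intro eq_matI) (auto simp: K1_def)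
  have Dc: "mat_diag n d \<in> carrier_mat n n" by simp
  have VV: "mat_adjoint V * V = 1\<^sub>m (Suc n)"
    unfolding aV unfolding V_def
    by (subst mult_four_block_mat[OF one_carrier_mat zero_carrier_mat zero_carrier_mat aU
          one_carrier_mat zero_carrier_mat zero_carrier_mat U(1)])
      (use U aU in \<open>simp add: four_block_one_mat\<close>)
  have UD: "U * mat_diag n d \<in> carrier_mat n n" using U(1) by simp
  have "V * mat_diag (Suc n) d' = four_block_mat (mat 1 1 (\<lambda>_. e)) (0\<^sub>m 1 n) (0\<^sub>m n 1) (U * mat_diag n d)"
    unfolding D V_def
    by (subst mult_four_block_mat[OF one_carrier_mat zero_carrier_mat zero_carrier_mat U(1)
          mat_carrier zero_carrier_mat zero_carrier_mat Dc]) (use U UD in \<open>auto simp: left_mult_zero_mat[OF Dc]\<close>)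
  then have "V * mat_diag (Suc n) d' * mat_adjoint V = K"
    unfolding aV KB U(3)
    by (simp only:, subst mult_four_block_mat[OF mat_carrier zero_carrier_mat zero_carrier_mat UD
          one_carrier_mat zero_carrier_mat zero_carrier_mat aU]) (use U UD aU in \<open>auto simp: left_mult_zero_mat[OF aU] right_mult_zero_mat[OF UD]
          left_add_zero_mat[OF mult_carrier_mat[OF UD aU]]\<close>)
  then have KV: "K = V * mat_diag (Suc n) d' * mat_adjoint V" by simp
  show ?case
  proof (intro exI conjI)
    show "W * V \<in> carrier_mat (Suc n) (Suc n)" using W V by simp
    note mc = mult_carrier_mat[of _ "Suc n" "Suc n" _ "Suc n"]
    note as = assoc_mult_mat[of _ "Suc n" "Suc n" _ "Suc n" _ "Suc n"]
    note aVc = mat_adjoint_carrier[OF V]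
    have WWV: "mat_adjoint W * (W * V) = V"
      using assoc_mult_mat[OF aW W(1) V] W(2) V by simp
    have "mat_adjoint (W * V) * (W * V) = mat_adjoint V * (mat_adjoint W * W) * V"
      using W V aW aVc by (simp add: mat_adjoint_mult[of _ "Suc n" "Suc n" _ "Suc n"] as WWV)
    also have "\<dots> = 1\<^sub>m (Suc n)" using W VV aVc V by simp
    finally show "mat_adjoint (W * V) * (W * V) = 1\<^sub>m (Suc n)" .
    have "H = (W * mat_adjoint W) * H * (W * mat_adjoint W)" using WW H by simp
    also have "\<dots> = W * K * mat_adjoint W" unfolding K_def using W aW H(1) by (simp add: as mc)
    also have "\<dots> = (W * V) * mat_diag (Suc n) d' * mat_adjoint (W * V)"
      unfolding KV using W V aW aVc by (simp add: mat_adjoint_mult[of _ "Suc n" "Suc n" _ "Suc n"] as mc)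
    finally show "H = (W * V) * mat_diag (Suc n) d' * mat_adjoint (W * V)" .
  qed
qed

section \<open>Singular values\<close>

lemma proots_prod_linear_factors:
  "proots (\<Prod>a\<leftarrow>es. [:- a, 1:]) = mset (es :: complex list)"
proof (induction es)
  case (Cons e es)
  have "(\<Prod>a\<leftarrow>es. [:- a, 1:]) \<noteq> 0" by (auto simp: prod_list_zero_iff)
  then have "proots ([:- e, 1:] * (\<Prod>a\<leftarrow>es. [:- a, 1:])) = {#e#} + proots (\<Prod>a\<leftarrow>es. [:- a, 1:])"
    by (subst proots_mult) auto
  then show ?case
    by (simp only: list.map prod_list.Cons Cons.IH mset.simps union_mset_add_mset_left add_0)
qed simp

text \<open>The adjoint of \<open>U\<close> is its inverse, so the matrix is similar to
  \<open>mat_diag n d\<close>; its eigenvalues with multiplicity are thus the entries of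
  \<open>d\<close>.\<close>

lemma char_poly_unitary_diagonalization:
  assumes U: "U \<in> carrier_mat n n" "mat_adjoint U * U = 1\<^sub>m n"
  shows "char_poly (U * mat_diag n d * mat_adjoint U) = (\<Prod>a\<leftarrow>map d [0..<n]. [:- a, 1:])"
proof -
  note aU = mat_adjoint_carrier[OF U(1)]
  have "similar_mat_wit (U * mat_diag n d * mat_adjoint U) (mat_diag n d) U (mat_adjoint U)"
    using U aU mat_mult_left_right_inverse[OF aU U(1,2)] by (intro similar_mat_witI[of _ _ n]) auto
  then have "char_poly (U * mat_diag n d * mat_adjoint U) = char_poly (mat_diag n d)"
    by (intro char_poly_similar) (auto simp: similar_mat_def)
  also have "\<dots> = (\<Prod>a\<leftarrow>diag_mat (mat_diag n d). [:- a, 1:])"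
    by (rule char_poly_upper_triangular[of _ n]) (auto simp: mat_diag_def)
  also have "diag_mat (mat_diag n d) = map d [0..<n]"
    by (auto simp: diag_mat_def mat_diag_def)
  finally show ?thesis .
qed

lemma length_filter_less_nth:
  assumes "sorted xs" "p < length xs"
  shows "length (filter (\<lambda>x. x < xs ! p) xs) \<le> p"
proof -
  have "{i. i < length xs \<and> xs ! i < xs ! p} \<subseteq> {..<p}"
    using sorted_nth_mono[OF assms(1), of p] by (auto simp: not_less[symmetric])
  then have "card {i. i < length xs \<and> xs ! i < xs ! p} \<le> card {..<p}"
    by (intro card_mono) auto
  then show ?thesis by (simp add: length_filter_conv_card)
qed

text \<open>In nonincreasing order, position \<open>N - k + 1\<close> holds the \<open>k\<close>th
  smallest value, so at most \<open>k - 1\<close> values lie strictly below it; strictness makes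
  this true for repeated values too. Counting indices of the diagonal rather than list entries
  yields a set of coordinates to avoid.\<close>

lemma card_less_singular_value:
  assumes U: "U \<in> carrier_mat N N" "mat_adjoint U * U = 1\<^sub>m N"
    and H: "mat_adjoint A * A = U * mat_diag N d * mat_adjoint U"
    and k: "1 \<le> k" "k \<le> N"
  shows "card {i. i < N \<and> sqrt (Re (d i)) < singular_value A (N - k + 1)} < k"
proof -
  define f where "f i = sqrt (Re (d i))" for i
  define L where "L = sorted_list_of_multiset (mset (map f [0..<N]))"
  have "image_mset (\<lambda>e. sqrt (Re e)) (mset (map d [0..<N])) = mset (map f [0..<N])"
    by (simp add: f_def[abs_def] image_mset.compositionality o_def)
  then have sv: "singular_values A = rev L"
    unfolding singular_values_def H char_poly_unitary_diagonalization[OF U] proots_prod_linear_factors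
    by (simp only: L_def)
  have L: "sorted L" "mset L = mset (map f [0..<N])" by (simp_all add: L_def)
  then have len: "length L = N" by (metis diff_zero length_map length_upt size_mset)
  \<comment> \<open>Entry number \<open>N - k + 1\<close> of \<open>rev L\<close> has index
    \<open>N - k\<close> counted from 0, which is index \<open>k - 1\<close> in
    \<open>L\<close>.\<close>
  have s: "singular_value A (N - k + 1) = L ! (k - 1)"
    using k len by (simp add: singular_value_def sv rev_nth)
  have "card {i. i < N \<and> f i < L ! (k - 1)} = length (filter (\<lambda>x. x < L ! (k - 1)) (map f [0..<N]))"
    by (auto simp: length_filter_conv_card intro!: arg_cong[where f = card])
  also have "\<dots> = size (filter_mset (\<lambda>x. x < L ! (k - 1)) (mset (map f [0..<N])))"
    by (metis mset_filter size_mset)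
  also have "\<dots> = length (filter (\<lambda>x. x < L ! (k - 1)) L)"
    by (metis L(2) mset_filter size_mset)
  also have "\<dots> \<le> k - 1" using L(1) len k by (intro length_filter_less_nth) auto
  finally show ?thesis using k unfolding s f_def by simp
qed

text \<open>Fewer than \<open>k\<close> homogeneous equations in \<open>k\<close> unknowns. The
  selected rows are padded with zero rows to a square matrix of size \<open>k\<close>; its last row
  is zero because \<open>card I < k\<close>, so every term of the Leibniz formula vanishes.\<close>

lemma exists_kernel_vec_rows:
  fixes G :: "complex mat"
  assumes G: "G \<in> carrier_mat N k" and I: "I \<subseteq> {..<N}" "card I < k"
  obtains a where "a \<in> carrier_vec k" "a \<noteq> 0\<^sub>v k" "\<And>i. i \<in> I \<Longrightarrow> (G *\<^sub>v a) $ i = 0"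
proof -
  have "finite I" using I(1) finite_subset by blast
  then obtain h where h: "bij_betw h {0..<card I} I" using ex_bij_betw_nat_finite by blast
  define M where "M = mat k k (\<lambda>(r, c). if r < card I then G $$ (h r, c) else 0)"
  have M: "M \<in> carrier_mat k k" by (simp add: M_def)
  have "(\<Prod>i = 0..<k. M $$ (i, p i)) = 0" if "p permutes {0..<k}" for p
  proof (rule prod_zero)
    have "p (k - 1) < k" using permutes_in_image[OF that, of "k - 1"] I(2) by auto
    then show "\<exists>i\<in>{0..<k}. M $$ (i, p i) = 0"
      using I(2) by (intro bexI[of _ "k - 1"]) (auto simp: M_def)
  qed simp
  then have "det M = 0" by (simp add: det_def'[OF M] sum.neutral)
  then obtain a where a: "a \<in> carrier_vec k" "a \<noteq> 0\<^sub>v k" "M *\<^sub>v a = 0\<^sub>v k"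
    using det_0_iff_vec_prod_zero[OF M] by blast
  have "(G *\<^sub>v a) $ i = 0" if "i \<in> I" for i
  proof -
    have "i \<in> h ` {0..<card I}" using that h by (simp add: bij_betw_imp_surj_on)
    then obtain r where r: "r < card I" "h r = i" by auto
    have i: "i < N" using that I(1) by auto
    have "row M r = row G i"
      using r i I(2) G by (intro eq_vecI) (auto simp: M_def)
    then have "(M *\<^sub>v a) $ r = (G *\<^sub>v a) $ i"
      using r(1) i I(2) G M by simp
    then show ?thesis using a(3) r(1) I(2) by simp
  qed
  with a that show ?thesis by blast
qed

text \<open>This is one half of the Courant--Fischer theorem for the \<open>k\<close>th smallest singular value.\<close>

theorem singular_value_le_on_subspace:
  assumes A: "A \<in> carrier_mat N N" and X: "X \<in> carrier_mat N k" and k: "1 \<le> k" "k \<le> N"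
    and inj: "\<And>a. a \<in> carrier_vec k \<Longrightarrow> X *\<^sub>v a = 0\<^sub>v N \<Longrightarrow> a = 0\<^sub>v k"
    and bound: "\<And>a. a \<in> carrier_vec k \<Longrightarrow> vec_norm2 (A *\<^sub>v (X *\<^sub>v a)) \<le> b * vec_norm2 (X *\<^sub>v a)"
  shows "singular_value A (N - k + 1) \<le> b"
proof -
  define s where "s = singular_value A (N - k + 1)"
  note aA = mat_adjoint_carrier[OF A]
  have "mat_adjoint (mat_adjoint A * A) = mat_adjoint A * A"
    using mat_adjoint_mult[OF aA A] by simp
  then obtain U d where U: "U \<in> carrier_mat N N" "mat_adjoint U * U = 1\<^sub>m N"
    and H: "mat_adjoint A * A = U * mat_diag N d * mat_adjoint U"
    using hermitian_unitary_diagonalization[of "mat_adjoint A * A" N] A aA by auto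
  note aU = mat_adjoint_carrier[OF U(1)]
  \<comment> \<open>The eigendirections of the Gram matrix with singular value below
    \<open>s\<close> number fewer than \<open>k\<close>, so the range of \<open>X\<close> contains a
    nonzero vector without component along any of them.\<close>
  define I where "I = {i. i < N \<and> sqrt (Re (d i)) < s}"
  have I: "I \<subseteq> {..<N}" "card I < k"
    using card_less_singular_value[OF U H k] by (auto simp: I_def s_def)
  have "mat_adjoint U * X \<in> carrier_mat N k" using aU X by simp
  from exists_kernel_vec_rows[OF this I] obtain a where a: "a \<in> carrier_vec k" "a \<noteq> 0\<^sub>v k"
    and a0: "\<And>i. i \<in> I \<Longrightarrow> (mat_adjoint U * X *\<^sub>v a) $ i = 0" by blast
  define x where "x = X *\<^sub>v a"
  define y where "y = mat_adjoint U *\<^sub>v x"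
  have x: "x \<in> carrier_vec N" using X a by (simp add: x_def)
  have y: "y \<in> carrier_vec N" using aU x by (simp add: y_def)
  have y0: "y $ i = 0" if "i \<in> I" for i
    using a0[OF that] assoc_mult_mat_vec[OF aU X a(1)] by (simp add: y_def x_def)
  have Uy: "U *\<^sub>v y = x"
    unfolding y_def assoc_mult_mat_vec[OF U(1) aU x, symmetric]
      mat_mult_left_right_inverse[OF aU U(1,2)] using x by simp
  have "complex_of_real ((vec_norm2 x)\<^sup>2) = (U *\<^sub>v y) \<bullet>c x" using Uy by (simp add: cscalar_prod_self)
  also have "\<dots> = complex_of_real ((vec_norm2 y)\<^sup>2)"
    by (simp add: cscalar_prod_mat_adjoint[OF U(1) y x] cscalar_prod_self flip: y_def)
  finally have "(vec_norm2 x)\<^sup>2 = (vec_norm2 y)\<^sup>2" by (simp only: of_real_eq_iff)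
  then have xy: "(vec_norm2 x)\<^sup>2 = (\<Sum>i<N. (cmod (y $ i))\<^sup>2)"
    using vec_norm2_sq[of y] y by simp
  have Ax: "A *\<^sub>v x \<in> carrier_vec N" using A x by simp
  have Dy: "mat_diag N d *\<^sub>v y \<in> carrier_vec N" using y by (intro mult_mat_vec_carrier[of _ N N]) auto
  have Dyi: "(mat_diag N d *\<^sub>v y) $ i = d i * y $ i" if "i < N" for i
    using that y
    by (simp add: mat_diag_def scalar_prod_def if_distrib[of "\<lambda>c. c * _"] cong: if_cong)
  have "complex_of_real ((vec_norm2 (A *\<^sub>v x))\<^sup>2) = (mat_adjoint A *\<^sub>v (A *\<^sub>v x)) \<bullet>c x"
    using cscalar_prod_mat_adjoint[OF aA Ax x] by (simp add: cscalar_prod_self)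
  also have "mat_adjoint A *\<^sub>v (A *\<^sub>v x) = U *\<^sub>v (mat_diag N d *\<^sub>v y)"
    unfolding y_def assoc_mult_mat_vec[OF aA A x, symmetric] H
      assoc_mult_mat_vec[OF mult_carrier_mat[OF U(1) mat_diag_dim] aU x]
    by (rule assoc_mult_mat_vec[OF U(1) mat_diag_dim y[unfolded y_def]])
  also have "\<dots> \<bullet>c x = (mat_diag N d *\<^sub>v y) \<bullet>c y"
    unfolding y_def by (rule cscalar_prod_mat_adjoint[OF U(1) Dy[unfolded y_def] x])
  also have "\<dots> = (\<Sum>i<N. d i * complex_of_real ((cmod (y $ i))\<^sup>2))"
    using y Dyi by (auto simp: scalar_prod_def atLeast0LessThan complex_norm_square simp del: of_real_power intro!: sum.cong)
  finally have "Re (complex_of_real ((vec_norm2 (A *\<^sub>v x))\<^sup>2)) = Re (\<Sum>i<N. d i * complex_of_real ((cmod (y $ i))\<^sup>2))"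
    by simp
  then have Axy: "(vec_norm2 (A *\<^sub>v x))\<^sup>2 = (\<Sum>i<N. Re (d i) * (cmod (y $ i))\<^sup>2)"
    by (simp del: of_real_power)
  have "s * vec_norm2 x \<le> vec_norm2 (A *\<^sub>v x)"
  \<comment> \<open>Nothing shown so far excludes a negative \<open>s\<close>, as
    \<open>sqrt\<close> of a negative real is negative. That case is trivial, and only for
    \<open>s \<ge> 0\<close> is the inequality obtained from its square.\<close>
  proof (cases "s \<ge> 0")
    case True
    have "(s * vec_norm2 x)\<^sup>2 = (\<Sum>i<N. s\<^sup>2 * (cmod (y $ i))\<^sup>2)"
      by (simp add: power_mult_distrib xy sum_distrib_left)
    also have "\<dots> \<le> (vec_norm2 (A *\<^sub>v x))\<^sup>2" unfolding Axy
    proof (rule sum_mono)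
      fix i assume i: "i \<in> {..<N}"
      show "s\<^sup>2 * (cmod (y $ i))\<^sup>2 \<le> Re (d i) * (cmod (y $ i))\<^sup>2"
      proof (cases "i \<in> I")
        case False
        then have "s \<le> sqrt (Re (d i))" using i by (auto simp: I_def)
        moreover from this True have "0 \<le> Re (d i)" by (meson order_trans real_sqrt_ge_0_iff)
        ultimately have "s\<^sup>2 \<le> Re (d i)" using True by (metis power_mono real_sqrt_pow2)
        then show ?thesis by (intro mult_right_mono) auto
      qed (simp add: y0)
    qed
    finally show ?thesis by (rule power2_le_imp_le) simp
  next
    case False
    then have "s * vec_norm2 x \<le> 0" by (simp add: mult_nonpos_nonneg)
    then show ?thesis using vec_norm2_nonneg order_trans by blast
  qed
  also have "\<dots> \<le> b * vec_norm2 x" unfolding x_def by (rule bound[OF a(1)])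
  finally have "s * vec_norm2 x \<le> b * vec_norm2 x" .
  moreover have "0 < vec_norm2 x"
    using inj[OF a(1)] a(2) x vec_norm2_eq_0[OF x] vec_norm2_nonneg[of x] by (auto simp: x_def less_le)
  ultimately show ?thesis by (simp add: s_def)
qed

section \<open>Divided differences\<close>

text \<open>The coefficient of block \<open>j\<close> in hat block \<open>p\<close>, with the sign
  \<open>(-1) ^ i\<close> absorbed into the factors. It is also entry \<open>j\<close> of the left
  eigenvector for \<open>\<mu> p\<close> of the bidiagonal matrix, normalized to 1 at
  \<open>p\<close>. Beyond \<open>p\<close> the eigenvector is 0 but the empty product is 1, so uses
  keep \<open>j \<le> p\<close>.\<close>

definition hat_coeff :: "(nat \<Rightarrow> complex) \<Rightarrow> real \<Rightarrow> nat \<Rightarrow> nat \<Rightarrow> complex" where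
  "hat_coeff \<mu> \<gamma> p j = (\<Prod>l = j..<p. - theta \<mu> \<gamma> l p)"

lemma hat_coeff_self [simp]: "hat_coeff \<mu> \<gamma> p p = 1"
  by (simp add: hat_coeff_def)

text \<open>Column \<open>j\<close> of the left eigenvector equation for the bidiagonal
  matrix.\<close>

lemma hat_coeff_Suc:
  assumes "j < p" "\<mu> j \<noteq> \<mu> p"
  shows "complex_of_real \<gamma> * hat_coeff \<mu> \<gamma> p (Suc j) = (\<mu> p - \<mu> j) * hat_coeff \<mu> \<gamma> p j"
  using assms by (simp add: hat_coeff_def prod.atLeast_Suc_lessThan theta_def field_simps)

lemma hat_block_eq:
  assumes "1 \<le> p"
  shows "hat_block n \<mu> \<gamma> x p = vec n (\<lambda>r. \<Sum>j = 1..p. hat_coeff \<mu> \<gamma> p j * block n x j $ r)"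
proof (rule eq_vecI)
  fix r assume "r < dim_vec (vec n (\<lambda>r. \<Sum>j = 1..p. hat_coeff \<mu> \<gamma> p j * block n x j $ r))"
  then have r: "r < n" by simp
  have "(\<Sum>i = 1..<p. (-1) ^ i * (\<Prod>j = p - i..p - 1. theta \<mu> \<gamma> j p) * block n x (p - i) $ r)
      = (\<Sum>i = 1..<p. hat_coeff \<mu> \<gamma> p (p - i) * block n x (p - i) $ r)"
  proof (rule sum.cong)
    fix i assume "i \<in> {1..<p}"
    moreover from this have "{p - i..p - 1} = {p - i..<p}" by auto
    ultimately show "(-1) ^ i * (\<Prod>j = p - i..p - 1. theta \<mu> \<gamma> j p) * block n x (p - i) $ r
        = hat_coeff \<mu> \<gamma> p (p - i) * block n x (p - i) $ r"
      by (simp add: hat_coeff_def prod_uminus)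
  qed simp
  also have "\<dots> = (\<Sum>j = 1..<p. hat_coeff \<mu> \<gamma> p j * block n x j $ r)"
    by (rule sum.reindex_bij_witness[of _ "\<lambda>j. p - j" "\<lambda>j. p - j"]) auto
  finally show "hat_block n \<mu> \<gamma> x p $ r = vec n (\<lambda>r. \<Sum>j = 1..p. hat_coeff \<mu> \<gamma> p j * block n x j $ r) $ r"
    using r assms by (simp add: hat_block_def sum.last_plus)
qed (simp add: hat_block_def)

text \<open>Entry \<open>j\<close> of the left eigenvector equation for a function of the bidiagonal
  matrix, with eigenvalue \<open>D p 0\<close>. Downward induction on \<open>j\<close>: writing
  \<open>\<mu> p - \<mu> j\<close> as the difference of \<open>\<mu> p - \<mu> i\<close> and
  \<open>\<mu> j - \<mu> i\<close> gives two weighted sums; \<open>hat_coeff_Suc\<close> rewrites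
  one, the recursion of \<open>D\<close> the other, and what does not cancel is a multiple of the
  sum for \<open>j + 1\<close>. \<open>D\<close> is abstract so that any matrix entry of the divided
  differences can be inserted.\<close>

lemma divided_differences_left_eigenvector:
  fixes D :: "nat \<Rightarrow> nat \<Rightarrow> complex"
  assumes rec: "\<And>i t. j \<le> i \<Longrightarrow> i + Suc t \<le> p \<Longrightarrow> (\<mu> i - \<mu> (i + Suc t)) * D i (Suc t) = D i t - D (Suc i) t"
    and distinct: "\<And>l. j \<le> l \<Longrightarrow> l < p \<Longrightarrow> \<mu> l \<noteq> \<mu> p"
    and "j \<le> p"
  shows "(\<Sum>i = j..p. hat_coeff \<mu> \<gamma> p i * complex_of_real \<gamma> ^ (i - j) * D j (i - j))
    = hat_coeff \<mu> \<gamma> p j * D p 0"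
  using \<open>j \<le> p\<close> rec distinct
proof (induction j rule: inc_induct)
  case (step j)
  define g where "g = complex_of_real \<gamma>"
  define c where "c = hat_coeff \<mu> \<gamma> p"
  have c: "g * c (Suc i) = (\<mu> p - \<mu> i) * c i" if "j \<le> i" "i < p" for i
    using hat_coeff_Suc[of i p \<mu> \<gamma>] that step.prems(2)[of i] by (auto simp: g_def c_def)
  have IH: "(\<Sum>i = Suc j..p. c i * g ^ (i - Suc j) * D (Suc j) (i - Suc j)) = c (Suc j) * D p 0"
    unfolding g_def c_def by (rule step.IH) (use step.prems in auto)
  have "(\<Sum>i = j..p. (\<mu> j - \<mu> i) * (c i * g ^ (i - j) * D j (i - j)))
      = (\<Sum>i = Suc j..p. (\<mu> j - \<mu> i) * (c i * g ^ (i - j) * D j (i - j)))"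
    using step.hyps by (subst sum.atLeast_Suc_atMost) auto
  also have "\<dots> = (\<Sum>i = Suc j..p. c i * g ^ (i - j) * D j (i - Suc j) - g * (c i * g ^ (i - Suc j) * D (Suc j) (i - Suc j)))"
  proof (rule sum.cong)
    fix i assume i: "i \<in> {Suc j..p}"
    then obtain t where t: "i = j + Suc t" by (metis add_Suc_right add_Suc atLeastAtMost_iff le_Suc_ex)
    have "(\<mu> j - \<mu> i) * D j (i - j) = D j (i - Suc j) - D (Suc j) (i - Suc j)"
      using step.prems(1)[of j t] i t by simp
    then have "(\<mu> j - \<mu> i) * (c i * g ^ (i - j) * D j (i - j))
        = c i * g ^ (i - j) * (D j (i - Suc j) - D (Suc j) (i - Suc j))"
      by (metis mult.assoc mult.left_commute)
    also have "g ^ (i - j) = g * g ^ (i - Suc j)" using t by simp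
    finally show "(\<mu> j - \<mu> i) * (c i * g ^ (i - j) * D j (i - j))
       = c i * g ^ (i - j) * D j (i - Suc j) - g * (c i * g ^ (i - Suc j) * D (Suc j) (i - Suc j))"
      using t by (simp add: algebra_simps)
  qed simp
  also have "\<dots> = (\<Sum>i = Suc j..p. c i * g ^ (i - j) * D j (i - Suc j)) - g * c (Suc j) * D p 0"
    unfolding sum_subtractf sum_distrib_left[symmetric] IH by simp
  also have "(\<Sum>i = Suc j..p. c i * g ^ (i - j) * D j (i - Suc j))
      = (\<Sum>i = j..<p. c (Suc i) * g ^ (Suc i - j) * D j (i - j))"
    by (rule sum.reindex_bij_witness[of _ Suc "\<lambda>i. i - 1"]) auto
  \<comment> \<open>Each \<open>g * c (Suc i)\<close> becomes
    \<open>(\<mu> p - \<mu> i) * c i\<close>, so the shifted sum is the one weighted by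
    \<open>\<mu> p - \<mu> i\<close>; the term \<open>i = p\<close> can then be added because its
    weight is zero.\<close>
  also have "\<dots> = (\<Sum>i = j..<p. (\<mu> p - \<mu> i) * (c i * g ^ (i - j) * D j (i - j)))"
  proof (rule sum.cong)
    fix i assume i: "i \<in> {j..<p}"
    have "c (Suc i) * g ^ (Suc i - j) * D j (i - j) = (g * c (Suc i)) * (g ^ (i - j) * D j (i - j))"
      using i by (simp add: Suc_diff_le mult_ac)
    also have "\<dots> = (\<mu> p - \<mu> i) * c i * (g ^ (i - j) * D j (i - j))"
      using c[of i] i by simp
    finally show "c (Suc i) * g ^ (Suc i - j) * D j (i - j) = (\<mu> p - \<mu> i) * (c i * g ^ (i - j) * D j (i - j))"
      by (simp only: mult.assoc)
  qed simp
  also have "\<dots> = (\<Sum>i = j..p. (\<mu> p - \<mu> i) * (c i * g ^ (i - j) * D j (i - j)))"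
    using step.hyps by (simp add: sum.last_plus)
  finally have E: "(\<Sum>i = j..p. (\<mu> p - \<mu> i) * (c i * g ^ (i - j) * D j (i - j)))
      - (\<Sum>i = j..p. (\<mu> j - \<mu> i) * (c i * g ^ (i - j) * D j (i - j))) = (g * c (Suc j)) * D p 0"
    by simp
  have "(\<Sum>i = j..p. (\<mu> p - \<mu> i) * (c i * g ^ (i - j) * D j (i - j)))
      - (\<Sum>i = j..p. (\<mu> j - \<mu> i) * (c i * g ^ (i - j) * D j (i - j)))
      = (\<mu> p - \<mu> j) * (\<Sum>i = j..p. c i * g ^ (i - j) * D j (i - j))"
    unfolding sum_subtractf[symmetric] sum_distrib_left by (intro sum.cong) (auto simp: algebra_simps)
  then have "(\<mu> p - \<mu> j) * (\<Sum>i = j..p. c i * g ^ (i - j) * D j (i - j)) = (g * c (Suc j)) * D p 0"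
    by (rule trans[OF sym E])
  also have "\<dots> = (\<mu> p - \<mu> j) * (c j * D p 0)"
    using c[of j] step.hyps by simp
  finally have "(\<mu> p - \<mu> j) * (\<Sum>i = j..p. c i * g ^ (i - j) * D j (i - j)) = (\<mu> p - \<mu> j) * (c j * D p 0)" .
  then show ?case using step.prems(2)[of j] step.hyps by (simp add: c_def g_def)
qed simp

text \<open>Entry \<open>i\<close> of the right eigenvector for \<open>\<mu> s\<close> of the
  bidiagonal matrix, normalized to 1 at \<open>s\<close>. For \<open>i < s\<close> the eigenvector
  is 0 but the empty product is 1, hence the guard \<open>s \<le> i\<close> in
  \<open>kernel_mat\<close>.\<close>

definition kernel_coeff :: "(nat \<Rightarrow> complex) \<Rightarrow> real \<Rightarrow> nat \<Rightarrow> nat \<Rightarrow> complex" where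
  "kernel_coeff \<mu> \<gamma> s i = (\<Prod>l = Suc s..i. theta \<mu> \<gamma> s l)"

lemma kernel_coeff_self [simp]: "kernel_coeff \<mu> \<gamma> s s = 1"
  by (simp add: kernel_coeff_def)

lemma kernel_coeff_Suc:
  assumes "s \<le> i" "\<mu> s \<noteq> \<mu> (Suc i)"
  shows "complex_of_real \<gamma> * kernel_coeff \<mu> \<gamma> s i = (\<mu> s - \<mu> (Suc i)) * kernel_coeff \<mu> \<gamma> s (Suc i)"
  using assms by (simp add: kernel_coeff_def prod.nat_ivl_Suc' theta_def field_simps)

text \<open>The mirror image of the left identity: upward induction on \<open>p\<close>, with
  \<open>\<mu> s - \<mu> q\<close> for \<open>q = p + 1\<close> written as the sum of
  \<open>\<mu> j - \<mu> q\<close> and \<open>\<mu> s - \<mu> j\<close>. The recursion of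
  \<open>D\<close> rewrites the first weighted sum, and by \<open>kernel_coeff_Suc\<close> part of
  the result cancels the second.\<close>

lemma divided_differences_right_eigenvector:
  fixes D :: "nat \<Rightarrow> nat \<Rightarrow> complex"
  assumes rec: "\<And>i t. s \<le> i \<Longrightarrow> i + Suc t \<le> p \<Longrightarrow> (\<mu> i - \<mu> (i + Suc t)) * D i (Suc t) = D i t - D (Suc i) t"
    and distinct: "\<And>l. s < l \<Longrightarrow> l \<le> p \<Longrightarrow> \<mu> s \<noteq> \<mu> l"
    and "s \<le> p"
  shows "(\<Sum>j = s..p. complex_of_real \<gamma> ^ (p - j) * D j (p - j) * kernel_coeff \<mu> \<gamma> s j)
    = kernel_coeff \<mu> \<gamma> s p * D s 0"
  using \<open>s \<le> p\<close> rec distinct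
proof (induction p rule: dec_induct)
  case (step p)
  define g where "g = complex_of_real \<gamma>"
  define b where "b = kernel_coeff \<mu> \<gamma> s"
  define q where "q = Suc p"
  have b: "g * b i = (\<mu> s - \<mu> (Suc i)) * b (Suc i)" if "s \<le> i" "i < q" for i
    using kernel_coeff_Suc[of s i \<mu> \<gamma>] that step.prems(2)[of "Suc i"] by (auto simp: g_def b_def q_def)
  have IH: "(\<Sum>j = s..p. g ^ (p - j) * D j (p - j) * b j) = b p * D s 0"
    unfolding g_def b_def by (rule step.IH) (use step.prems in auto)
  have "(\<Sum>j = s..q. (\<mu> j - \<mu> q) * (g ^ (q - j) * D j (q - j) * b j))
      = (\<Sum>j = s..p. (\<mu> j - \<mu> q) * (g ^ (q - j) * D j (q - j) * b j))"
    using step.hyps by (simp add: q_def)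
  also have "\<dots> = (\<Sum>j = s..p. g * (g ^ (p - j) * D j (p - j) * b j) - g ^ (p - j) * D (Suc j) (p - j) * (g * b j))"
  proof (rule sum.cong)
    fix j assume j: "j \<in> {s..p}"
    then obtain t where t: "p = j + t" by (metis atLeastAtMost_iff le_Suc_ex)
    have "(\<mu> j - \<mu> q) * D j (q - j) = D j (p - j) - D (Suc j) (p - j)"
      using step.prems(1)[of j t] j t by (simp add: q_def)
    moreover have "g ^ (q - j) = g * g ^ (p - j)" using t by (simp add: q_def)
    moreover have "(\<mu> j - \<mu> q) * (g ^ (q - j) * D j (q - j) * b j)
        = g ^ (q - j) * ((\<mu> j - \<mu> q) * D j (q - j)) * b j"
      by (simp add: mult_ac)
    ultimately have "(\<mu> j - \<mu> q) * (g ^ (q - j) * D j (q - j) * b j)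
        = g * g ^ (p - j) * (D j (p - j) - D (Suc j) (p - j)) * b j"
      by (simp only:)
    then show "(\<mu> j - \<mu> q) * (g ^ (q - j) * D j (q - j) * b j)
       = g * (g ^ (p - j) * D j (p - j) * b j) - g ^ (p - j) * D (Suc j) (p - j) * (g * b j)"
      by (simp only:) (simp add: algebra_simps)
  qed simp
  also have "\<dots> = g * b p * D s 0 - (\<Sum>j = s..p. g ^ (p - j) * D (Suc j) (p - j) * (g * b j))"
    unfolding sum_subtractf sum_distrib_left[symmetric] IH by simp
  also have "(\<Sum>j = s..p. g ^ (p - j) * D (Suc j) (p - j) * (g * b j))
      = (\<Sum>j = s..p. (\<mu> s - \<mu> (Suc j)) * (g ^ (q - Suc j) * D (Suc j) (q - Suc j) * b (Suc j)))"
    using b by (intro sum.cong) (auto simp: q_def)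
  also have "\<dots> = (\<Sum>j = Suc s..q. (\<mu> s - \<mu> j) * (g ^ (q - j) * D j (q - j) * b j))"
    unfolding q_def by (rule sum.shift_bounds_cl_Suc_ivl[symmetric])
  also have "\<dots> = (\<Sum>j = s..q. (\<mu> s - \<mu> j) * (g ^ (q - j) * D j (q - j) * b j))"
    using step.hyps by (subst (2) sum.atLeast_Suc_atMost) (auto simp: q_def)
  finally have E: "(\<Sum>j = s..q. (\<mu> j - \<mu> q) * (g ^ (q - j) * D j (q - j) * b j))
      + (\<Sum>j = s..q. (\<mu> s - \<mu> j) * (g ^ (q - j) * D j (q - j) * b j)) = (g * b p) * D s 0"
    by simp
  have "(\<Sum>j = s..q. (\<mu> j - \<mu> q) * (g ^ (q - j) * D j (q - j) * b j))
      + (\<Sum>j = s..q. (\<mu> s - \<mu> j) * (g ^ (q - j) * D j (q - j) * b j))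
      = (\<mu> s - \<mu> q) * (\<Sum>j = s..q. g ^ (q - j) * D j (q - j) * b j)"
    unfolding sum.distrib[symmetric] sum_distrib_left by (intro sum.cong) (auto simp: algebra_simps)
  then have "(\<mu> s - \<mu> q) * (\<Sum>j = s..q. g ^ (q - j) * D j (q - j) * b j) = (g * b p) * D s 0"
    by (rule trans[OF sym E])
  also have "\<dots> = (\<mu> s - \<mu> q) * (b q * D s 0)"
    using b[of p] step.hyps by (simp add: q_def)
  finally have "(\<mu> s - \<mu> q) * (\<Sum>j = s..q. g ^ (q - j) * D j (q - j) * b j) = (\<mu> s - \<mu> q) * (b q * D s 0)" .
  then show ?case using step.prems(2)[of q] step.hyps by (simp add: b_def g_def q_def)
qed simp

section \<open>Block indexing and the action of \<open>F_mat\<close>\<close>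

lemma sum_blocks:
  fixes n k :: nat
  shows "(\<Sum>c<n * k. g c) = (\<Sum>j = 1..k. \<Sum>c<n. g ((j - 1) * n + c))"
proof -
  have "(\<Sum>c<n * k. g c) = (\<Sum>j<k. sum g {j * n..<j * n + n})"
    unfolding mult.commute[of n k] sum.nat_group ..
  also have "\<dots> = (\<Sum>j<k. \<Sum>c<n. g (j * n + c))"
  proof (rule sum.cong)
    show "sum g {j * n..<j * n + n} = (\<Sum>c<n. g (j * n + c))" for j
      by (rule sum.reindex_bij_witness[of _ "\<lambda>c. j * n + c" "\<lambda>c. c - j * n"]) auto
  qed simp
  also have "\<dots> = (\<Sum>j = 1..k. \<Sum>c<n. g ((j - 1) * n + c))"
    by (rule sum.reindex_bij_witness[of _ "\<lambda>j. j - 1" Suc]) auto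
  finally show ?thesis .
qed

lemma sum_triangle_swap:
  "(\<Sum>i = l..p. \<Sum>j = l..i. g i j) = (\<Sum>j = l..(p::nat). \<Sum>i = j..p. g i j)"
proof -
  have "(\<Sum>i = l..p. \<Sum>j = l..i. g i j) = (\<Sum>i = l..p. \<Sum>j\<in>{j \<in> {l..p}. j \<le> i}. g i j)"
    by (intro sum.cong) auto
  also have "\<dots> = (\<Sum>j = l..p. \<Sum>i\<in>{i \<in> {l..p}. j \<le> i}. g i j)"
    by (rule sum.swap_restrict) auto
  also have "\<dots> = (\<Sum>j = l..p. \<Sum>i = j..p. g i j)"
    by (intro sum.cong) auto
  finally show ?thesis .
qed

lemma divdiff_carrier [simp, intro]: "divdiff n m P \<mu> i t \<in> carrier_mat n n"
  by (induction t arbitrary: i) (auto simp: eval_matpoly_def intro!: smult_carrier_mat minus_carrier_mat)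

lemma dim_divdiff [simp]:
  "dim_row (divdiff n m P \<mu> i t) = n" "dim_col (divdiff n m P \<mu> i t) = n"
  using divdiff_carrier[of n m P \<mu> i t] by (simp_all only: carrier_matD)

text \<open>With the denominator cleared, each matrix entry satisfies the hypothesis
  \<open>rec\<close> of the two eigenvector identities.\<close>

lemma divdiff_rec:
  assumes "r < n" "c < n" "\<mu> i \<noteq> \<mu> (i + Suc t)"
  shows "(\<mu> i - \<mu> (i + Suc t)) * divdiff n m P \<mu> i (Suc t) $$ (r, c)
    = divdiff n m P \<mu> i t $$ (r, c) - divdiff n m P \<mu> (Suc i) t $$ (r, c)"
  using assms by simp

lemma block_index_less:
  fixes i k n r :: nat
  assumes "1 \<le> i" "i \<le> k" "r < n"
  shows "(i - 1) * n + r < n * k"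
proof -
  have "(i - 1) * n + r < (i - 1) * n + n" using assms(3) by (rule add_strict_left_mono)
  also have "\<dots> = i * n" using assms by (cases i) auto
  also have "\<dots> \<le> n * k" using assms by (simp add: mult.commute)
  finally show ?thesis .
qed

lemma dim_block [simp]: "dim_vec (block n x j) = n" by (simp add: block_def)

lemma block_carrier [simp, intro]: "block n x j \<in> carrier_vec n" by (simp add: block_def)

lemma dim_F_mat [simp]:
  "dim_row (F_mat n m k P \<mu> \<gamma>) = n * k" "dim_col (F_mat n m k P \<mu> \<gamma>) = n * k"
  by (simp_all add: F_mat_def)

lemma F_mat_carrier [simp, intro]: "F_mat n m k P \<mu> \<gamma> \<in> carrier_mat (n * k) (n * k)"
  by (simp add: F_mat_def)

lemma block_F_mat_mult:
  assumes x: "x \<in> carrier_vec (n * k)" and i: "1 \<le> i" "i \<le> k" and r: "r < n"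
  shows "block n (F_mat n m k P \<mu> \<gamma> *\<^sub>v x) i $ r
    = (\<Sum>j = 1..i. \<Sum>c<n. complex_of_real \<gamma> ^ (i - j) * divdiff n m P \<mu> j (i - j) $$ (r, c) * block n x j $ c)"
proof -
  define R where "R = (i - 1) * n + r"
  have R: "R < n * k" "R div n = i - 1" "R mod n = r"
    using block_index_less[OF i r] r by (auto simp: R_def)
  have "block n (F_mat n m k P \<mu> \<gamma> *\<^sub>v x) i $ r = (F_mat n m k P \<mu> \<gamma> *\<^sub>v x) $ R"
    using r by (simp add: block_def R_def)
  also have "\<dots> = (\<Sum>c<n * k. F_mat n m k P \<mu> \<gamma> $$ (R, c) * x $ c)"
    using R(1) x
    by (auto simp: scalar_prod_def atLeast0LessThan intro!: sum.cong)
  also have "\<dots> = (\<Sum>j = 1..k. \<Sum>c<n. F_mat n m k P \<mu> \<gamma> $$ (R, (j - 1) * n + c) * x $ ((j - 1) * n + c))"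
    by (rule sum_blocks)
  also have "\<dots> = (\<Sum>j = 1..k. if j \<le> i then
      \<Sum>c<n. complex_of_real \<gamma> ^ (i - j) * divdiff n m P \<mu> j (i - j) $$ (r, c) * block n x j $ c else 0)"
  proof (rule sum.cong)
    fix j assume j: "j \<in> {1..k}"
    have "F_mat n m k P \<mu> \<gamma> $$ (R, (j - 1) * n + c) * x $ ((j - 1) * n + c)
       = (if j \<le> i then complex_of_real \<gamma> ^ (i - j) * divdiff n m P \<mu> j (i - j) $$ (r, c) * block n x j $ c else 0)"
      if c: "c < n" for c
    proof -
      have "(j - 1) * n + c < n * k" using block_index_less[of j k c n] j c by simp
      moreover have "((j - 1) * n + c) div n = j - 1" "((j - 1) * n + c) mod n = c" using c by auto
      ultimately show ?thesis using R i j c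
        by (simp add: F_mat_def block_def) linarith
    qed
    then show "(\<Sum>c<n. F_mat n m k P \<mu> \<gamma> $$ (R, (j - 1) * n + c) * x $ ((j - 1) * n + c)) =
      (if j \<le> i then \<Sum>c<n. complex_of_real \<gamma> ^ (i - j) * divdiff n m P \<mu> j (i - j) $$ (r, c) * block n x j $ c else 0)"
      by simp
  qed simp
  also have "\<dots> = (\<Sum>j = 1..i. \<Sum>c<n. complex_of_real \<gamma> ^ (i - j) * divdiff n m P \<mu> j (i - j) $$ (r, c) * block n x j $ c)"
    using i by (intro sum.mono_neutral_cong_right) auto
  finally show ?thesis .
qed

text \<open>The left eigenvector for \<open>\<mu> p\<close> tensored with the identity. Once the
  triangular double sum is swapped, the inner sum over \<open>i \<ge> j\<close> is the left
  eigenvector identity for entry \<open>(r, c)\<close>, and the value of the polynomial at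
  \<open>\<mu> p\<close> factors out.\<close>

lemma hat_block_F_mat:
  assumes x: "x \<in> carrier_vec (n * k)" and p: "1 \<le> p" "p \<le> k" and inj: "inj_on \<mu> {1..k}"
  shows "hat_block n \<mu> \<gamma> (F_mat n m k P \<mu> \<gamma> *\<^sub>v x) p
    = eval_matpoly n m P (\<mu> p) *\<^sub>v hat_block n \<mu> \<gamma> x p"
proof (rule eq_vecI)
  define D where "D r c j t = divdiff n m P \<mu> j t $$ (r, c)" for r c j t
  define g where "g = complex_of_real \<gamma>"
  define h where "h = hat_coeff \<mu> \<gamma> p"
  define X where "X j c = block n x j $ c" for j c
  have dist: "\<mu> i \<noteq> \<mu> j" if "1 \<le> i" "i < j" "j \<le> k" for i j
    using inj_onD[OF inj, of i j] that by auto
  fix r assume "r < dim_vec (eval_matpoly n m P (\<mu> p) *\<^sub>v hat_block n \<mu> \<gamma> x p)"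
  then have r: "r < n" by (simp add: eval_matpoly_def)
  have "hat_block n \<mu> \<gamma> (F_mat n m k P \<mu> \<gamma> *\<^sub>v x) p $ r
      = (\<Sum>i = 1..p. h i * (\<Sum>j = 1..i. \<Sum>c<n. g ^ (i - j) * D r c j (i - j) * X j c))"
    unfolding hat_block_eq[OF p(1)] using r p x
    by (simp add: block_F_mat_mult h_def g_def D_def X_def)
  also have "\<dots> = (\<Sum>i = 1..p. \<Sum>j = 1..i. \<Sum>c<n. h i * g ^ (i - j) * D r c j (i - j) * X j c)"
    by (simp add: sum_distrib_left mult.assoc)
  also have "\<dots> = (\<Sum>j = 1..p. \<Sum>i = j..p. \<Sum>c<n. h i * g ^ (i - j) * D r c j (i - j) * X j c)"
    by (rule sum_triangle_swap)
  also have "\<dots> = (\<Sum>j = 1..p. \<Sum>c<n. (\<Sum>i = j..p. h i * g ^ (i - j) * D r c j (i - j)) * X j c)"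
    unfolding sum_distrib_right by (intro sum.cong refl sum.swap)
  also have "\<dots> = (\<Sum>j = 1..p. \<Sum>c<n. h j * D r c p 0 * X j c)"
  proof (intro sum.cong refl arg_cong2[where f = "(*)"])
    fix j c assume "j \<in> {1..p}" "c \<in> {..<n}"
    then show "(\<Sum>i = j..p. h i * g ^ (i - j) * D r c j (i - j)) = h j * D r c p 0"
      unfolding h_def g_def D_def
      by (intro divided_differences_left_eigenvector divdiff_rec) (use r p dist in auto)
  qed
  also have "\<dots> = (\<Sum>c<n. D r c p 0 * (\<Sum>j = 1..p. h j * X j c))"
    by (subst sum.swap) (simp add: sum_distrib_left mult_ac)
  also have "\<dots> = (eval_matpoly n m P (\<mu> p) *\<^sub>v hat_block n \<mu> \<gamma> x p) $ r"
    unfolding hat_block_eq[OF p(1)] using r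
    by (simp add: D_def X_def h_def scalar_prod_def atLeast0LessThan eval_matpoly_def)
  finally show "hat_block n \<mu> \<gamma> (F_mat n m k P \<mu> \<gamma> *\<^sub>v x) p $ r
      = (eval_matpoly n m P (\<mu> p) *\<^sub>v hat_block n \<mu> \<gamma> x p) $ r" .
qed (simp add: hat_block_def eval_matpoly_def)

definition kernel_mat :: "nat \<Rightarrow> nat \<Rightarrow> (nat \<Rightarrow> complex) \<Rightarrow> real \<Rightarrow> (nat \<Rightarrow> complex vec) \<Rightarrow> complex mat" where
  "kernel_mat n k \<mu> \<gamma> v = mat (n * k) k (\<lambda>(r, c).
     let i = r div n + 1; s = c + 1 in
     if s \<le> i then kernel_coeff \<mu> \<gamma> s i * v s $ (r mod n) else 0)"

lemma dim_kernel_mat [simp]: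
  "dim_row (kernel_mat n k \<mu> \<gamma> v) = n * k" "dim_col (kernel_mat n k \<mu> \<gamma> v) = k"
  by (simp_all add: kernel_mat_def)

lemma kernel_mat_carrier [simp, intro]: "kernel_mat n k \<mu> \<gamma> v \<in> carrier_mat (n * k) k"
  by (simp add: kernel_mat_def)

lemma block_kernel_mat_mult:
  assumes a: "a \<in> carrier_vec k" and i: "1 \<le> i" "i \<le> k" and r: "r < n"
  shows "block n (kernel_mat n k \<mu> \<gamma> v *\<^sub>v a) i $ r
    = (\<Sum>s = 1..i. a $ (s - 1) * kernel_coeff \<mu> \<gamma> s i * v s $ r)"
proof -
  define R where "R = (i - 1) * n + r"
  have R: "R < n * k" "R div n = i - 1" "R mod n = r"
    using block_index_less[OF i r] r by (auto simp: R_def)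
  have "block n (kernel_mat n k \<mu> \<gamma> v *\<^sub>v a) i $ r = (\<Sum>c<k. kernel_mat n k \<mu> \<gamma> v $$ (R, c) * a $ c)"
  proof -
    have "block n (kernel_mat n k \<mu> \<gamma> v *\<^sub>v a) i $ r = (kernel_mat n k \<mu> \<gamma> v *\<^sub>v a) $ R"
      using r by (simp add: block_def R_def)
    also have "\<dots> = (\<Sum>c<k. kernel_mat n k \<mu> \<gamma> v $$ (R, c) * a $ c)"
      using R(1) a by (auto simp: scalar_prod_def atLeast0LessThan intro!: sum.cong)
    finally show ?thesis .
  qed
  also have "\<dots> = (\<Sum>s = 1..k. kernel_mat n k \<mu> \<gamma> v $$ (R, s - 1) * a $ (s - 1))"
    by (rule sum.reindex_bij_witness[of _ "\<lambda>j. j - 1" Suc]) auto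
  also have "\<dots> = (\<Sum>s = 1..i. a $ (s - 1) * kernel_coeff \<mu> \<gamma> s i * v s $ r)"
  proof (intro sum.mono_neutral_cong_right ballI)
    have K: "kernel_mat n k \<mu> \<gamma> v $$ (R, s - 1) = (if s \<le> i then kernel_coeff \<mu> \<gamma> s i * v s $ r else 0)"
      if "1 \<le> s" "s \<le> k" for s
      using that i R by (cases s; cases i) (auto simp: kernel_mat_def)
    show "kernel_mat n k \<mu> \<gamma> v $$ (R, s - 1) * a $ (s - 1) = 0" if "s \<in> {1..k} - {1..i}" for s
      using that K[of s] by auto
    show "kernel_mat n k \<mu> \<gamma> v $$ (R, s - 1) * a $ (s - 1) = a $ (s - 1) * kernel_coeff \<mu> \<gamma> s i * v s $ r"
      if "s \<in> {1..i}" for s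
      using that i K[of s] by (auto simp: mult_ac)
  qed (use i in auto)
  finally show ?thesis .
qed

text \<open>Forward substitution: block \<open>i\<close> of the product involves only the
  coefficients with \<open>s \<le> i\<close>, and the newest one multiplies
  \<open>v i \<noteq> 0\<close> with factor 1. Linear dependence among the vectors
  \<open>v s\<close> does no harm.\<close>

lemma kernel_mat_inj:
  assumes a: "a \<in> carrier_vec k" and v: "\<And>s. 1 \<le> s \<Longrightarrow> s \<le> k \<Longrightarrow> v s \<in> carrier_vec n \<and> v s \<noteq> 0\<^sub>v n"
    and 0: "kernel_mat n k \<mu> \<gamma> v *\<^sub>v a = 0\<^sub>v (n * k)"
  shows "a = 0\<^sub>v k"
proof -
  have "a $ (i - 1) = 0" if "1 \<le> i" "i \<le> k" for i
    using that
  proof (induction i rule: less_induct)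
    case (less i)
    obtain r where r: "r < n" "v i $ r \<noteq> 0"
      using v[OF less.prems] by (metis carrier_vecD eq_vecI index_zero_vec)
    have "0 = block n (kernel_mat n k \<mu> \<gamma> v *\<^sub>v a) i $ r"
      unfolding 0 using r block_index_less[OF less.prems r(1)] by (simp add: block_def)
    also have "\<dots> = (\<Sum>s = 1..i. if s = i then a $ (i - 1) * v i $ r else 0)"
      unfolding block_kernel_mat_mult[OF a less.prems r(1)]
      using less by (intro sum.cong) auto
    also have "\<dots> = a $ (i - 1) * v i $ r" using less.prems by simp
    finally show ?case using r by simp
  qed
  from this[of "Suc _"] show ?thesis using a by (intro eq_vecI) auto
qed

text \<open>After a swap of the triangular sum, the inner sum over \<open>j\<close> is the right
  eigenvector identity for each entry. This leaves in block \<open>i\<close> a combination of the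
  vectors \<open>Q(\<mu> s) v s\<close>, all of them zero.\<close>

lemma F_mat_kernel_mat:
  assumes a: "a \<in> carrier_vec k" and inj: "inj_on \<mu> {1..k}"
    and v: "\<And>s. 1 \<le> s \<Longrightarrow> s \<le> k \<Longrightarrow> v s \<in> carrier_vec n"
    and ker: "\<And>s. 1 \<le> s \<Longrightarrow> s \<le> k \<Longrightarrow> eval_matpoly n m Q (\<mu> s) *\<^sub>v v s = 0\<^sub>v n"
  shows "F_mat n m k Q \<mu> \<gamma> *\<^sub>v (kernel_mat n k \<mu> \<gamma> v *\<^sub>v a) = 0\<^sub>v (n * k)"
proof -
  define x where "x = kernel_mat n k \<mu> \<gamma> v *\<^sub>v a"
  have x: "x \<in> carrier_vec (n * k)"
    unfolding x_def using a by (rule mult_mat_vec_carrier[OF kernel_mat_carrier])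
  define D where "D r c j t = divdiff n m Q \<mu> j t $$ (r, c)" for r c j t
  define g where "g = complex_of_real \<gamma>"
  define b where "b = kernel_coeff \<mu> \<gamma>"
  have dist: "\<mu> i \<noteq> \<mu> j" if "1 \<le> i" "i < j" "j \<le> k" for i j
    using inj_onD[OF inj, of i j] that by auto
  have blk: "block n (F_mat n m k Q \<mu> \<gamma> *\<^sub>v x) i $ r = 0" if i: "1 \<le> i" "i \<le> k" and r: "r < n" for i r
  proof -
    have "block n (F_mat n m k Q \<mu> \<gamma> *\<^sub>v x) i $ r
        = (\<Sum>j = 1..i. \<Sum>c<n. g ^ (i - j) * D r c j (i - j) * (\<Sum>s = 1..j. a $ (s - 1) * b s j * v s $ c))"
      unfolding block_F_mat_mult[OF x i r] using i
      by (intro sum.cong) (auto simp: x_def block_kernel_mat_mult[OF a] g_def D_def b_def)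
    also have "\<dots> = (\<Sum>j = 1..i. \<Sum>s = 1..j. \<Sum>c<n. g ^ (i - j) * D r c j (i - j) * (a $ (s - 1) * b s j * v s $ c))"
      unfolding sum_distrib_left by (intro sum.cong refl sum.swap)
    also have "\<dots> = (\<Sum>s = 1..i. \<Sum>j = s..i. \<Sum>c<n. g ^ (i - j) * D r c j (i - j) * (a $ (s - 1) * b s j * v s $ c))"
      by (rule sum_triangle_swap)
    also have "\<dots> = (\<Sum>s = 1..i. \<Sum>c<n. a $ (s - 1) * v s $ c * (\<Sum>j = s..i. g ^ (i - j) * D r c j (i - j) * b s j))"
      unfolding sum_distrib_left by (subst sum.swap) (simp add: mult_ac)
    also have "\<dots> = (\<Sum>s = 1..i. \<Sum>c<n. a $ (s - 1) * v s $ c * (b s i * D r c s 0))"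
    proof (intro sum.cong refl arg_cong2[where f = "(*)"])
      fix s c assume "s \<in> {1..i}" "c \<in> {..<n}"
      then show "(\<Sum>j = s..i. g ^ (i - j) * D r c j (i - j) * b s j) = b s i * D r c s 0"
        unfolding b_def g_def D_def
        by (intro divided_differences_right_eigenvector divdiff_rec) (use r i dist in auto)
    qed
    also have "\<dots> = (\<Sum>s = 1..i. a $ (s - 1) * b s i * (eval_matpoly n m Q (\<mu> s) *\<^sub>v v s) $ r)"
    proof (intro sum.cong refl)
      fix s assume "s \<in> {1..i}"
      then have "v s \<in> carrier_vec n" using v i by auto
      then have "(eval_matpoly n m Q (\<mu> s) *\<^sub>v v s) $ r = (\<Sum>c<n. D r c s 0 * v s $ c)"
        using r by (auto simp: D_def eval_matpoly_def scalar_prod_def atLeast0LessThan intro!: sum.cong)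
      then show "(\<Sum>c<n. a $ (s - 1) * v s $ c * (b s i * D r c s 0))
          = a $ (s - 1) * b s i * (eval_matpoly n m Q (\<mu> s) *\<^sub>v v s) $ r"
        by (simp add: sum_distrib_left mult_ac)
    qed
    also have "\<dots> = 0" using ker i r by (intro sum.neutral) auto
    finally show ?thesis .
  qed
  show ?thesis
  proof (rule eq_vecI)
    fix R assume "R < dim_vec (0\<^sub>v (n * k) :: complex vec)"
    then have R: "R < n * k" by simp
    \<comment> \<open>An index below \<open>n * k\<close> forces \<open>n > 0\<close>, so it splits
      into a block number and an offset.\<close>
    then have n: "0 < n" by (cases n) auto
    then have "R div n < k" "R mod n < n" using R by (auto simp: less_mult_imp_div_less mult.commute)
    then show "(F_mat n m k Q \<mu> \<gamma> *\<^sub>v (kernel_mat n k \<mu> \<gamma> v *\<^sub>v a)) $ R = 0\<^sub>v (n * k) $ R"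
      using blk[of "R div n + 1" "R mod n"] R by (simp add: block_def x_def)
  qed simp
qed

section \<open>The lower bound\<close>

lemma L2_set_sum_le:
  assumes "finite A"
  shows "L2_set (\<lambda>r. \<Sum>j\<in>A. f j r) R \<le> (\<Sum>j\<in>A. L2_set (f j) R)"
  using assms
proof (induction A)
  case (insert a A)
  have "L2_set (\<lambda>r. \<Sum>j\<in>insert a A. f j r) R = L2_set (\<lambda>r. f a r + (\<Sum>j\<in>A. f j r)) R"
    using insert by simp
  also have "\<dots> \<le> L2_set (f a) R + L2_set (\<lambda>r. \<Sum>j\<in>A. f j r) R" by (rule L2_set_triangle_ineq)
  finally show ?case using insert by simp
qed (simp add: L2_set_def)

lemma vec_norm2_sum_le:
  assumes "finite A"
  shows "vec_norm2 (vec n (\<lambda>r. \<Sum>j\<in>A. f j r)) \<le> (\<Sum>j\<in>A. vec_norm2 (vec n (f j)))"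
proof -
  have "vec_norm2 (vec n (\<lambda>r. \<Sum>j\<in>A. f j r)) \<le> L2_set (\<lambda>r. \<Sum>j\<in>A. cmod (f j r)) {..<n}"
    unfolding vec_norm2_def dim_vec by (intro L2_set_mono) (auto intro: norm_sum)
  also have "\<dots> \<le> (\<Sum>j\<in>A. L2_set (\<lambda>r. cmod (f j r)) {..<n})" by (rule L2_set_sum_le[OF assms])
  also have "\<dots> = (\<Sum>j\<in>A. vec_norm2 (vec n (f j)))"
    by (intro sum.cong refl) (auto simp: vec_norm2_def intro!: L2_set_cong)
  finally show ?thesis .
qed

lemma vec_norm2_smult: "vec_norm2 (c \<cdot>\<^sub>v x) = cmod c * vec_norm2 x"
proof -
  have "vec_norm2 (c \<cdot>\<^sub>v x) = L2_set (\<lambda>i. cmod c * cmod (x $ i)) {..<dim_vec x}"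
    unfolding vec_norm2_def by (intro L2_set_cong) (auto simp: norm_mult)
  then show ?thesis by (simp add: vec_norm2_def L2_set_right_distrib)
qed

lemma spectral_norm_bound:
  assumes "x \<in> carrier_vec (dim_col A)"
  shows "vec_norm2 (A *\<^sub>v x) \<le> spectral_norm A * vec_norm2 x"
proof (cases "vec_norm2 x = 0")
  case True
  then have "x = 0\<^sub>v (dim_col A)" using vec_norm2_eq_0[OF assms] by simp
  then have "A *\<^sub>v x = 0\<^sub>v (dim_row A)" by (intro eq_vecI) auto
  then show ?thesis using True by simp
next
  case False
  then have pos: "0 < vec_norm2 x" using vec_norm2_nonneg[of x] by linarith
  define c where "c = complex_of_real (1 / vec_norm2 x)"
  have "vec_norm2 (A *\<^sub>v (c \<cdot>\<^sub>v x)) \<le> spectral_norm A"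
    using assms pos by (intro spectral_norm_upper) (auto simp: vec_norm2_smult c_def norm_divide)
  also have "A *\<^sub>v (c \<cdot>\<^sub>v x) = c \<cdot>\<^sub>v (A *\<^sub>v x)"
    using assms by (intro mult_mat_vec[of _ "dim_row A" "dim_col A"]) auto
  finally show ?thesis using pos by (simp add: vec_norm2_smult c_def norm_divide field_simps)
qed

lemma smult_mat_mult_vec:
  fixes A :: "complex mat"
  assumes "A \<in> carrier_mat nr nc" "x \<in> carrier_vec nc"
  shows "(c \<cdot>\<^sub>m A) *\<^sub>v x = c \<cdot>\<^sub>v (A *\<^sub>v x)"
proof (rule eq_vecI)
  fix i assume "i < dim_vec (c \<cdot>\<^sub>v (A *\<^sub>v x))"
  then have i: "i < nr" using assms by simp
  have "row A i \<in> carrier_vec nc" using assms(1) by (intro carrier_vecI) simp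
  then show "((c \<cdot>\<^sub>m A) *\<^sub>v x) $ i = (c \<cdot>\<^sub>v (A *\<^sub>v x)) $ i"
    using i assms by (simp add: smult_scalar_prod_distrib[of _ nc])
qed (use assms in simp)

lemma spectral_norm_smult: "spectral_norm (c \<cdot>\<^sub>m A) = cmod c * spectral_norm A"
proof -
  have le: "spectral_norm (c \<cdot>\<^sub>m A) \<le> cmod c * spectral_norm A" for c A
  proof (rule spectral_norm_least)
    fix x assume x: "x \<in> carrier_vec (dim_col (c \<cdot>\<^sub>m A))" "vec_norm2 x \<le> 1"
    have "(c \<cdot>\<^sub>m A) *\<^sub>v x = c \<cdot>\<^sub>v (A *\<^sub>v x)"
      using x(1) by (intro smult_mat_mult_vec[of _ "dim_row A" "dim_col A"]) auto
    then show "vec_norm2 ((c \<cdot>\<^sub>m A) *\<^sub>v x) \<le> cmod c * spectral_norm A"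
      using spectral_norm_upper[of x A] x by (auto simp: vec_norm2_smult intro: mult_left_mono)
  qed
  show ?thesis
  proof (cases "c = 0")
    case True
    then show ?thesis using le[of c A] spectral_norm_nonneg[of "c \<cdot>\<^sub>m A"] by simp
  next
    case False
    then have "(1 / c) \<cdot>\<^sub>m (c \<cdot>\<^sub>m A) = A" by (intro eq_matI) auto
    then have "spectral_norm A \<le> cmod (1 / c) * spectral_norm (c \<cdot>\<^sub>m A)" using le[of "1 / c" "c \<cdot>\<^sub>m A"] by simp
    then show ?thesis using False le[of c A] by (simp add: norm_divide field_simps)
  qed
qed

lemma spectral_norm_minus_le:
  assumes "A \<in> carrier_mat nr nc" "B \<in> carrier_mat nr nc"
  shows "spectral_norm (A - B) \<le> spectral_norm A + spectral_norm B"
proof -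
  have "A - B = A + (- B)" using assms by (intro eq_matI) auto
  then show ?thesis
    using spectral_norm_triangle[OF assms(1), of "- B"] assms by (simp add: spectral_norm_uminus)
qed

text \<open>The scalars \<open>z j\<close> are arbitrary in order to serve twice: powers of
  \<open>\<mu> i\<close> give an evaluation, quotients of differences of powers give a first divided
  difference.\<close>

lemma spectral_norm_lincomb_le:
  fixes m :: nat
  assumes "\<And>j. j \<le> m \<Longrightarrow> Q j \<in> carrier_mat n n"
  shows "spectral_norm (mat n n (\<lambda>(r, c). \<Sum>j\<le>m. Q j $$ (r, c) * z j))
    \<le> (\<Sum>j\<le>m. spectral_norm (Q j) * cmod (z j))"
  using assms
proof (induction m)
  case 0
  have eq: "mat n n (\<lambda>(r, c). \<Sum>j\<le>0. Q j $$ (r, c) * z j) = z 0 \<cdot>\<^sub>m Q 0"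
    using 0[of 0] by (intro eq_matI) auto
  show ?case unfolding eq by (simp add: spectral_norm_smult)
next
  case (Suc m)
  let ?M = "mat n n (\<lambda>(r, c). \<Sum>j\<le>m. Q j $$ (r, c) * z j)"
  have Q: "Q (Suc m) \<in> carrier_mat n n" using Suc.prems by simp
  have "mat n n (\<lambda>(r, c). \<Sum>j\<le>Suc m. Q j $$ (r, c) * z j) = ?M + z (Suc m) \<cdot>\<^sub>m Q (Suc m)"
    using Q by (intro eq_matI) auto
  also have "spectral_norm \<dots> \<le> spectral_norm ?M + spectral_norm (z (Suc m) \<cdot>\<^sub>m Q (Suc m))"
    using Q by (intro spectral_norm_triangle[of _ n n]) auto
  also have "\<dots> \<le> (\<Sum>j\<le>m. spectral_norm (Q j) * cmod (z j)) + spectral_norm (Q (Suc m)) * cmod (z (Suc m))"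
  proof (rule add_mono)
    show "spectral_norm ?M \<le> (\<Sum>j\<le>m. spectral_norm (Q j) * cmod (z j))"
      by (rule Suc.IH) (use Suc.prems in simp)
  qed (simp add: spectral_norm_smult mult.commute)
  finally show ?case unfolding sum.atMost_Suc .
qed

text \<open>The induction runs along the clauses of \<open>varpi\<close>. At order 1 the powers are
  subtracted inside each coefficient before norms are taken; from order 2 on the triangle inequality
  is applied to the two divided differences of lower order.\<close>

lemma spectral_norm_divdiff_le:
  assumes "\<And>j. j \<le> m \<Longrightarrow> \<Delta> j \<in> carrier_mat n n"
    and "\<And>j. j \<le> m \<Longrightarrow> spectral_norm (\<Delta> j) \<le> \<epsilon> * w j"
  shows "spectral_norm (divdiff n m \<Delta> \<mu> i t) \<le> \<epsilon> * varpi m w \<mu> i t"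
  using assms
proof (induction m w \<mu> i t rule: varpi.induct)
  case (1 m w \<mu> i)
  have "spectral_norm (divdiff n m \<Delta> \<mu> i 0) \<le> (\<Sum>j\<le>m. spectral_norm (\<Delta> j) * cmod (\<mu> i ^ j))"
    unfolding divdiff.simps eval_matpoly_def by (rule spectral_norm_lincomb_le) (use 1 in auto)
  also have "\<dots> \<le> (\<Sum>j\<le>m. \<epsilon> * w j * cmod (\<mu> i ^ j))"
    using 1 by (intro sum_mono mult_right_mono) auto
  finally show ?case by (simp add: weight_def sum_distrib_left norm_power mult.assoc)
next
  case (2 m w \<mu> i)
  have "divdiff n m \<Delta> \<mu> i (Suc 0)
    = mat n n (\<lambda>(r, c). \<Sum>j\<le>m. \<Delta> j $$ (r, c) * ((\<mu> i ^ j - \<mu> (Suc i) ^ j) / (\<mu> i - \<mu> (Suc i))))"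
    by (intro eq_matI) (auto simp: eval_matpoly_def sum_subtractf[symmetric] sum_divide_distrib right_diff_distrib)
  also have "spectral_norm \<dots> \<le> (\<Sum>j\<le>m. spectral_norm (\<Delta> j) * cmod ((\<mu> i ^ j - \<mu> (Suc i) ^ j) / (\<mu> i - \<mu> (Suc i))))"
    by (rule spectral_norm_lincomb_le) (use 2 in auto)
  also have "\<dots> \<le> (\<Sum>j\<le>m. \<epsilon> * w j * cmod ((\<mu> i ^ j - \<mu> (Suc i) ^ j) / (\<mu> i - \<mu> (Suc i))))"
    using 2 by (intro sum_mono mult_right_mono) auto
  finally show ?case by (simp add: sum_distrib_left norm_divide mult.assoc)
next
  case (3 m w \<mu> i t)
  let ?D = "divdiff n m \<Delta> \<mu>"
  let ?d = "cmod (\<mu> i - \<mu> (i + Suc (Suc t)))"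
  have "spectral_norm (?D i (Suc (Suc t))) = spectral_norm (?D i (Suc t) - ?D (Suc i) (Suc t)) / ?d"
    by (subst divdiff.simps) (simp add: spectral_norm_smult norm_divide del: divdiff.simps)
  also have "\<dots> \<le> (spectral_norm (?D i (Suc t)) + spectral_norm (?D (Suc i) (Suc t))) / ?d"
    by (intro divide_right_mono spectral_norm_minus_le[of _ n n]) auto
  also have "\<dots> \<le> (\<epsilon> * varpi m w \<mu> i (Suc t) + \<epsilon> * varpi m w \<mu> (Suc i) (Suc t)) / ?d"
    using 3 by (intro divide_right_mono add_mono) auto
  finally show ?case by (simp add: ring_distribs)
qed

section \<open>Additivity of \<open>F_mat\<close> and comparison with \<open>F_varpi\<close>\<close>

lemma divdiff_add:
  assumes "\<And>j. P j \<in> carrier_mat n n" "\<And>j. \<Delta> j \<in> carrier_mat n n"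
  shows "divdiff n m (\<lambda>j. P j + \<Delta> j) \<mu> i t = divdiff n m P \<mu> i t + divdiff n m \<Delta> \<mu> i t"
proof (induction t arbitrary: i)
  case 0
  have [simp]: "dim_row (\<Delta> j) = n" "dim_col (\<Delta> j) = n" for j using assms(2)[of j] by auto
  show ?case
    by (rule eq_matI) (simp_all add: eval_matpoly_def distrib_right sum.distrib)
next
  case (Suc t)
  show ?case
    unfolding divdiff.simps Suc by (rule eq_matI) (simp_all add: diff_divide_distrib add_divide_distrib del: divdiff.simps)
qed

lemma F_mat_add:
  assumes "\<And>j. P j \<in> carrier_mat n n" "\<And>j. \<Delta> j \<in> carrier_mat n n"
  shows "F_mat n m k (\<lambda>j. P j + \<Delta> j) \<mu> \<gamma> = F_mat n m k P \<mu> \<gamma> + F_mat n m k \<Delta> \<mu> \<gamma>"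
proof (rule eq_matI)
  fix R C assume "R < dim_row (F_mat n m k P \<mu> \<gamma> + F_mat n m k \<Delta> \<mu> \<gamma>)"
    "C < dim_col (F_mat n m k P \<mu> \<gamma> + F_mat n m k \<Delta> \<mu> \<gamma>)"
  then have RC: "R < n * k" "C < n * k" by auto
  then have "R mod n < n" "C mod n < n" by (auto intro!: mod_less_divisor gr0I)
  then show "F_mat n m k (\<lambda>j. P j + \<Delta> j) \<mu> \<gamma> $$ (R, C) = (F_mat n m k P \<mu> \<gamma> + F_mat n m k \<Delta> \<mu> \<gamma>) $$ (R, C)"
    using RC by (simp add: F_mat_def Let_def divdiff_add[OF assms] distrib_left)
qed auto

lemma vec_norm2_blocks:
  assumes "x \<in> carrier_vec (n * k)"
  shows "(vec_norm2 x)\<^sup>2 = (\<Sum>j = 1..k. (vec_norm2 (block n x j))\<^sup>2)"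
proof -
  have "(vec_norm2 x)\<^sup>2 = (\<Sum>c<n * k. (cmod (x $ c))\<^sup>2)" using assms by (simp add: vec_norm2_sq)
  also have "\<dots> = (\<Sum>j = 1..k. \<Sum>c<n. (cmod (x $ ((j - 1) * n + c)))\<^sup>2)" by (rule sum_blocks)
  finally show ?thesis by (simp add: vec_norm2_sq block_def)
qed

lemma F_varpi_mult:
  assumes "1 \<le> i" "i \<le> k"
  shows "(F_varpi m k w \<mu> \<gamma> *\<^sub>v vec k (\<lambda>j. complex_of_real (X (Suc j)))) $ (i - 1)
    = complex_of_real (\<Sum>j = 1..i. \<gamma> ^ (i - j) * varpi m w \<mu> j (i - j) * X j)"
proof -
  have "(F_varpi m k w \<mu> \<gamma> *\<^sub>v vec k (\<lambda>j. complex_of_real (X (Suc j)))) $ (i - 1)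
      = (\<Sum>j<k. F_varpi m k w \<mu> \<gamma> $$ (i - 1, j) * complex_of_real (X (Suc j)))"
    using assms by (simp add: F_varpi_def scalar_prod_def atLeast0LessThan)
  also have "\<dots> = (\<Sum>j = 1..k. F_varpi m k w \<mu> \<gamma> $$ (i - 1, j - 1) * complex_of_real (X j))"
    by (rule sum.reindex_bij_witness[of _ "\<lambda>j. j - 1" Suc]) auto
  also have "\<dots> = (\<Sum>j = 1..i. complex_of_real (\<gamma> ^ (i - j) * varpi m w \<mu> j (i - j) * X j))"
  proof (intro sum.mono_neutral_cong_right ballI)
    have K: "F_varpi m k w \<mu> \<gamma> $$ (i - 1, j - 1)
        = (if j \<le> i then complex_of_real (\<gamma> ^ (i - j) * varpi m w \<mu> j (i - j)) else 0)"
      if "1 \<le> j" "j \<le> k" for j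
      using that assms by (cases i; cases j) (auto simp: F_varpi_def)
    show "F_varpi m k w \<mu> \<gamma> $$ (i - 1, j - 1) * complex_of_real (X j) = 0" if "j \<in> {1..k} - {1..i}" for j
      using that K[of j] by auto
    show "F_varpi m k w \<mu> \<gamma> $$ (i - 1, j - 1) * complex_of_real (X j)
      = complex_of_real (\<gamma> ^ (i - j) * varpi m w \<mu> j (i - j) * X j)" if "j \<in> {1..i}" for j
      using that assms K[of j] by auto
  qed (use assms in auto)
  finally show ?thesis by simp
qed

text \<open>Comparison with a scalar matrix: replacing each block of \<open>x\<close> by its norm
  gives \<open>\<xi>\<close>, a vector of the same norm as \<open>x\<close>. Each block of the
  product has norm at most \<open>\<epsilon>\<close> times the matching entry of
  \<open>F_varpi\<close> applied to \<open>\<xi>\<close>; here \<open>\<gamma> \<ge> 0\<close> lets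
  the powers of \<open>\<gamma>\<close> pass unchanged through the norm.\<close>

lemma F_mat_perturbation_bound:
  assumes \<Delta>: "\<And>j. j \<le> m \<Longrightarrow> \<Delta> j \<in> carrier_mat n n"
    "\<And>j. j \<le> m \<Longrightarrow> spectral_norm (\<Delta> j) \<le> \<epsilon> * w j"
    and "0 \<le> \<epsilon>" "0 \<le> \<gamma>" and x: "x \<in> carrier_vec (n * k)"
  shows "vec_norm2 (F_mat n m k \<Delta> \<mu> \<gamma> *\<^sub>v x) \<le> \<epsilon> * spectral_norm (F_varpi m k w \<mu> \<gamma>) * vec_norm2 x"
proof -
  define y where "y = F_mat n m k \<Delta> \<mu> \<gamma> *\<^sub>v x"
  have y: "y \<in> carrier_vec (n * k)" unfolding y_def using x by (rule mult_mat_vec_carrier[OF F_mat_carrier])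
  define X where "X j = vec_norm2 (block n x j)" for j
  define \<xi> where "\<xi> = vec k (\<lambda>j. complex_of_real (X (Suc j)))"
  define Y where "Y i = (\<Sum>j = 1..i. \<gamma> ^ (i - j) * varpi m w \<mu> j (i - j) * X j)" for i
  have shift: "(\<Sum>j<k. f (Suc j)) = (\<Sum>j = 1..k. f j)" for f :: "nat \<Rightarrow> real"
    by (rule sum.reindex_bij_witness[of _ "\<lambda>j. j - 1" Suc]) auto
  have "(vec_norm2 \<xi>)\<^sup>2 = (\<Sum>j<k. (X (Suc j))\<^sup>2)" by (simp add: vec_norm2_sq \<xi>_def)
  also have "\<dots> = (vec_norm2 x)\<^sup>2" unfolding vec_norm2_blocks[OF x] X_def by (rule shift)
  finally have \<xi>: "vec_norm2 \<xi> = vec_norm2 x" by simp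
  have "(vec_norm2 (F_varpi m k w \<mu> \<gamma> *\<^sub>v \<xi>))\<^sup>2 = (\<Sum>i<k. (cmod ((F_varpi m k w \<mu> \<gamma> *\<^sub>v \<xi>) $ (Suc i - 1)))\<^sup>2)"
    by (simp add: vec_norm2_sq F_varpi_def)
  also have "\<dots> = (\<Sum>i = 1..k. (cmod ((F_varpi m k w \<mu> \<gamma> *\<^sub>v \<xi>) $ (i - 1)))\<^sup>2)" by (rule shift)
  also have "\<dots> = (\<Sum>i = 1..k. (Y i)\<^sup>2)"
    unfolding \<xi>_def
  proof (rule sum.cong)
    fix i assume "i \<in> {1..k}"
    then show "(cmod ((F_varpi m k w \<mu> \<gamma> *\<^sub>v vec k (\<lambda>j. complex_of_real (X (Suc j)))) $ (i - 1)))\<^sup>2 = (Y i)\<^sup>2"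
      by (subst F_varpi_mult) (auto simp: Y_def simp del: of_real_sum)
  qed simp
  finally have FY: "(vec_norm2 (F_varpi m k w \<mu> \<gamma> *\<^sub>v \<xi>))\<^sup>2 = (\<Sum>i = 1..k. (Y i)\<^sup>2)" .
  have "vec_norm2 (block n y i) \<le> \<epsilon> * Y i" if i: "1 \<le> i" "i \<le> k" for i
  proof -
    define f where "f j = complex_of_real (\<gamma> ^ (i - j)) \<cdot>\<^sub>v (divdiff n m \<Delta> \<mu> j (i - j) *\<^sub>v block n x j)" for j
    have "block n y i = vec n (\<lambda>r. \<Sum>j = 1..i. f j $ r)"
      by (intro eq_vecI) (auto simp: y_def block_F_mat_mult[OF x i] f_def scalar_prod_def
          atLeast0LessThan sum_distrib_left mult.assoc intro!: sum.cong)
    then have "vec_norm2 (block n y i) \<le> (\<Sum>j = 1..i. vec_norm2 (vec n (\<lambda>r. f j $ r)))"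
      using vec_norm2_sum_le[of "{1..i}" n "\<lambda>j r. f j $ r"] by simp
    also have "\<dots> \<le> (\<Sum>j = 1..i. \<gamma> ^ (i - j) * (\<epsilon> * varpi m w \<mu> j (i - j) * X j))"
    proof (rule sum_mono)
      fix j assume "j \<in> {1..i}"
      have "vec n (\<lambda>r. f j $ r) = f j" by (intro eq_vecI) (auto simp: f_def)
      then have "vec_norm2 (vec n (\<lambda>r. f j $ r)) = \<gamma> ^ (i - j) * vec_norm2 (divdiff n m \<Delta> \<mu> j (i - j) *\<^sub>v block n x j)"
        using \<open>0 \<le> \<gamma>\<close> by (simp add: f_def vec_norm2_smult norm_power)
      also have "\<dots> \<le> \<gamma> ^ (i - j) * (spectral_norm (divdiff n m \<Delta> \<mu> j (i - j)) * X j)"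
        unfolding X_def using \<open>0 \<le> \<gamma>\<close> by (intro mult_left_mono spectral_norm_bound) auto
      also have "\<dots> \<le> \<gamma> ^ (i - j) * (\<epsilon> * varpi m w \<mu> j (i - j) * X j)"
        using \<open>0 \<le> \<gamma>\<close> spectral_norm_divdiff_le[OF \<Delta>]
        by (intro mult_left_mono mult_right_mono) (auto simp: X_def)
      finally show "vec_norm2 (vec n (\<lambda>r. f j $ r)) \<le> \<gamma> ^ (i - j) * (\<epsilon> * varpi m w \<mu> j (i - j) * X j)" .
    qed
    finally show ?thesis by (simp add: Y_def sum_distrib_left mult_ac)
  qed
  then have "(vec_norm2 y)\<^sup>2 \<le> (\<Sum>i = 1..k. (\<epsilon> * Y i)\<^sup>2)"
    unfolding vec_norm2_blocks[OF y] by (intro sum_mono power_mono) auto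
  also have "\<dots> = (\<epsilon> * vec_norm2 (F_varpi m k w \<mu> \<gamma> *\<^sub>v \<xi>))\<^sup>2"
    by (simp add: power_mult_distrib FY sum_distrib_left)
  finally have "vec_norm2 y \<le> \<epsilon> * vec_norm2 (F_varpi m k w \<mu> \<gamma> *\<^sub>v \<xi>)"
    by (rule power2_le_imp_le) (use \<open>0 \<le> \<epsilon>\<close> in simp)
  also have "\<dots> \<le> \<epsilon> * (spectral_norm (F_varpi m k w \<mu> \<gamma>) * vec_norm2 \<xi>)"
    using \<open>0 \<le> \<epsilon>\<close> by (intro mult_left_mono spectral_norm_bound) (auto simp: \<xi>_def F_varpi_def)
  finally show ?thesis by (simp add: y_def \<xi> mult.assoc)
qed

lemma beta_low_le:
  assumes P: "P \<in> matpolys n m" and k: "1 \<le> k" "k \<le> n"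
    and inj: "inj_on \<mu> {1..k}" and "0 \<le> \<epsilon>" "0 \<le> \<gamma>"
    and Q: "Q \<in> perturbations n m P \<epsilon> w" "\<mu> ` {1..k} \<subseteq> spectrum_matpoly n m Q"
  shows "beta_low n m k P w \<mu> \<gamma> \<le> \<epsilon>"
proof -
  from Q(1) obtain \<Delta> where Q_def: "Q = (\<lambda>j. P j + \<Delta> j)" and \<Delta>: "\<Delta> \<in> matpolys n m"
    "\<And>j. j \<le> m \<Longrightarrow> spectral_norm (\<Delta> j) \<le> \<epsilon> * w j"
    by (auto simp: perturbations_def)
  have Pc: "P j \<in> carrier_mat n n" and \<Delta>c: "\<Delta> j \<in> carrier_mat n n" for j
    using P \<Delta>(1) by (auto simp: matpolys_def)
  have "\<forall>s. \<exists>v. s \<in> {1..k} \<longrightarrow> v \<in> carrier_vec n \<and> v \<noteq> 0\<^sub>v n \<and> eval_matpoly n m Q (\<mu> s) *\<^sub>v v = 0\<^sub>v n"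
  proof (intro allI)
    fix s
    show "\<exists>v. s \<in> {1..k} \<longrightarrow> v \<in> carrier_vec n \<and> v \<noteq> 0\<^sub>v n \<and> eval_matpoly n m Q (\<mu> s) *\<^sub>v v = 0\<^sub>v n"
    proof (cases "s \<in> {1..k}")
      case True
      then have "\<mu> s \<in> spectrum_matpoly n m Q" using Q(2) by blast
      then show ?thesis by (auto simp: spectrum_matpoly_def)
    qed blast
  qed
  then obtain v where v: "\<And>s. 1 \<le> s \<Longrightarrow> s \<le> k \<Longrightarrow> v s \<in> carrier_vec n"
    "\<And>s. 1 \<le> s \<Longrightarrow> s \<le> k \<Longrightarrow> v s \<noteq> 0\<^sub>v n"
    "\<And>s. 1 \<le> s \<Longrightarrow> s \<le> k \<Longrightarrow> eval_matpoly n m Q (\<mu> s) *\<^sub>v v s = 0\<^sub>v n"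
    by (metis atLeastAtMost_iff)
  \<comment> \<open>For size \<open>n * k\<close> the index \<open>n * k - k + 1\<close> selects the
    \<open>k\<close>th smallest singular value, matching the \<open>k\<close> columns of
    \<open>kernel_mat\<close>.\<close>
  have "singular_value (F_mat n m k P \<mu> \<gamma>) (n * k - k + 1) \<le> \<epsilon> * spectral_norm (F_varpi m k w \<mu> \<gamma>)"
  proof (rule singular_value_le_on_subspace[OF F_mat_carrier kernel_mat_carrier k(1)])
    show "k \<le> n * k" using k by simp
    show "a = 0\<^sub>v k" if "a \<in> carrier_vec k" "kernel_mat n k \<mu> \<gamma> v *\<^sub>v a = 0\<^sub>v (n * k)" for a :: "complex vec"
      using kernel_mat_inj[OF that(1) _ that(2)] v by blast
    fix a :: "complex vec" assume a: "a \<in> carrier_vec k"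
    define x where "x = kernel_mat n k \<mu> \<gamma> v *\<^sub>v a"
    have x: "x \<in> carrier_vec (n * k)" unfolding x_def by (rule mult_mat_vec_carrier[OF kernel_mat_carrier a])
    let ?FP = "F_mat n m k P \<mu> \<gamma>" and ?FD = "F_mat n m k \<Delta> \<mu> \<gamma>"
    have "0\<^sub>v (n * k) = (?FP + ?FD) *\<^sub>v x"
      using F_mat_kernel_mat[OF a inj v(1,3), of \<gamma>] F_mat_add[OF Pc \<Delta>c] by (simp add: Q_def x_def)
    also have "\<dots> = ?FP *\<^sub>v x + ?FD *\<^sub>v x"
      by (rule add_mult_distrib_mat_vec[OF F_mat_carrier F_mat_carrier x])
    finally have sum0: "?FP *\<^sub>v x + ?FD *\<^sub>v x = 0\<^sub>v (n * k)" by simp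
    have "?FP *\<^sub>v x = (- 1) \<cdot>\<^sub>v (?FD *\<^sub>v x)"
    proof (rule eq_vecI)
      fix i assume "i < dim_vec ((- 1) \<cdot>\<^sub>v (?FD *\<^sub>v x))"
      then show "(?FP *\<^sub>v x) $ i = ((- 1) \<cdot>\<^sub>v (?FD *\<^sub>v x)) $ i"
        using arg_cong[OF sum0, of "\<lambda>z. z $ i"] by (simp add: add_eq_0_iff2)
    qed simp
    then have "vec_norm2 (?FP *\<^sub>v x) = vec_norm2 (?FD *\<^sub>v x)" by (simp add: vec_norm2_smult)
    also have "\<dots> \<le> \<epsilon> * spectral_norm (F_varpi m k w \<mu> \<gamma>) * vec_norm2 x"
      using \<Delta>c \<Delta>(2) assms(5,6) x by (intro F_mat_perturbation_bound) auto
    finally show "vec_norm2 (?FP *\<^sub>v (kernel_mat n k \<mu> \<gamma> v *\<^sub>v a))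
      \<le> \<epsilon> * spectral_norm (F_varpi m k w \<mu> \<gamma>) * vec_norm2 (kernel_mat n k \<mu> \<gamma> v *\<^sub>v a)"
      by (simp add: x_def)
  qed
  then have "s_rho n m k P \<mu> \<gamma> \<le> \<epsilon> * spectral_norm (F_varpi m k w \<mu> \<gamma>)" by (simp add: s_rho_def)
  \<comment> \<open>If the norm of \<open>F_varpi\<close> is 0, then \<open>beta_low\<close> is a
    division by zero, hence 0, and the bound is \<open>0 \<le> \<epsilon>\<close>.\<close>
  then show ?thesis
    using \<open>0 \<le> \<epsilon>\<close> spectral_norm_nonneg[of "F_varpi m k w \<mu> \<gamma>"]
    by (cases "spectral_norm (F_varpi m k w \<mu> \<gamma>) = 0") (auto simp: beta_low_def field_simps)
qed

section \<open>Attainment of the distance\<close>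

text \<open>The null vector in the definition of the spectrum is traded for a determinant, a
  polynomial in the coefficients; in this form the spectral condition is visibly closed.\<close>

lemma in_spectrum_iff_det:
  "x \<in> spectrum_matpoly n m Q \<longleftrightarrow> det (eval_matpoly n m Q x) = 0"
  using det_0_iff_vec_prod_zero[of "eval_matpoly n m Q x" n]
  by (auto simp: spectrum_matpoly_def eval_matpoly_def)

text \<open>Changing the constant coefficient alone suffices. Column \<open>s - 1\<close> of
  \<open>D\<close>, counted from 0, is minus that column of \<open>P(\<mu> s)\<close>, so
  \<open>P(\<mu> s) + D\<close> annihilates the corresponding unit vector. Different eigenvalues
  occupy different columns, hence \<open>k \<le> n\<close>; dividing by \<open>w 0\<close> gives the
  radius.\<close>

lemma perturbation_exists:
  assumes P: "P \<in> matpolys n m" and w: "\<And>j. j \<le> m \<Longrightarrow> 0 \<le> w j" "0 < w 0" and "k \<le> n"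
  shows "\<exists>\<epsilon>\<ge>0. \<exists>Q\<in>perturbations n m P \<epsilon> w. \<mu> ` {1..k} \<subseteq> spectrum_matpoly n m Q"
proof -
  define D where "D = mat n n (\<lambda>(r, c). if c < k then - eval_matpoly n m P (\<mu> (Suc c)) $$ (r, c) else 0)"
  define \<Delta> where "\<Delta> j = (if j = 0 then D else 0\<^sub>m n n)" for j :: nat
  define \<epsilon> where "\<epsilon> = spectral_norm D / w 0"
  have \<epsilon>: "0 \<le> \<epsilon>" using w(2) spectral_norm_nonneg[of D] by (simp add: \<epsilon>_def)
  have \<Delta>: "\<Delta> \<in> matpolys n m" by (auto simp: matpolys_def \<Delta>_def D_def)
  have "spectral_norm (\<Delta> j) \<le> \<epsilon> * w j" if "j \<le> m" for j
    using w(1)[OF that] w(2) mult_nonneg_nonneg[OF \<epsilon> w(1)[OF that]]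
    by (auto simp: \<Delta>_def spectral_norm_zero \<epsilon>_def)
  then have Q: "(\<lambda>j. P j + \<Delta> j) \<in> perturbations n m P \<epsilon> w" using \<Delta> by (auto simp: perturbations_def)
  have "\<mu> s \<in> spectrum_matpoly n m (\<lambda>j. P j + \<Delta> j)" if s: "1 \<le> s" "s \<le> k" for s
  proof -
    have [simp]: "dim_row (\<Delta> j) = n" "dim_col (\<Delta> j) = n" for j by (auto simp: \<Delta>_def D_def)
    have sn: "s - 1 < n" "s - 1 < k" using s \<open>k \<le> n\<close> by auto
    let ?e = "unit_vec n (s - 1) :: complex vec"
    have "eval_matpoly n m (\<lambda>j. P j + \<Delta> j) (\<mu> s) *\<^sub>v ?e = 0\<^sub>v n"
    proof (rule eq_vecI)
      fix r assume "r < dim_vec (0\<^sub>v n :: complex vec)"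
      then have r: "r < n" by simp
      have "(eval_matpoly n m (\<lambda>j. P j + \<Delta> j) (\<mu> s) *\<^sub>v ?e) $ r
          = (\<Sum>j\<le>m. (P j $$ (r, s - 1) + \<Delta> j $$ (r, s - 1)) * \<mu> s ^ j)"
        using r sn by (simp add: eval_matpoly_def)
      also have "\<dots> = eval_matpoly n m P (\<mu> s) $$ (r, s - 1) + (\<Sum>j\<le>m. if j = 0 then D $$ (r, s - 1) else 0)"
      proof -
        have "(\<Sum>j\<le>m. \<Delta> j $$ (r, s - 1) * \<mu> s ^ j) = (\<Sum>j\<le>m. if j = 0 then D $$ (r, s - 1) else 0)"
          using r sn by (intro sum.cong) (auto simp: \<Delta>_def)
        then show ?thesis
          using r sn by (simp add: eval_matpoly_def distrib_right sum.distrib)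
      qed
      also have "\<dots> = 0" using r sn s by (simp add: D_def)
      finally show "(eval_matpoly n m (\<lambda>j. P j + \<Delta> j) (\<mu> s) *\<^sub>v ?e) $ r = 0\<^sub>v n $ r" using r by simp
    qed (simp add: eval_matpoly_def)
    moreover have "?e \<noteq> 0\<^sub>v n" using sn by (metis index_unit_vec(1) index_zero_vec(1) zero_neq_one)
    ultimately show ?thesis unfolding spectrum_matpoly_def by (auto intro: bexI[of _ ?e])
  qed
  then have "\<mu> ` {1..k} \<subseteq> spectrum_matpoly n m (\<lambda>j. P j + \<Delta> j)" by auto
  with \<epsilon> Q show ?thesis by blast
qed

text \<open>Coefficients of a perturbation are encoded as a function on index triples, so that Tychonoff's theorem applies.\<close>

definition coeff_mat :: "nat \<Rightarrow> (nat \<times> nat \<times> nat \<Rightarrow> complex) \<Rightarrow> nat \<Rightarrow> complex mat" where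
  "coeff_mat n f j = mat n n (\<lambda>(r, c). f (j, r, c))"

text \<open>The product of balls is compact by Tychonoff, and each condition is closed: a norm bound
  is a family of inequalities between continuous functions, one for each vector of the unit ball,
  and the determinant is a polynomial. The radius \<open>\<epsilon>\<close> is itself a coordinate,
  so that minimizing it means minimizing a projection.\<close>

lemma compact_feasible_perturbations:
  fixes P :: matpoly and w :: "nat \<Rightarrow> real"
  assumes P: "\<And>j. P j \<in> carrier_mat n n"
  shows "compact {(\<epsilon>, f). \<epsilon> \<in> {0..b} \<and> f \<in> Pi\<^sub>E UNIV (\<lambda>_. cball 0 c)
    \<and> (\<forall>j\<le>m. spectral_norm (coeff_mat n f j) \<le> \<epsilon> * w j)
    \<and> (\<forall>x\<in>S. det (eval_matpoly n m (\<lambda>j. P j + coeff_mat n f j) x) = 0)}"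
proof -
  define K where "K = {0..b} \<times> Pi\<^sub>E UNIV (\<lambda>_ :: nat \<times> nat \<times> nat. cball (0 :: complex) c)"
  define X where "X = {x. x \<in> carrier_vec n \<and> vec_norm2 x \<le> 1}"
  have coord [continuous_intros]: "continuous_on UNIV (\<lambda>p. snd p i)"
    for i :: "nat \<times> nat \<times> nat" and p :: "real \<times> (nat \<times> nat \<times> nat \<Rightarrow> complex)"
    by (rule continuous_on_compose2[OF continuous_on_product_coordinates continuous_on_snd[OF continuous_on_id]]) auto
  have fst_cont: "continuous_on UNIV (\<lambda>p :: real \<times> (nat \<times> nat \<times> nat \<Rightarrow> complex). fst p)"
    by (rule continuous_on_fst[OF continuous_on_id])
  have norm_eq: "vec_norm2 (coeff_mat n f j *\<^sub>v x) = sqrt (\<Sum>r<n. (cmod (\<Sum>c<n. f (j, r, c) * x $ c))\<^sup>2)"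
    if "x \<in> X" for f j x
    using that
    by (auto simp: vec_norm2_def L2_set_def coeff_mat_def X_def scalar_prod_def atLeast0LessThan)
  \<comment> \<open>A bound on a supremum is an intersection of bounds, so closedness follows
    without continuity of the supremum.\<close>
  have spec: "spectral_norm (coeff_mat n f j) \<le> e \<longleftrightarrow> (\<forall>x\<in>X. vec_norm2 (coeff_mat n f j *\<^sub>v x) \<le> e)" for f j e
  proof
    assume *: "spectral_norm (coeff_mat n f j) \<le> e"
    have "vec_norm2 (coeff_mat n f j *\<^sub>v x) \<le> spectral_norm (coeff_mat n f j)" if "x \<in> X" for x
      using that by (intro spectral_norm_upper) (auto simp: X_def coeff_mat_def)
    with * show "\<forall>x\<in>X. vec_norm2 (coeff_mat n f j *\<^sub>v x) \<le> e" by fastforce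
  next
    assume "\<forall>x\<in>X. vec_norm2 (coeff_mat n f j *\<^sub>v x) \<le> e"
    then show "spectral_norm (coeff_mat n f j) \<le> e"
      by (intro spectral_norm_least) (auto simp: X_def coeff_mat_def)
  qed
  have det_eq: "det (eval_matpoly n m (\<lambda>j. P j + coeff_mat n f j) x)
    = (\<Sum>p | p permutes {0..<n}. signof p * (\<Prod>i = 0..<n. \<Sum>j\<le>m. (P j $$ (i, p i) + f (j, i, p i)) * x ^ j))" for f x
  proof -
    have "eval_matpoly n m (\<lambda>j. P j + coeff_mat n f j) x \<in> carrier_mat n n" by (simp add: eval_matpoly_def)
    moreover have "eval_matpoly n m (\<lambda>j. P j + coeff_mat n f j) x $$ (i, p i)
      = (\<Sum>j\<le>m. (P j $$ (i, p i) + f (j, i, p i)) * x ^ j)" if "p permutes {0..<n}" "i < n" for p i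
      using that permutes_in_image[OF that(1), of i] by (simp add: eval_matpoly_def coeff_mat_def)
    ultimately show ?thesis by (auto simp: det_def' intro!: sum.cong prod.cong)
  qed
  have "compactin (product_topology (\<lambda>_. euclidean) UNIV) (Pi\<^sub>E UNIV (\<lambda>_ :: nat \<times> nat \<times> nat. cball (0 :: complex) c))"
    by (subst compactin_PiE) auto
  then have "compact (Pi\<^sub>E UNIV (\<lambda>_ :: nat \<times> nat \<times> nat. cball (0 :: complex) c))"
    by (simp add: euclidean_product_topology)
  then have K: "compact K" unfolding K_def by (intro compact_Times) auto
  have "closed (\<Inter>j\<in>{..m}. \<Inter>x\<in>X. {p :: real \<times> (nat \<times> nat \<times> nat \<Rightarrow> complex). vec_norm2 (coeff_mat n (snd p) j *\<^sub>v x) \<le> fst p * w j})"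
    by (intro closed_INT ballI closed_Collect_le, subst norm_eq) (auto intro!: continuous_intros coord fst_cont)
  moreover have "closed (\<Inter>x\<in>S. {p :: real \<times> (nat \<times> nat \<times> nat \<Rightarrow> complex). det (eval_matpoly n m (\<lambda>j. P j + coeff_mat n (snd p) j) x) = 0})"
    unfolding det_eq by (intro closed_INT ballI closed_Collect_eq continuous_intros coord)
  ultimately have "compact (K \<inter> ((\<Inter>j\<in>{..m}. \<Inter>x\<in>X. {p. vec_norm2 (coeff_mat n (snd p) j *\<^sub>v x) \<le> fst p * w j})
      \<inter> (\<Inter>x\<in>S. {p. det (eval_matpoly n m (\<lambda>j. P j + coeff_mat n (snd p) j) x) = 0})))"
    using K by (intro compact_Int_closed closed_Int)
  also have "K \<inter> ((\<Inter>j\<in>{..m}. \<Inter>x\<in>X. {p. vec_norm2 (coeff_mat n (snd p) j *\<^sub>v x) \<le> fst p * w j})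
      \<inter> (\<Inter>x\<in>S. {p. det (eval_matpoly n m (\<lambda>j. P j + coeff_mat n (snd p) j) x) = 0}))
    = {(\<epsilon>, f). \<epsilon> \<in> {0..b} \<and> f \<in> Pi\<^sub>E UNIV (\<lambda>_. cball 0 c)
    \<and> (\<forall>j\<le>m. spectral_norm (coeff_mat n f j) \<le> \<epsilon> * w j)
    \<and> (\<forall>x\<in>S. det (eval_matpoly n m (\<lambda>j. P j + coeff_mat n f j) x) = 0)}"
    unfolding spec K_def by auto
  finally show ?thesis .
qed

text \<open>Turns norm bounds into entrywise bounds, which place the coefficients of a perturbation
  in a product of balls.\<close>

lemma cmod_index_le_spectral_norm:
  assumes "A \<in> carrier_mat nr nc" "r < nr" "c < nc"
  shows "cmod (A $$ (r, c)) \<le> spectral_norm A"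
proof -
  have "cmod (A $$ (r, c)) = cmod ((A *\<^sub>v unit_vec nc c) $ r)" using assms by simp
  also have "\<dots> \<le> vec_norm2 (A *\<^sub>v unit_vec nc c)"
    unfolding vec_norm2_def using assms by (intro member_le_L2_set) auto
  also have "\<dots> \<le> spectral_norm A * vec_norm2 (unit_vec nc c)"
    using assms by (intro spectral_norm_bound) auto
  also have "(vec_norm2 (unit_vec nc c))\<^sup>2 = (\<Sum>i<nc. if i = c then 1 else 0)"
    unfolding vec_norm2_sq using assms by (intro sum.cong) auto
  then have "vec_norm2 (unit_vec nc c) = 1"
    using assms vec_norm2_nonneg[of "unit_vec nc c"] by (simp add: power2_eq_1_iff)
  finally show ?thesis by simp
qed

text \<open>The feasible radii up to some feasible \<open>b\<close> are exactly the projection of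
  the compact set \<open>T\<close>, so a smallest one exists; radii above \<open>b\<close> are
  larger anyway. This minimum is the value of the \<open>LEAST\<close>.\<close>

lemma dist_spectrum_attained:
  assumes P: "P \<in> matpolys n m" and w: "\<And>j. j \<le> m \<Longrightarrow> 0 \<le> w j" "0 < w 0" and "k \<le> n"
    and S_def: "S = \<mu> ` {1..k}"
  shows "0 \<le> dist_spectrum n m P w S"
    and "\<exists>Q\<in>perturbations n m P (dist_spectrum n m P w S) w. S \<subseteq> spectrum_matpoly n m Q"
    and "0 \<le> \<epsilon> \<Longrightarrow> Q \<in> perturbations n m P \<epsilon> w \<Longrightarrow> S \<subseteq> spectrum_matpoly n m Q \<Longrightarrow> dist_spectrum n m P w S \<le> \<epsilon>"
proof -
  define feas where "feas \<epsilon> \<longleftrightarrow> 0 \<le> \<epsilon> \<and> (\<exists>Q\<in>perturbations n m P \<epsilon> w. S \<subseteq> spectrum_matpoly n m Q)" for \<epsilon>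
  have Pc: "P j \<in> carrier_mat n n" for j using P by (simp add: matpolys_def)
  obtain b where b: "feas b"
    using perturbation_exists[of P n m w k \<mu>, OF P w \<open>k \<le> n\<close>] by (auto simp: feas_def S_def)
  \<comment> \<open>An entry of coefficient \<open>j\<close> has modulus at most
    \<open>\<epsilon> * w j \<le> b * w j\<close>; the sum over \<open>j\<close> bounds all of these
    at once.\<close>
  define c where "c = b * (\<Sum>j\<le>m. w j)"
  define T where "T = {(\<epsilon>, f). \<epsilon> \<in> {0..b} \<and> f \<in> Pi\<^sub>E UNIV (\<lambda>_. cball 0 c)
    \<and> (\<forall>j\<le>m. spectral_norm (coeff_mat n f j) \<le> \<epsilon> * w j)
    \<and> (\<forall>x\<in>S. det (eval_matpoly n m (\<lambda>j. P j + coeff_mat n f j) x) = 0)}"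
  have T: "compact T" unfolding T_def by (rule compact_feasible_perturbations[OF Pc])
  have feas_T: "\<epsilon> \<in> fst ` T" if "feas \<epsilon>" "\<epsilon> \<le> b" for \<epsilon>
  proof -
    from that(1) obtain \<Delta> where \<Delta>: "\<Delta> \<in> matpolys n m" "\<And>j. j \<le> m \<Longrightarrow> spectral_norm (\<Delta> j) \<le> \<epsilon> * w j"
      "S \<subseteq> spectrum_matpoly n m (\<lambda>j. P j + \<Delta> j)" and \<epsilon>: "0 \<le> \<epsilon>"
      by (auto simp: feas_def perturbations_def)
    define f where "f = (\<lambda>(j, r, c). if j \<le> m \<and> r < n \<and> c < n then \<Delta> j $$ (r, c) else 0)"
    have \<Delta>c: "\<Delta> j \<in> carrier_mat n n" for j using \<Delta>(1) by (simp add: matpolys_def)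
    have fM: "coeff_mat n f j = \<Delta> j" for j
    proof (cases "j \<le> m")
      case False
      then have "\<Delta> j = 0\<^sub>m n n" using \<Delta>(1) by (simp add: matpolys_def)
      then show ?thesis using False by (intro eq_matI) (auto simp: coeff_mat_def f_def)
    qed (use \<Delta>c[of j] in \<open>auto intro!: eq_matI simp: coeff_mat_def f_def\<close>)
    have c0: "0 \<le> c" using that(2) \<epsilon> w(1) by (auto simp: c_def intro!: mult_nonneg_nonneg sum_nonneg)
    have "cmod (f (j, r, c')) \<le> c" for j r c'
    proof (cases "j \<le> m \<and> r < n \<and> c' < n")
      case True
      then have "cmod (f (j, r, c')) \<le> spectral_norm (\<Delta> j)"
        using cmod_index_le_spectral_norm[OF \<Delta>c] by (simp add: f_def)
      also have "\<dots> \<le> \<epsilon> * w j" using \<Delta>(2) True by simp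
      also have "\<dots> \<le> b * w j" using that(2) w(1) True by (intro mult_right_mono) auto
      also have "\<dots> \<le> c"
        unfolding c_def using True w(1) that(2) \<epsilon> by (intro mult_left_mono member_le_sum) auto
      finally show ?thesis .
    qed (auto simp: f_def c0)
    then have "f \<in> Pi\<^sub>E UNIV (\<lambda>_. cball 0 c)" by auto
    moreover have "det (eval_matpoly n m (\<lambda>j. P j + \<Delta> j) x) = 0" if "x \<in> S" for x
      using \<Delta>(3) that in_spectrum_iff_det by blast
    ultimately have "(\<epsilon>, f) \<in> T" using \<Delta>(2) \<epsilon> that(2) by (simp add: T_def fM)
    then show ?thesis by force
  qed
  have T_feas: "feas \<epsilon>" if T': "(\<epsilon>, f) \<in> T" for \<epsilon> f
  proof -
    \<comment> \<open>\<open>T\<close> constrains norms only for \<open>j \<le> m\<close>; cutting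
      off the rest gives a member of \<open>matpolys\<close> with the same evaluations.\<close>
    define \<Delta> where "\<Delta> j = (if j \<le> m then coeff_mat n f j else 0\<^sub>m n n)" for j
    have "\<Delta> \<in> matpolys n m" by (auto simp: matpolys_def \<Delta>_def coeff_mat_def)
    moreover have "spectral_norm (\<Delta> j) \<le> \<epsilon> * w j" if "j \<le> m" for j
      using T' that by (simp add: T_def \<Delta>_def)
    ultimately have "(\<lambda>j. P j + \<Delta> j) \<in> perturbations n m P \<epsilon> w" by (auto simp: perturbations_def)
    moreover have "eval_matpoly n m (\<lambda>j. P j + \<Delta> j) x = eval_matpoly n m (\<lambda>j. P j + coeff_mat n f j) x" for x
      by (intro eq_matI) (auto simp: eval_matpoly_def \<Delta>_def intro!: sum.cong)
    then have "S \<subseteq> spectrum_matpoly n m (\<lambda>j. P j + \<Delta> j)"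
      using T' by (auto simp: T_def in_spectrum_iff_det)
    ultimately show ?thesis using T' by (auto simp: feas_def T_def)
  qed
  have "T \<noteq> {}" using feas_T[OF b] by auto
  then obtain p where p: "p \<in> T" "\<And>q. q \<in> T \<Longrightarrow> fst p \<le> fst q"
    using continuous_attains_inf[OF T _ continuous_on_fst[OF continuous_on_id]] by blast
  have least: "fst p \<le> \<epsilon>" if "feas \<epsilon>" for \<epsilon>
  proof (cases "\<epsilon> \<le> b")
    case True
    then show ?thesis using feas_T[OF that] p(2) by auto
  next
    case False
    then show ?thesis using p(1) by (auto simp: T_def)
  qed
  have feas_p: "feas (fst p)" using T_feas[of "fst p" "snd p"] p(1) by simp
  have "dist_spectrum n m P w S = fst p"
    unfolding dist_spectrum_def feas_def[symmetric] by (rule Least_equality) (rule feas_p, rule least)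
  then show "0 \<le> dist_spectrum n m P w S"
    "\<exists>Q\<in>perturbations n m P (dist_spectrum n m P w S) w. S \<subseteq> spectrum_matpoly n m Q"
    "0 \<le> \<epsilon> \<Longrightarrow> Q \<in> perturbations n m P \<epsilon> w \<Longrightarrow> S \<subseteq> spectrum_matpoly n m Q \<Longrightarrow> dist_spectrum n m P w S \<le> \<epsilon>"
    using feas_p least[of \<epsilon>] by (auto simp: feas_def)
qed

section \<open>The upper bound\<close>

text \<open>The rank counts an independent subset of the set of columns, so repeated columns are
  excluded first: they would leave fewer than \<open>nc\<close> vectors to choose from. After that,
  a nonzero kernel vector contradicts independence.\<close>

lemma full_rank_imp_inj:
  fixes A :: "complex mat"
  assumes A: "A \<in> carrier_mat n nc" and rank: "vec_space.rank n A = nc"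
    and a: "a \<in> carrier_vec nc" "A *\<^sub>v a = 0\<^sub>v n"
  shows "a = 0\<^sub>v nc"
proof -
  interpret vec_space "TYPE(complex)" n .
  have "distinct (cols A)"
  proof (rule ccontr)
    assume "\<not> distinct (cols A)"
    then have "card (set (cols A)) < nc"
      using A card_distinct[of "cols A"] card_length[of "cols A"] by (auto simp: le_less)
    moreover have "lin_indpt {}" by (rule finite_lin_indpt2) auto
    then obtain S where S: "maximal S (\<lambda>T. T \<subseteq> set (cols A) \<and> lin_indpt T)"
      using maximal_exists_superset[of "set (cols A)" "\<lambda>T. T \<subseteq> set (cols A) \<and> lin_indpt T" "{}"]
      by auto
    then have "card S \<le> card (set (cols A))" by (simp add: card_mono maximal_def)
    ultimately show False using rank_card_indpt[OF A S] rank by simp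
  qed
  then show ?thesis using full_rank_lin_indpt[OF A rank] lin_depI[OF A a(1) _ a(2)] by blast
qed

lemma mat_adjoint_one [simp]: "mat_adjoint (1\<^sub>m n :: complex mat) = 1\<^sub>m n"
  by (rule eq_matI) auto

text \<open>Injectivity makes the Gram matrix \<open>G\<close> invertible, since
  \<open>G a = 0\<close> gives \<open>A a = 0\<close>. With \<open>B\<close> the inverse of
  \<open>G\<close>, the matrix \<open>B * mat_adjoint A\<close> satisfies the Penrose equations. As
  \<open>pinv\<close> is defined by \<open>THE\<close>, uniqueness has to be shown as well.\<close>

lemma pinv_left_inverse:
  assumes A: "A \<in> carrier_mat n k"
    and inj: "\<And>a. a \<in> carrier_vec k \<Longrightarrow> A *\<^sub>v a = 0\<^sub>v n \<Longrightarrow> a = 0\<^sub>v k"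
  shows "pinv A \<in> carrier_mat k n" "pinv A * A = 1\<^sub>m k"
proof -
  note aA = mat_adjoint_carrier[OF A]
  define G where "G = mat_adjoint A * A"
  have G: "G \<in> carrier_mat k k" unfolding G_def by (rule mult_carrier_mat[OF aA A])
  have GH: "mat_adjoint G = G" by (simp add: G_def mat_adjoint_mult[OF aA A])
  have "det G \<noteq> 0"
  proof
    assume "det G = 0"
    then obtain a where a: "a \<in> carrier_vec k" "a \<noteq> 0\<^sub>v k" "G *\<^sub>v a = 0\<^sub>v k"
      using det_0_iff_vec_prod_zero[OF G] by blast
    have Aa: "A *\<^sub>v a \<in> carrier_vec n" using A a(1) by (rule mult_mat_vec_carrier)
    have "(A *\<^sub>v a) \<bullet>c (A *\<^sub>v a) = a \<bullet>c (G *\<^sub>v a)"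
      using cscalar_prod_mat_adjoint[OF A a(1) Aa] assoc_mult_mat_vec[OF aA A a(1)] by (simp add: G_def)
    also have "\<dots> = 0" using a by simp
    finally have "vec_norm2 (A *\<^sub>v a) = 0" by (simp add: cscalar_prod_self)
    then show False using vec_norm2_eq_0[OF Aa] inj[OF a(1)] a(2) by simp
  qed
  then obtain B where B: "B \<in> carrier_mat k k" "B * G = 1\<^sub>m k" "G * B = 1\<^sub>m k"
    using det_non_zero_imp_unit[OF G, of "()"] by (auto simp: Units_def ring_mat_def)
  note aB = mat_adjoint_carrier[OF B(1)]
  have BH: "mat_adjoint B = B"
  proof -
    have "mat_adjoint B * G = 1\<^sub>m k"
      using mat_adjoint_mult[OF G B(1)] B(3) GH by (metis mat_adjoint_one)
    then have "mat_adjoint B * (G * B) = B"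
      using assoc_mult_mat[OF aB G B(1)] B(1) by simp
    then show ?thesis by (simp only: B(3) right_mult_one_mat[OF aB])
  qed
  define X where "X = B * mat_adjoint A"
  have X: "X \<in> carrier_mat k n" using B aA by (simp add: X_def)
  have XA: "X * A = 1\<^sub>m k"
    unfolding X_def using assoc_mult_mat[OF B(1) aA A] B(2) by (simp add: G_def)
  have AX: "mat_adjoint (A * X) = A * X"
    unfolding X_def using assoc_mult_mat[OF A B(1) aA] mult_carrier_mat[OF B(1) aA]
    by (simp add: mat_adjoint_mult[OF A] mat_adjoint_mult[OF B(1) aA] BH)
  have "is_pinv A X"
    using A X XA AX assoc_mult_mat[OF A X A] by (simp add: is_pinv_def)
  \<comment> \<open>Both \<open>A * X\<close> and \<open>A * Y\<close> are Hermitian projections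
    that absorb each other, so taking adjoints identifies them; multiplying by \<open>X\<close> on
    the left then cancels \<open>A\<close>.\<close>
  moreover have "Y = X" if "is_pinv A Y" for Y
  proof -
    have Y: "Y \<in> carrier_mat k n" "A * Y * A = A" "Y * A * Y = Y" "mat_adjoint (A * Y) = A * Y"
      using that A by (auto simp: is_pinv_def)
    have AYc: "A * Y \<in> carrier_mat n n" and AXc: "A * X \<in> carrier_mat n n" using A X Y by auto
    have YA: "Y * A = 1\<^sub>m k"
    proof -
      note YAc = mult_carrier_mat[OF Y(1) A]
      have "Y * A = X * A * (Y * A)" by (simp only: XA left_mult_one_mat[OF YAc])
      also have "\<dots> = X * (A * Y * A)"
        by (simp only: assoc_mult_mat[OF X A YAc] assoc_mult_mat[OF A Y(1) A])
      finally show ?thesis by (simp only: Y(2) XA)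
    qed
    have "(A * X) * (A * Y) = A * Y"
      using assoc_mult_mat[OF A X AYc] assoc_mult_mat[OF X A Y(1)] XA Y(1) by simp
    then have "mat_adjoint ((A * X) * (A * Y)) = mat_adjoint (A * Y)" by (rule arg_cong)
    then have "(A * Y) * (A * X) = A * Y" by (simp add: mat_adjoint_mult[OF AXc AYc] Y(4) AX)
    moreover have "(A * Y) * (A * X) = A * X"
      using assoc_mult_mat[OF A Y(1) AXc] assoc_mult_mat[OF Y(1) A X] YA X by simp
    ultimately have "A * Y = A * X" by simp
    then have "(X * A) * Y = (X * A) * X"
      using assoc_mult_mat[OF X A Y(1)] assoc_mult_mat[OF X A X] by simp
    then show "Y = X" using XA X Y(1) by simp
  qed
  ultimately have "pinv A = X" unfolding pinv_def by (rule the_equality)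
  then show "pinv A \<in> carrier_mat k n" "pinv A * A = 1\<^sub>m k" using X XA by simp_all
qed

section \<open>Block matrices and their hat versions\<close>

lemma block_mat_index:
  assumes "r < n" "j < k"
  shows "block_mat n k x $$ (r, j) = block n x (Suc j) $ r"
  using assms by (simp add: block_mat_def mat_of_cols_index del: upt_Suc)

lemma hat_mat_index:
  assumes "r < n" "j < k"
  shows "hat_mat n k \<mu> \<gamma> x $$ (r, j) = hat_block n \<mu> \<gamma> x (Suc j) $ r"
  using assms by (simp add: hat_mat_def mat_of_cols_index del: upt_Suc)

lemma block_mat_carrier [simp, intro]: "block_mat n k x \<in> carrier_mat n k"
  by (auto simp: block_mat_def intro!: carrier_matI)

lemma hat_mat_carrier [simp, intro]: "hat_mat n k \<mu> \<gamma> x \<in> carrier_mat n k"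
  by (auto simp: hat_mat_def intro!: carrier_matI)

lemma dim_hat_mat [simp]: "dim_row (hat_mat n k \<mu> \<gamma> x) = n" "dim_col (hat_mat n k \<mu> \<gamma> x) = k"
  by (simp_all only: carrier_matD[OF hat_mat_carrier])

lemma dim_block_mat [simp]: "dim_row (block_mat n k x) = n" "dim_col (block_mat n k x) = k"
  by (simp_all only: carrier_matD[OF block_mat_carrier])

lemma hat_block_carrier [simp, intro]: "hat_block n \<mu> \<gamma> x p \<in> carrier_vec n"
  by (simp add: hat_block_def)

lemma hat_mat_mult_unit_vec:
  assumes "1 \<le> p" "p \<le> k"
  shows "hat_mat n k \<mu> \<gamma> x *\<^sub>v unit_vec k (p - 1) = hat_block n \<mu> \<gamma> x p"
  using assms by (intro eq_vecI) (auto simp: hat_mat_index hat_block_def)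

lemma hat_mat_eq:
  "hat_mat n k \<mu> \<gamma> x = block_mat n k x * mat k k (\<lambda>(j, p). if j \<le> p then hat_coeff \<mu> \<gamma> (Suc p) (Suc j) else 0)"
proof (rule eq_matI)
  let ?H = "mat k k (\<lambda>(j, p). if j \<le> p then hat_coeff \<mu> \<gamma> (Suc p) (Suc j) else 0)"
  fix r p assume "r < dim_row (block_mat n k x * ?H)" "p < dim_col (block_mat n k x * ?H)"
  then have rp: "r < n" "p < k" by simp_all
  have "hat_mat n k \<mu> \<gamma> x $$ (r, p) = (\<Sum>j = 1..Suc p. hat_coeff \<mu> \<gamma> (Suc p) j * block n x j $ r)"
    using rp by (simp add: hat_mat_index hat_block_eq)
  also have "\<dots> = (\<Sum>j\<le>p. hat_coeff \<mu> \<gamma> (Suc p) (Suc j) * block n x (Suc j) $ r)"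
    by (rule sum.reindex_bij_witness[of _ Suc "\<lambda>j. j - 1"]) auto
  also have "\<dots> = (\<Sum>j<k. block_mat n k x $$ (r, j) * ?H $$ (j, p))"
    using rp by (intro sum.mono_neutral_cong_left) (auto simp: block_mat_index mult.commute)
  also have "\<dots> = (block_mat n k x * ?H) $$ (r, p)"
    using rp by (simp add: scalar_prod_def atLeast0LessThan)
  finally show "hat_mat n k \<mu> \<gamma> x $$ (r, p) = (block_mat n k x * ?H) $$ (r, p)" .
qed simp_all

text \<open>The matrix of the hat transformation is upper triangular with unit diagonal, hence of
  determinant 1. This carries the rank condition over to the matrix whose pseudoinverse is
  taken.\<close>

lemma hat_mat_inj:
  assumes inj: "\<And>a. a \<in> carrier_vec k \<Longrightarrow> block_mat n k x *\<^sub>v a = 0\<^sub>v n \<Longrightarrow> a = 0\<^sub>v k"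
    and a: "a \<in> carrier_vec k" "hat_mat n k \<mu> \<gamma> x *\<^sub>v a = 0\<^sub>v n"
  shows "a = 0\<^sub>v k"
proof -
  define H where "H = mat k k (\<lambda>(j, p). if j \<le> p then hat_coeff \<mu> \<gamma> (Suc p) (Suc j) else 0)"
  have H: "H \<in> carrier_mat k k" by (simp add: H_def)
  have "block_mat n k x *\<^sub>v (H *\<^sub>v a) = 0\<^sub>v n"
    using a(2) assoc_mult_mat_vec[OF block_mat_carrier H a(1)] by (simp add: hat_mat_eq H_def)
  then have Ha: "H *\<^sub>v a = 0\<^sub>v k" using inj[OF mult_mat_vec_carrier[OF H a(1)]] by simp
  have "det H = prod_list (diag_mat H)"
    by (rule det_upper_triangular[OF _ H]) (auto simp: H_def)
  also have "diag_mat H = replicate k 1"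
    by (rule nth_equalityI) (auto simp: diag_mat_def H_def)
  finally have "det H \<noteq> 0" by simp
  then show ?thesis using det_0_iff_vec_prod_zero[OF H] a(1) Ha by blast
qed

lemma hat_block_smult:
  assumes "x \<in> carrier_vec (n * k)" "1 \<le> p" "p \<le> k"
  shows "hat_block n \<mu> \<gamma> (c \<cdot>\<^sub>v x) p = c \<cdot>\<^sub>v hat_block n \<mu> \<gamma> x p"
proof -
  have "block n (c \<cdot>\<^sub>v x) j $ r = c * block n x j $ r" if "1 \<le> j" "j \<le> p" "r < n" for j r
    using that assms block_index_less[of j k r n] by (simp add: block_def)
  then show ?thesis
    unfolding hat_block_eq[OF assms(2)] by (intro eq_vecI) (auto simp: sum_distrib_left mult_ac)
qed

section \<open>Boundary points of the perturbation class\<close>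

lemma matpoly_minus_in_perturbations:
  assumes "P \<in> matpolys n m" "R \<in> perturbations n m P \<epsilon> w" "j \<le> m"
  shows "spectral_norm (R j - P j) \<le> \<epsilon> * w j"
proof -
  obtain \<Delta> where \<Delta>: "R = (\<lambda>j. P j + \<Delta> j)" "\<Delta> \<in> matpolys n m" "spectral_norm (\<Delta> j) \<le> \<epsilon> * w j"
    using assms by (auto simp: perturbations_def)
  have "P j \<in> carrier_mat n n" "\<Delta> j \<in> carrier_mat n n" using assms(1) \<Delta>(2) by (auto simp: matpolys_def)
  then have "R j - P j = \<Delta> j" unfolding \<Delta>(1) by (intro eq_matI) auto
  with \<Delta>(3) show ?thesis by simp
qed

lemma perturbations_subset:
  assumes "P \<in> matpolys n m"
  shows "perturbations n m P \<epsilon> w \<subseteq> matpolys n m"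
  using assms by (auto simp: perturbations_def matpolys_def)

text \<open>Scaling \<open>A\<close> up works unless its norm is 0; then \<open>A\<close> is zero
  and the identity works, whose norm is positive as \<open>n \<ge> 1\<close>. One \<open>M\<close>
  must serve all \<open>\<delta>\<close>, because \<open>\<delta>\<close> is later chosen from the
  norm of \<open>M\<close>.\<close>

lemma exists_norm_increasing_direction:
  assumes "A \<in> carrier_mat n n" "1 \<le> n"
  obtains M where "M \<in> carrier_mat n n" "0 < spectral_norm M"
    "\<And>\<delta>. 0 < \<delta> \<Longrightarrow> spectral_norm A < spectral_norm (A + complex_of_real \<delta> \<cdot>\<^sub>m M)"
proof (cases "spectral_norm A = 0")
  case True
  then have A0: "A = 0\<^sub>m n n" using spectral_norm_eq_0D[OF assms(1)] by simp
  have "1\<^sub>m n \<noteq> (0\<^sub>m n n :: complex mat)"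
  proof
    assume "1\<^sub>m n = (0\<^sub>m n n :: complex mat)"
    from arg_cong[OF this, of "\<lambda>M. M $$ (0, 0)"] show False using assms(2) by simp
  qed
  then have "spectral_norm (1\<^sub>m n) \<noteq> 0" using spectral_norm_eq_0D[of "1\<^sub>m n" n n] by auto
  then have pos: "0 < spectral_norm (1\<^sub>m n)" using spectral_norm_nonneg[of "1\<^sub>m n"] by linarith
  show ?thesis
  proof (rule that[of "1\<^sub>m n"])
    show "spectral_norm A < spectral_norm (A + complex_of_real \<delta> \<cdot>\<^sub>m 1\<^sub>m n)" if "0 < \<delta>" for \<delta>
      using that pos True by (simp add: A0 spectral_norm_smult)
  qed (use pos in auto)
next
  case False
  then have pos: "0 < spectral_norm A" using spectral_norm_nonneg[of A] by linarith
  show ?thesis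
  proof (rule that[of A])
    fix \<delta> :: real assume \<delta>: "0 < \<delta>"
    have "A + complex_of_real \<delta> \<cdot>\<^sub>m A = complex_of_real (1 + \<delta>) \<cdot>\<^sub>m A"
      using assms(1) by (intro eq_matI) (auto simp: ring_distribs)
    then have "spectral_norm (A + complex_of_real \<delta> \<cdot>\<^sub>m A) = (1 + \<delta>) * spectral_norm A"
      using \<delta> by (simp only: spectral_norm_smult norm_of_real)
    then show "spectral_norm A < spectral_norm (A + complex_of_real \<delta> \<cdot>\<^sub>m A)"
      using pos \<delta> by (simp add: ring_distribs)
  qed (use pos assms in auto)
qed

text \<open>The polynomial belongs to the class, hence to its closure. It is not interior:
  coefficient \<open>j0\<close> already attains its bound, and an arbitrarily small move along a
  norm-increasing direction exceeds it.\<close>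

lemma perturbation_in_frontier:
  assumes P: "P \<in> matpolys n m" and \<Delta>: "\<Delta> \<in> matpolys n m"
    and bound: "\<And>j. j \<le> m \<Longrightarrow> spectral_norm (\<Delta> j) \<le> \<epsilon> * w j"
    and tight: "j0 \<le> m" "spectral_norm (\<Delta> j0) = \<epsilon> * w j0" and n: "1 \<le> n"
  shows "(\<lambda>j. P j + \<Delta> j) \<in> matpoly_topology n m frontier_of perturbations n m P \<epsilon> w"
proof -
  interpret Metric_space "matpolys n m" "matpoly_dist n m" by (rule Metric_space_matpolys)
  let ?Q = "\<lambda>j. P j + \<Delta> j" and ?B = "perturbations n m P \<epsilon> w"
  have Q: "?Q \<in> ?B" using \<Delta> bound by (auto simp: perturbations_def)
  have Pc: "P j \<in> carrier_mat n n" and \<Delta>c: "\<Delta> j \<in> carrier_mat n n" for j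
    using P \<Delta> by (auto simp: matpolys_def)
  have QM: "?Q \<in> matpolys n m" using Q perturbations_subset[OF P] by blast
  have "?Q \<in> mtopology closure_of ?B"
    using closure_of_subset[of ?B mtopology] perturbations_subset[OF P] Q by auto
  moreover have "?Q \<notin> mtopology interior_of ?B"
  proof
    assume "?Q \<in> mtopology interior_of ?B"
    then obtain r where r: "0 < r" "mball ?Q r \<subseteq> ?B" by (auto simp: metric_interior_of)
    obtain M where M: "M \<in> carrier_mat n n" "0 < spectral_norm M"
      "\<And>\<delta>. 0 < \<delta> \<Longrightarrow> spectral_norm (\<Delta> j0) < spectral_norm (\<Delta> j0 + complex_of_real \<delta> \<cdot>\<^sub>m M)"
      using exists_norm_increasing_direction[OF \<Delta>c n] by blast
    \<comment> \<open>The move \<open>\<delta>\<close> times \<open>M\<close> has norm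
      \<open>r / 2\<close>, so \<open>R\<close> stays inside the ball of radius
      \<open>r\<close>.\<close>
    define \<delta> where "\<delta> = r / (2 * spectral_norm M)"
    have \<delta>: "0 < \<delta>" using r M by (simp add: \<delta>_def)
    define R where "R j = (if j = j0 then ?Q j + complex_of_real \<delta> \<cdot>\<^sub>m M else ?Q j)" for j
    have R: "R \<in> matpolys n m" using QM M(1) tight(1) by (auto simp: matpolys_def R_def)
    have "matpoly_dist n m ?Q R = (\<Sum>j\<le>m. if j = j0 then \<delta> * spectral_norm M else 0)"
      unfolding matpoly_dist_def
    proof (rule sum.cong)
      fix j assume "j \<in> {..m}"
      have "mat n n (\<lambda>(r, c). ?Q j $$ (r, c) - R j $$ (r, c))
          = (if j = j0 then complex_of_real (- \<delta>) \<cdot>\<^sub>m M else 0\<^sub>m n n)"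
        using M(1) Pc[of j] \<Delta>c[of j] by (intro eq_matI) (auto simp: R_def)
      then show "spectral_norm (mat n n (\<lambda>(r, c). ?Q j $$ (r, c) - R j $$ (r, c)))
          = (if j = j0 then \<delta> * spectral_norm M else 0)"
        using \<delta> by (simp add: spectral_norm_smult spectral_norm_zero)
    qed simp
    also have "\<dots> = r / 2" using tight(1) M(2) by (simp add: \<delta>_def)
    finally have "R \<in> mball ?Q r" using R QM r(1) by (simp add: in_mball)
    then have "spectral_norm (R j0 - P j0) \<le> \<epsilon> * w j0"
      using r(2) matpoly_minus_in_perturbations[OF P _ tight(1)] by blast
    also have "R j0 - P j0 = \<Delta> j0 + complex_of_real \<delta> \<cdot>\<^sub>m M"
      using M(1) Pc[of j0] \<Delta>c[of j0] by (intro eq_matI) (auto simp: R_def)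
    finally show False using M(3)[OF \<delta>] tight(2) by simp
  qed
  ultimately show ?thesis by (simp add: frontier_of_def)
qed

section \<open>Mean direction coefficients and their size\<close>

lemma weight_pos:
  assumes "\<And>j. j \<le> m \<Longrightarrow> 0 \<le> w j" "0 < w 0" "0 \<le> x"
  shows "0 < weight m w x"
proof -
  have "w 0 * x ^ 0 \<le> weight m w x"
    unfolding weight_def using assms by (intro member_le_sum) auto
  with assms(2) show ?thesis by simp
qed

text \<open>Exhibits \<open>beta\<close> as the value at \<open>\<mu> s\<close> of the scalar
  polynomial that multiplies \<open>Delta\<close> in \<open>Delta_poly\<close>.\<close>

lemma beta_eq_sum_dir_coeff:
  "beta m k w \<mu> s = (\<Sum>j\<le>m. (1 / of_nat k * (\<Sum>i = 1..k. dir_coeff m w \<mu> i j)) * \<mu> s ^ j)"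
proof -
  have "beta m k w \<mu> s = 1 / of_nat k * (\<Sum>i = 1..k. \<Sum>j\<le>m. dir_coeff m w \<mu> i j * \<mu> s ^ j)"
    by (simp add: beta_def alpha_def dir_coeff_def sum_distrib_left mult_ac)
  also have "(\<Sum>i = 1..k. \<Sum>j\<le>m. dir_coeff m w \<mu> i j * \<mu> s ^ j) = (\<Sum>j\<le>m. \<Sum>i = 1..k. dir_coeff m w \<mu> i j * \<mu> s ^ j)"
    by (rule sum.swap)
  finally show ?thesis by (simp add: sum_distrib_left sum_distrib_right mult.assoc)
qed

text \<open>The quotient of \<open>cnj (\<mu> i)\<close> by the modulus of \<open>\<mu> i\<close>
  has modulus 1, or 0 when \<open>\<mu> i = 0\<close>, so its powers have modulus at most 1; the
  triangle inequality does the rest.\<close>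

lemma cmod_mean_dir_coeff_le:
  assumes w: "\<And>j. j \<le> m \<Longrightarrow> 0 \<le> w j" "0 < w 0" and "j \<le> m"
  shows "cmod (1 / of_nat k * (\<Sum>i = 1..k. dir_coeff m w \<mu> i j))
    \<le> 1 / real k * (\<Sum>i = 1..k. 1 / weight m w (cmod (\<mu> i))) * w j"
proof -
  have W: "0 < weight m w (cmod (\<mu> i))" for i using w by (intro weight_pos) auto
  have "cmod (dir_coeff m w \<mu> i j) \<le> 1 / weight m w (cmod (\<mu> i)) * w j" for i
  proof -
    have "cmod (cnj (\<mu> i) / complex_of_real (cmod (\<mu> i))) \<le> 1" by (simp add: norm_divide)
    then have "cmod ((cnj (\<mu> i) / complex_of_real (cmod (\<mu> i))) ^ j) \<le> 1"
      unfolding norm_power by (intro power_le_one) auto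
    then have "1 / weight m w (cmod (\<mu> i)) * cmod ((cnj (\<mu> i) / complex_of_real (cmod (\<mu> i))) ^ j) * w j
        \<le> 1 / weight m w (cmod (\<mu> i)) * 1 * w j"
      using W[of i] w(1)[OF \<open>j \<le> m\<close>]
      by (intro mult_right_mono mult_left_mono) auto
    then show ?thesis
      using W[of i] w(1)[OF \<open>j \<le> m\<close>]
      by (simp add: dir_coeff_def norm_mult norm_divide)
  qed
  then have "cmod (\<Sum>i = 1..k. dir_coeff m w \<mu> i j) \<le> (\<Sum>i = 1..k. 1 / weight m w (cmod (\<mu> i)) * w j)"
    by (rule sum_norm_le)
  then have "1 / real k * cmod (\<Sum>i = 1..k. dir_coeff m w \<mu> i j)
      \<le> 1 / real k * (\<Sum>i = 1..k. 1 / weight m w (cmod (\<mu> i)) * w j)"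
    by (rule mult_left_mono) simp
  then show ?thesis by (simp add: norm_mult norm_divide sum_distrib_right mult.assoc)
qed

text \<open>At \<open>j = 0\<close> every phase factor is 1, also for \<open>\<mu> i = 0\<close>
  because \<open>0 ^ 0 = 1\<close>. The sum consists of nonnegative reals, so nothing is lost in the
  triangle inequality.\<close>

lemma cmod_mean_dir_coeff_0:
  assumes w: "\<And>j. j \<le> m \<Longrightarrow> 0 \<le> w j" "0 < w 0"
  shows "cmod (1 / of_nat k * (\<Sum>i = 1..k. dir_coeff m w \<mu> i 0))
    = 1 / real k * (\<Sum>i = 1..k. 1 / weight m w (cmod (\<mu> i))) * w 0"
proof -
  have "1 / of_nat k * (\<Sum>i = 1..k. dir_coeff m w \<mu> i 0)
      = complex_of_real (1 / real k * (\<Sum>i = 1..k. 1 / weight m w (cmod (\<mu> i))) * w 0)"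
    by (simp add: dir_coeff_def sum_distrib_right)
  moreover have "0 < weight m w (cmod (\<mu> i))" for i using w by (intro weight_pos) auto
  then have "0 \<le> 1 / real k * (\<Sum>i = 1..k. 1 / weight m w (cmod (\<mu> i))) * w 0"
    using w(2)
    by (intro mult_nonneg_nonneg sum_nonneg) (auto simp: less_imp_le)
  ultimately show ?thesis by (metis abs_of_nonneg norm_of_real)
qed

lemma Delta_carrier:
  assumes "pinv (hat_mat n k \<mu> \<gamma> v) \<in> carrier_mat k n"
  shows "Delta n m k P w \<mu> \<gamma> u v \<in> carrier_mat n n"
  unfolding Delta_def
  by (intro smult_carrier_mat mult_carrier_mat[OF mult_carrier_mat[OF hat_mat_carrier mat_diag_dim] assms])

text \<open>The null vector is hat block \<open>s\<close> of \<open>v\<close>, nonzero because the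
  hat matrix is injective. Being column \<open>s\<close> of that matrix, it is sent by the
  pseudoinverse to a unit vector, so \<open>Delta\<close> maps it to hat block \<open>s\<close> of
  \<open>u\<close> times \<open>- \<sigma>\<close> divided by \<open>beta\<close>; evaluation at
  \<open>\<mu> s\<close> multiplies by \<open>beta\<close> again.\<close>

lemma Q_poly_spectrum:
  assumes P: "P \<in> matpolys n m" and inj: "inj_on \<mu> {1..k}"
    and beta: "\<And>s. 1 \<le> s \<Longrightarrow> s \<le> k \<Longrightarrow> beta m k w \<mu> s \<noteq> 0"
    and uv: "singular_pair (F_mat n m k P \<mu> \<gamma>) (s_rho n m k P \<mu> \<gamma>) u v"
    and rank: "vec_space.rank n (block_mat n k v) = k"
    and s: "1 \<le> s" "s \<le> k"
  shows "\<mu> s \<in> spectrum_matpoly n m (Q_poly n m k P w \<mu> \<gamma> u v)"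
proof -
  define \<sigma> where "\<sigma> = complex_of_real (s_rho n m k P \<mu> \<gamma>)"
  let ?U = "hat_mat n k \<mu> \<gamma> u" and ?V = "hat_mat n k \<mu> \<gamma> v"
  let ?B = "mat_diag k (\<lambda>s. 1 / beta m k w \<mu> (s + 1))"
  let ?D = "Delta n m k P w \<mu> \<gamma> u v" and ?e = "unit_vec k (s - 1) :: complex vec"
  let ?hu = "hat_block n \<mu> \<gamma> u s" and ?hv = "hat_block n \<mu> \<gamma> v s"
  have Vinj: "a = 0\<^sub>v k" if "a \<in> carrier_vec k" "?V *\<^sub>v a = 0\<^sub>v n" for a
    using hat_mat_inj[OF full_rank_imp_inj[OF block_mat_carrier rank] that] .
  have u: "u \<in> carrier_vec (n * k)" and v: "v \<in> carrier_vec (n * k)"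
    and Fv: "F_mat n m k P \<mu> \<gamma> *\<^sub>v v = \<sigma> \<cdot>\<^sub>v u"
    using uv by (auto simp: singular_pair_def \<sigma>_def)
  have pinv: "pinv ?V \<in> carrier_mat k n" "pinv ?V * ?V = 1\<^sub>m k"
    by (rule pinv_left_inverse[OF hat_mat_carrier], rule Vinj, assumption+)+
  have e: "?e \<in> carrier_vec k" by simp
  have Ve: "?V *\<^sub>v ?e = ?hv" and Ue: "?U *\<^sub>v ?e = ?hu" using hat_mat_mult_unit_vec[OF s] by auto
  have e0: "?e \<noteq> 0\<^sub>v k"
  proof
    assume "?e = 0\<^sub>v k"
    from arg_cong[OF this, of "\<lambda>x. x $ (s - 1)"] show False using s by simp
  qed
  have hv0: "?hv \<noteq> 0\<^sub>v n" using Vinj[OF e] e0 Ve by auto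
  have "?D *\<^sub>v ?hv = (- \<sigma> / beta m k w \<mu> s) \<cdot>\<^sub>v ?hu"
  proof -
    have hv: "?hv \<in> carrier_vec n" by simp
    have "pinv ?V *\<^sub>v ?hv = pinv ?V *\<^sub>v (?V *\<^sub>v ?e)" by (simp only: Ve)
    also have "\<dots> = (pinv ?V * ?V) *\<^sub>v ?e"
      by (rule assoc_mult_mat_vec[OF pinv(1) hat_mat_carrier e, symmetric])
    also have "\<dots> = ?e" unfolding pinv(2) by simp
    finally have "pinv ?V *\<^sub>v ?hv = ?e" .
    then have "(?U * ?B * pinv ?V) *\<^sub>v ?hv = (?U * ?B) *\<^sub>v ?e"
      using assoc_mult_mat_vec[OF mult_carrier_mat[OF hat_mat_carrier mat_diag_dim] pinv(1) hv] by simp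
    also have "\<dots> = ?U *\<^sub>v (?B *\<^sub>v ?e)"
      by (rule assoc_mult_mat_vec[OF hat_mat_carrier mat_diag_dim e])
    \<comment> \<open>\<open>mat_diag\<close> counts from 0, so the entry met by \<open>?e\<close>
      is the one at \<open>s - 1\<close>, which is \<open>1 / beta m k w \<mu> s\<close>.\<close>
    also have "?B *\<^sub>v ?e = (1 / beta m k w \<mu> s) \<cdot>\<^sub>v ?e"
      using s by (intro eq_vecI) (auto simp: mat_diag_def)
    also have "?U *\<^sub>v \<dots> = (1 / beta m k w \<mu> s) \<cdot>\<^sub>v ?hu"
      using mult_mat_vec[OF hat_mat_carrier e] Ue by simp
    finally have *: "(?U * ?B * pinv ?V) *\<^sub>v ?hv = (1 / beta m k w \<mu> s) \<cdot>\<^sub>v ?hu" .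
    have C: "?U * ?B * pinv ?V \<in> carrier_mat n n"
      by (rule mult_carrier_mat[OF mult_carrier_mat[OF hat_mat_carrier mat_diag_dim] pinv(1)])
    have "?D *\<^sub>v ?hv = (- \<sigma>) \<cdot>\<^sub>v ((?U * ?B * pinv ?V) *\<^sub>v ?hv)"
      unfolding Delta_def \<sigma>_def[symmetric] by (rule smult_mat_mult_vec[OF C hv])
    then show ?thesis unfolding * by (simp add: smult_smult_assoc)
  qed
  note D = this
  have Dc: "?D \<in> carrier_mat n n" by (rule Delta_carrier[OF pinv(1)])
  have Pc: "P j \<in> carrier_mat n n" for j using P by (simp add: matpolys_def)
  have eval: "eval_matpoly n m (Q_poly n m k P w \<mu> \<gamma> u v) (\<mu> s) = eval_matpoly n m P (\<mu> s) + beta m k w \<mu> s \<cdot>\<^sub>m ?D"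
  proof (rule eq_matI)
    fix r c assume "r < dim_row (eval_matpoly n m P (\<mu> s) + beta m k w \<mu> s \<cdot>\<^sub>m ?D)"
      "c < dim_col (eval_matpoly n m P (\<mu> s) + beta m k w \<mu> s \<cdot>\<^sub>m ?D)"
    then have rc: "r < n" "c < n" using Dc by auto
    let ?a = "\<lambda>j. 1 / of_nat k * (\<Sum>i = 1..k. dir_coeff m w \<mu> i j)"
    have "eval_matpoly n m (Q_poly n m k P w \<mu> \<gamma> u v) (\<mu> s) $$ (r, c)
        = (\<Sum>j\<le>m. P j $$ (r, c) * \<mu> s ^ j + (?a j * \<mu> s ^ j) * ?D $$ (r, c))"
      unfolding eval_matpoly_def using rc Dc Pc
      by (auto simp: Q_poly_def Delta_poly_def distrib_right intro!: sum.cong)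
    also have "\<dots> = (\<Sum>j\<le>m. P j $$ (r, c) * \<mu> s ^ j) + beta m k w \<mu> s * ?D $$ (r, c)"
      unfolding beta_eq_sum_dir_coeff sum.distrib sum_distrib_right ..
    finally show "eval_matpoly n m (Q_poly n m k P w \<mu> \<gamma> u v) (\<mu> s) $$ (r, c)
      = (eval_matpoly n m P (\<mu> s) + beta m k w \<mu> s \<cdot>\<^sub>m ?D) $$ (r, c)"
      using rc Dc by (simp add: eval_matpoly_def)
  qed (use Dc in \<open>auto simp: eval_matpoly_def\<close>)
  have "eval_matpoly n m P (\<mu> s) *\<^sub>v ?hv = \<sigma> \<cdot>\<^sub>v ?hu"
    using hat_block_F_mat[OF v s inj, of \<gamma> m P] hat_block_smult[OF u s] by (simp add: Fv)
  then have "eval_matpoly n m (Q_poly n m k P w \<mu> \<gamma> u v) (\<mu> s) *\<^sub>v ?hv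
      = \<sigma> \<cdot>\<^sub>v ?hu + beta m k w \<mu> s \<cdot>\<^sub>v (?D *\<^sub>v ?hv)"
    unfolding eval using Dc
    by (subst add_mult_distrib_mat_vec[of _ n n]) (auto simp: eval_matpoly_def smult_mat_mult_vec[of _ n n])
  also have "\<dots> = 0\<^sub>v n"
    unfolding D using beta[OF s] by (intro eq_vecI) (auto simp: hat_block_def)
  finally show ?thesis
    unfolding spectrum_matpoly_def using hv0 by (auto intro!: bexI[of _ ?hv])
qed

text \<open>The factor of \<open>beta_up\<close> in front of the norm of \<open>Delta\<close> is the
  bound of \<open>cmod_mean_dir_coeff_le\<close> with \<open>w j\<close> taken out. It holds for all
  \<open>j \<le> m\<close>, which puts the polynomial in the class, and with equality at
  \<open>j = 0\<close>, which puts it on the frontier.\<close>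

lemma Q_poly_upper_bound:
  assumes P: "P \<in> matpolys n m" and w: "\<And>j. j \<le> m \<Longrightarrow> 0 \<le> w j" "0 < w 0" and n: "1 \<le> n"
    and rank: "vec_space.rank n (block_mat n k v) = k"
    and b_def: "b = beta_up n m k P w \<mu> \<gamma> u v"
  shows "0 \<le> b" "Q_poly n m k P w \<mu> \<gamma> u v \<in> perturbations n m P b w"
    "Q_poly n m k P w \<mu> \<gamma> u v \<in> matpoly_topology n m frontier_of perturbations n m P b w"
proof -
  let ?D = "Delta n m k P w \<mu> \<gamma> u v" and ?\<Delta> = "Delta_poly n m k P w \<mu> \<gamma> u v"
  have "pinv (hat_mat n k \<mu> \<gamma> v) \<in> carrier_mat k n"
    using hat_mat_inj[OF full_rank_imp_inj[OF block_mat_carrier rank]]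
    by (intro pinv_left_inverse(1)[OF hat_mat_carrier]) blast
  then have D: "?D \<in> carrier_mat n n" by (rule Delta_carrier)
  have \<Delta>: "?\<Delta> \<in> matpolys n m" using D by (auto simp: matpolys_def Delta_poly_def)
  have W: "0 < weight m w (cmod (\<mu> i))" for i using w by (intro weight_pos) auto
  show b0: "0 \<le> b" unfolding b_def beta_up_def
    using W by (intro mult_nonneg_nonneg sum_nonneg spectral_norm_nonneg) (auto simp: less_imp_le)
  have norm: "spectral_norm (?\<Delta> j) = cmod (1 / of_nat k * (\<Sum>i = 1..k. dir_coeff m w \<mu> i j)) * spectral_norm ?D"
    if "j \<le> m" for j
    using that by (simp only: Delta_poly_def spectral_norm_smult if_True)
  have bound: "spectral_norm (?\<Delta> j) \<le> b * w j" if "j \<le> m" for j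
  proof -
    have "cmod (1 / of_nat k * (\<Sum>i = 1..k. dir_coeff m w \<mu> i j))
        \<le> 1 / real k * (\<Sum>i = 1..k. 1 / weight m w (cmod (\<mu> i))) * w j"
      using w that by (rule cmod_mean_dir_coeff_le)
    from mult_right_mono[OF this spectral_norm_nonneg[of ?D]] show ?thesis
      unfolding norm[OF that] b_def beta_up_def by (simp only: mult_ac)
  qed
  have "cmod (1 / of_nat k * (\<Sum>i = 1..k. dir_coeff m w \<mu> i 0))
      = 1 / real k * (\<Sum>i = 1..k. 1 / weight m w (cmod (\<mu> i))) * w 0"
    using w by (rule cmod_mean_dir_coeff_0)
  then have tight: "spectral_norm (?\<Delta> 0) = b * w 0"
    unfolding norm[OF le0] b_def beta_up_def by (simp only: mult_ac)
  have "Q_poly n m k P w \<mu> \<gamma> u v = (\<lambda>j. P j + ?\<Delta> j)" by (simp add: Q_poly_def)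
  then show "Q_poly n m k P w \<mu> \<gamma> u v \<in> perturbations n m P b w"
    "Q_poly n m k P w \<mu> \<gamma> u v \<in> matpoly_topology n m frontier_of perturbations n m P b w"
    using perturbation_in_frontier[OF P \<Delta> bound _ tight n] \<Delta> bound by (auto simp: perturbations_def)
qed

theorem theorem4p3:
  fixes n m k :: nat
    and P :: matpoly
    and w :: "nat \<Rightarrow> real"
    and \<mu> :: "nat \<Rightarrow> complex"
  assumes "P \<in> matpolys n m"
    and "invertible_mat (P m)"
    and "\<forall>j\<le>m. 0 \<le> w j"
    and "0 < w 0"
    and "1 \<le> k" and "k \<le> n"
    and "inj_on \<mu> {1..k}"
  shows "(\<forall>\<gamma>>0. beta_low n m k P w \<mu> \<gamma> \<le> dist_spectrum n m P w (\<mu> ` {1..k})) \<and>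
    ((\<forall>s\<in>{1..k}. beta m k w \<mu> s \<noteq> 0) \<longrightarrow>
      (\<forall>\<gamma>>0. \<forall>u v.
        singular_pair (F_mat n m k P \<mu> \<gamma>) (s_rho n m k P \<mu> \<gamma>) u v \<and>
        vec_space.rank n (block_mat n k v) = k \<longrightarrow>
          dist_spectrum n m P w (\<mu> ` {1..k}) \<le> beta_up n m k P w \<mu> \<gamma> u v \<and>
          Q_poly n m k P w \<mu> \<gamma> u v \<in>
            matpoly_topology n m frontier_of
              perturbations n m P (beta_up n m k P w \<mu> \<gamma> u v) w))"
proof -
  note P = assms(1) and k = assms(5,6) and inj = assms(7)
  have w: "\<And>j. j \<le> m \<Longrightarrow> 0 \<le> w j" "0 < w 0" using assms(3,4) by auto
  let ?S = "\<mu> ` {1..k}"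
  let ?d = "dist_spectrum n m P w ?S"
  have least: "?d \<le> \<epsilon>"
    if "0 \<le> \<epsilon>" "Q \<in> perturbations n m P \<epsilon> w" "?S \<subseteq> spectrum_matpoly n m Q" for \<epsilon> Q
    using P w k(2) refl that by (rule dist_spectrum_attained(3))
  have d0: "0 \<le> ?d"
    using P w k(2) refl by (rule dist_spectrum_attained(1))
  have "\<exists>Q\<in>perturbations n m P ?d w. ?S \<subseteq> spectrum_matpoly n m Q"
    using P w k(2) refl by (rule dist_spectrum_attained(2))
  then obtain Q where Q: "Q \<in> perturbations n m P ?d w" "?S \<subseteq> spectrum_matpoly n m Q" by blast
  \<comment> \<open>The lower bound holds for every feasible radius; it is applied at the minimal
    one, which is feasible by attainment.\<close>
  have "beta_low n m k P w \<mu> \<gamma> \<le> ?d" if "0 < \<gamma>" for \<gamma>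
    by (rule beta_low_le[OF P k inj d0 less_imp_le[OF that] Q])
  moreover have "?d \<le> beta_up n m k P w \<mu> \<gamma> u v"
    "Q_poly n m k P w \<mu> \<gamma> u v
      \<in> matpoly_topology n m frontier_of perturbations n m P (beta_up n m k P w \<mu> \<gamma> u v) w"
    if "\<forall>s\<in>{1..k}. beta m k w \<mu> s \<noteq> 0"
      and "singular_pair (F_mat n m k P \<mu> \<gamma>) (s_rho n m k P \<mu> \<gamma>) u v"
      and rank: "vec_space.rank n (block_mat n k v) = k" for \<gamma> u v
  proof -
    have n: "1 \<le> n" using k by simp
    have "?S \<subseteq> spectrum_matpoly n m (Q_poly n m k P w \<mu> \<gamma> u v)"
      using Q_poly_spectrum[OF P inj _ that(2) rank] that(1) by auto
    moreover have "0 \<le> beta_up n m k P w \<mu> \<gamma> u v"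
      using P w n rank refl by (rule Q_poly_upper_bound(1))
    moreover have "Q_poly n m k P w \<mu> \<gamma> u v \<in> perturbations n m P (beta_up n m k P w \<mu> \<gamma> u v) w"
      using P w n rank refl by (rule Q_poly_upper_bound(2))
    ultimately show "?d \<le> beta_up n m k P w \<mu> \<gamma> u v" by (intro least)
    show "Q_poly n m k P w \<mu> \<gamma> u v
        \<in> matpoly_topology n m frontier_of perturbations n m P (beta_up n m k P w \<mu> \<gamma> u v) w"
      using P w n rank refl by (rule Q_poly_upper_bound(3))
  qed
  ultimately show ?thesis by blast
qed

end
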